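(* Let $k\ge 2$. For each color $i\in\{1,\dots,k\}$ let an unordered list of $m_i\ge1$ positive lengths be given, and consider oriented circles of color $i$ with these lengths, where circles of the same color and same length are indistinguishable. Let $l_i$ be the sum of the lengths of the circles of color $i$, $l=l_1+\dots+l_k$, and $|\mathrm{Aut}_i|$ the number of permutations of the circles of color $i$ that preserve their lengths. Then the volume of the space of circle cacti glued from these circles equals $$l^{k-2}\prod_{i=1}^k \frac{(l-l_i)^{m_i-1}}{|\mathrm{Aut}_i|}.$$
   Context: A circle constellation is a connected oriented graph with nonnegative edge lengths obtained by gluing together, at finitely many points, oriented circles of given lengths colored in colors $1,\dots,k$, such that two circles of the same color never share a point; it is naturally embedded in a compact oriented surface so that each circle bounds a disc of the complement, is oriented counterclockwise with respect to it, and at each gluing point the cyclic order of the circles agrees with the increasing order of colors. A circle cactus is a circle constellation that has no cycles other than the circles themselves. The volume measure on the space of circle cacti glued from given circles is: on the locus where no three circles share a point, take as local coordinates the lengths of all but one of the arcs into which each circle is cut by its gluing points, and use $|d\lambda_1\wedge\dots\wedge d\lambda_d|$; the locus where three or more circles share a point has measure $0$. For indistinguishable circles the space is the quotient of the space with labeled circles by relabelings, with the induced measure. *)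

theory Defs
  imports "HOL-Analysis.Analysis" "HOL-Library.Real_Mod" "HOL-Library.Disjoint_Sets"
    "HOL-Combinatorics.Permutations"
begin

text \<open>
  The circle with label \<open>c \<in> C\<close> is \<open>\<real> / len c \<int>\<close>, with points represented by \<open>(c, x)\<close>,
  \<open>0 \<le> x < len c\<close>, and oriented in the direction of increasing \<open>x\<close>.  A gluing is given by the
  set \<open>V\<close> of its gluing points, each of them being the set of (at least two) points of circles
  that are identified.  The embedding of the glued graph into an oriented surface carries no
  further data: the cyclic order at every gluing point is prescribed by the colours.
\<close>

context
  fixes C :: "'c set" and color :: "'c \<Rightarrow> nat" and len :: "'c \<Rightarrow> real"
begin

definition circle_points :: "('c \<times> real) set" where
  "circle_points = (SIGMA c:C. {0..<len c})"

text \<open>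
  Injectivity of the colour on \<open>v\<close> says that two circles of the same colour never share a point,
  and also that no circle is glued to itself.  A union of circles is connected iff any two
  circles are joined by a chain of circles in which consecutive ones share a point.
\<close>

definition constellation :: "('c \<times> real) set set \<Rightarrow> bool" where
  "constellation V \<longleftrightarrow>
     finite V \<and> disjoint V \<and> \<Union>V \<subseteq> circle_points \<and>
     (\<forall>v\<in>V. 2 \<le> card v \<and> inj_on (color \<circ> fst) v) \<and>
     C \<times> C \<subseteq> {(c, c'). \<exists>v\<in>V. c \<in> fst ` v \<and> c' \<in> fst ` v}\<^sup>*"

text \<open>
  The glued graph has vertex set \<open>V\<close>.  Its edges are the arcs into which the circles are cut by
  their gluing points; an arc is represented by its initial point, so that \<open>\<Union>V\<close> is the set of
  edges.  The distance \<open>arc_dist c x y\<close> from \<open>x\<close> to \<open>y\<close> along the orientation takes values in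
  \<open>{0<..len c}\<close>: from \<open>x\<close> to itself one goes once around the circle.
\<close>

definition arc_dist :: "'c \<Rightarrow> real \<Rightarrow> real \<Rightarrow> real" where
  "arc_dist c x y = (if x < y then y - x else y - x + len c)"

definition arc_length :: "('c \<times> real) set set \<Rightarrow> 'c \<times> real \<Rightarrow> real" where
  "arc_length V p = Min {arc_dist (fst p) (snd p) y | y. (fst p, y) \<in> \<Union>V}"

definition arc_end :: "('c \<times> real) set set \<Rightarrow> 'c \<times> real \<Rightarrow> 'c \<times> real" where
  "arc_end V p = (fst p, (snd p + arc_length V p) rmod len (fst p))"

definition arc_joins ::
  "('c \<times> real) set set \<Rightarrow> 'c \<times> real \<Rightarrow> ('c \<times> real) set \<Rightarrow> ('c \<times> real) set \<Rightarrow> bool" where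
  "arc_joins V p v w \<longleftrightarrow> p \<in> v \<and> arc_end V p \<in> w \<or> p \<in> w \<and> arc_end V p \<in> v"

text \<open>
  Simple cycles of the underlying undirected multigraph; length 1 is a loop, length 2 a pair of
  parallel edges.
\<close>

definition graph_cycle ::
  "('c \<times> real) set set \<Rightarrow> ('c \<times> real) set list \<Rightarrow> ('c \<times> real) list \<Rightarrow> bool" where
  "graph_cycle V vs es \<longleftrightarrow>
     es \<noteq> [] \<and> length vs = length es \<and> distinct vs \<and> distinct es \<and> set vs \<subseteq> V \<and> set es \<subseteq> \<Union>V \<and>
     (\<forall>i<length es. arc_joins V (es ! i) (vs ! i) (vs ! (Suc i mod length es)))"

definition cacti :: "('c \<times> real) set set set" where
  "cacti = {V. constellation V \<and>
     (\<forall>vs es. graph_cycle V vs es \<longrightarrow> (\<exists>c\<in>C. set es = {p \<in> \<Union>V. fst p = c}))}"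

text \<open>
  Isomorphisms respecting the labels are the rotations of the individual circles.
\<close>

definition rotate_circles :: "('c \<Rightarrow> real) \<Rightarrow> ('c \<times> real) set set \<Rightarrow> ('c \<times> real) set set" where
  "rotate_circles \<theta> V = image (\<lambda>(c, x). (c, (x + \<theta> c) rmod len c)) ` V"

definition rotation_rel :: "(('c \<times> real) set set \<times> ('c \<times> real) set set) set" where
  "rotation_rel = {(V, W). V \<in> cacti \<and> W \<in> cacti \<and> (\<exists>\<theta>. W = rotate_circles \<theta> V)}"

definition labelled_cacti :: "('c \<times> real) set set set set" where
  "labelled_cacti = cacti // rotation_rel"

definition generic_cacti :: "('c \<times> real) set set set" where
  "generic_cacti = {V \<in> cacti. \<forall>v\<in>V. card v = 2}"

text \<open>
  Two circles of a cactus share at most one point.  Hence in a generic cactus an arc is named by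
  the pair \<open>(c, c')\<close> such that it lies on \<open>c\<close> and begins where \<open>c\<close> is glued to \<open>c'\<close>.  The
  combinatorial type records, as triples \<open>(c, c', c'')\<close>, that on \<open>c\<close> the gluing point with \<open>c'\<close>
  is followed by the gluing point with \<open>c''\<close>.
\<close>

definition arc_type :: "('c \<times> real) set set \<Rightarrow> ('c \<times> 'c \<times> 'c) set" where
  "arc_type V = {(c, c', c''). \<exists>v\<in>V. \<exists>w\<in>V. \<exists>x. (c, x) \<in> v \<and> arc_end V (c, x) \<in> w \<and>
     c' \<in> fst ` v - {c} \<and> c'' \<in> fst ` w - {c}}"

definition gluing_position :: "('c \<times> real) set set \<Rightarrow> 'c \<Rightarrow> 'c \<Rightarrow> real" where
  "gluing_position V c c' = (THE x. \<exists>v\<in>V. (c, x) \<in> v \<and> c' \<in> fst ` v)"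

text \<open>
  One arbitrarily chosen arc is omitted on each circle; the volume does not depend on the choice,
  since the lengths of the arcs of \<open>c\<close> add up to \<open>len c\<close>.
\<close>

definition omitted_arc :: "('c \<times> 'c \<times> 'c) set \<Rightarrow> 'c \<Rightarrow> 'c" where
  "omitted_arc \<tau> c = (SOME c'. \<exists>c''. (c, c', c'') \<in> \<tau>)"

definition coord_arcs :: "('c \<times> 'c \<times> 'c) set \<Rightarrow> ('c \<times> 'c) set" where
  "coord_arcs \<tau> = {(c, c'). (\<exists>c''. (c, c', c'') \<in> \<tau>) \<and> c' \<noteq> omitted_arc \<tau> c}"

definition arc_coords :: "('c \<times> real) set set \<Rightarrow> 'c \<times> 'c \<Rightarrow> real" where
  "arc_coords V = (\<lambda>(c, c')\<in>coord_arcs (arc_type V). arc_length V (c, gluing_position V c c'))"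

text \<open>
  The set of coordinate vectors of the generic cacti of type \<open>\<tau>\<close> belonging to a set \<open>A\<close> of
  isomorphism classes.
\<close>

definition chart_image ::
  "('c \<times> 'c \<times> 'c) set \<Rightarrow> ('c \<times> real) set set set set \<Rightarrow> ('c \<times> 'c \<Rightarrow> real) set" where
  "chart_image \<tau> A = arc_coords ` {V \<in> generic_cacti. arc_type V = \<tau> \<and> V \<in> \<Union>A}"

definition labelled_measure :: "('c \<times> real) set set set measure" where
  "labelled_measure = measure_of labelled_cacti
     {A. A \<subseteq> labelled_cacti \<and>
         (\<forall>\<tau>. chart_image \<tau> A \<in> sets (PiM (coord_arcs \<tau>) (\<lambda>_. lborel)))}
     (\<lambda>A. \<Sum>\<tau>\<in>arc_type ` generic_cacti.
         emeasure (PiM (coord_arcs \<tau>) (\<lambda>_. lborel)) (chart_image \<tau> A))"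

definition relabelings :: "('c \<Rightarrow> 'c) set" where
  "relabelings = {\<sigma>. \<sigma> permutes C \<and> (\<forall>c\<in>C. color (\<sigma> c) = color c \<and> len (\<sigma> c) = len c)}"

definition relabel :: "('c \<Rightarrow> 'c) \<Rightarrow> ('c \<times> real) set set \<Rightarrow> ('c \<times> real) set set" where
  "relabel \<sigma> V = image (map_prod \<sigma> id) ` V"

definition relabel_rel :: "(('c \<times> real) set set set \<times> ('c \<times> real) set set set) set" where
  "relabel_rel = {(X, Y). X \<in> labelled_cacti \<and> Y \<in> labelled_cacti \<and>
     (\<exists>\<sigma>\<in>relabelings. Y = relabel \<sigma> ` X)}"

definition cactus_space :: "('c \<times> real) set set set set set" where
  "cactus_space = labelled_cacti // relabel_rel"

end

text \<open>
  The measure induced on the quotient by an equivalence relation with finite classes: a point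
  of \<open>M\<close> is weighted by the inverse of the size of its class, so that every class is counted
  once.  The projection is thus locally measure preserving wherever it is a covering, that is,
  the local coordinates on the quotient are those upstairs.
\<close>

definition quotient_measure :: "'a measure \<Rightarrow> ('a \<times> 'a) set \<Rightarrow> 'a set measure" where
  "quotient_measure M R = measure_of (space M // R)
     {B. B \<subseteq> space M // R \<and> \<Union>B \<in> sets M}
     (\<lambda>B. \<integral>\<^sup>+x\<in>\<Union>B. ennreal (1 / real (card (R `` {x}))) \<partial>M)"

definition cactus_measure ::
  "'c set \<Rightarrow> ('c \<Rightarrow> nat) \<Rightarrow> ('c \<Rightarrow> real) \<Rightarrow> ('c \<times> real) set set set set measure" where
  "cactus_measure C color len =
     quotient_measure (labelled_measure C color len) (relabel_rel C color len)"

end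

theory Submission
  imports Defs "HOL-Combinatorics.Multiset_Permutations" "HOL-Library.Transitive_Closure_Table"
begin

text \<open>
  A generic cactus is a spanning tree of the circles without monochromatic edges, together with the
  positions of the gluing points on each circle. A circle of length \<open>L\<close> with \<open>d\<close> gluing points
  contributes \<open>(d - 1)!\<close> cyclic orders, each with a simplex of arc lengths of volume
  \<open>L ^ (d - 1) / (d - 1)!\<close>. The volume of the labelled space is therefore the sum over these trees
  of the product of the \<open>L ^ (d - 1)\<close>, and this sum factorises: putting the length of a circle to
  zero leaves the trees in which that circle is a leaf, so both sides satisfy the same recursion on
  the coordinate hyperplanes, which determines them since their degree is less than the number of
  variables. Finally, a nontrivial relabeling fixes a cactus only if two different arcs have the same
  length, and such cacti form a null set; so almost all orbits have the size of the relabeling group.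
\<close>



subsection \<open>Trees\<close>

text \<open>\<open>cacti\<close> is defined by simple cycles of the glued multigraph, while the
  enumeration needs trees whose vertices are the circles, and this gap is the geometric half of the
  proof. That trees give cacti rests on bridges: a simple cycle that changes circles at a gluing
  point would have to come back through that same point. That generic cacti give trees is shown by
  exhibiting a forbidden cycle through any gluing point left over by a spanning tree. The
  enumeration is a coloured Cayley formula. It is stated for arbitrary real weights, since it is
  proved by evaluating both sides where some weights are 0, which no circle has as its length. With
  \<open>n\<close> circles both sides have degree \<open>n - 2\<close>: each tree contributes
  \<open>2 * (n - 1) - n\<close>, and the product has \<open>k - 2\<close> factors \<open>l\<close>
  besides \<open>m_i - 1\<close> factors for each colour. Trees are generated by attaching leaves
  because both the recursion and the bridge property proceed leaf by leaf.\<close>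

inductive tree :: "'a set \<Rightarrow> 'a set set \<Rightarrow> bool" where
  singleton: "tree {v} {}"
| add_leaf: "tree S E \<Longrightarrow> u \<in> S \<Longrightarrow> v \<notin> S \<Longrightarrow> tree (insert v S) (insert {u, v} E)"

definition nbrs :: "'a set set \<Rightarrow> 'a \<Rightarrow> 'a set" where
  "nbrs E v = {u. {v, u} \<in> E}"

lemma nbrs_sym: "u \<in> nbrs E v \<longleftrightarrow> v \<in> nbrs E u"
  by (simp add: nbrs_def insert_commute)

lemma tree_finite: "tree S E \<Longrightarrow> finite S \<and> finite E"
  by (induction rule: tree.induct) auto

lemma tree_edge_subset: "tree S E \<Longrightarrow> e \<in> E \<Longrightarrow> e \<subseteq> S"
  by (induction rule: tree.induct) auto

lemma tree_edgeE:
  assumes "tree S E" "e \<in> E"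
  obtains u v where "e = {u, v}" "u \<noteq> v" "u \<in> S" "v \<in> S"
  using assms by (induction arbitrary: thesis rule: tree.induct) blast+

lemma tree_nbrs_subset: "tree S E \<Longrightarrow> nbrs E v \<subseteq> S - {v}"
proof
  fix u assume "tree S E" "u \<in> nbrs E v"
  then have "{v, u} \<in> E" by (simp add: nbrs_def)
  with \<open>tree S E\<close> show "u \<in> S - {v}"
    by (elim tree_edgeE) (auto simp: doubleton_eq_iff)
qed

lemma tree_nbrs_outside: "tree S E \<Longrightarrow> v \<notin> S \<Longrightarrow> nbrs E v = {}"
  using tree_edge_subset[of S E] by (force simp: nbrs_def)

lemma finite_nbrs: "tree S E \<Longrightarrow> finite (nbrs E v)"
  by (meson finite_subset finite_Diff tree_finite tree_nbrs_subset)

lemma nbrs_add_leaf: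
  assumes "tree S E" "u \<in> S" "v \<notin> S"
  shows "nbrs (insert {u, v} E) w = (if w = v then {u} else if w = u then insert v (nbrs E u) else nbrs E w)"
  using assms tree_nbrs_outside[OF assms(1,3)]
  by (auto simp: nbrs_def doubleton_eq_iff)

lemma tree_nbrs_nonempty: "tree S E \<Longrightarrow> v \<in> S \<Longrightarrow> S \<noteq> {v} \<Longrightarrow> nbrs E v \<noteq> {}"
proof (induction arbitrary: v rule: tree.induct)
  case (add_leaf S E u z)
  then show ?case
    by (cases "v = z"; cases "v = u") (auto simp: nbrs_add_leaf)
qed simp

lemma tree_card_nbrs_pos:
  assumes "tree S E" "v \<in> S" "2 \<le> card S"
  shows "0 < card (nbrs E v)"
proof -
  have "S \<noteq> {v}" using assms(3) by auto
  then show ?thesis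
    using assms tree_nbrs_nonempty[of S E v] finite_nbrs[of S E v] by (simp add: card_gt_0_iff)
qed

text \<open>The vertex attached last is a leaf. In the enumeration its variable is the one missing
  from the monomial of the tree.\<close>

lemma tree_has_leaf: "tree S E \<Longrightarrow> 2 \<le> card S \<Longrightarrow> \<exists>v\<in>S. card (nbrs E v) = 1"
proof (induction rule: tree.cases)
  case (add_leaf S' E' u v)
  then show ?case by (auto simp: nbrs_add_leaf intro!: bexI[of _ v])
qed simp

lemma tree_connected:
  "tree S E \<Longrightarrow> u \<in> S \<Longrightarrow> v \<in> S \<Longrightarrow> (u, v) \<in> {(a, b). {a, b} \<in> E}\<^sup>*"
proof (induction arbitrary: u v rule: tree.induct)
  case (add_leaf S E w z)
  let ?r = "\<lambda>E. {(a, b). {a, b} \<in> E}"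
  have mono: "(?r E)\<^sup>* \<subseteq> (?r (insert {w, z} E))\<^sup>*" by (intro rtrancl_mono) auto
  have wz: "(w, z) \<in> (?r (insert {w, z} E))\<^sup>*" and zw: "(z, w) \<in> (?r (insert {w, z} E))\<^sup>*"
    by (auto simp: insert_commute)
  have *: "(a, b) \<in> (?r (insert {w, z} E))\<^sup>*" if "a \<in> S" "b \<in> S" for a b
    using add_leaf.IH[OF that] mono by blast
  show ?case
    using add_leaf.prems add_leaf.hyps * wz zw by (auto intro: rtrancl_trans)
qed simp

text \<open>Every edge of a tree is a bridge; \<open>Q\<close> is one side of it.\<close>

lemma tree_edge_cut:
  assumes "tree S E" "{c, c'} \<in> E"
  obtains Q where "c \<in> Q" "c' \<notin> Q" "\<And>e. e \<in> E \<Longrightarrow> e \<noteq> {c, c'} \<Longrightarrow> e \<subseteq> Q \<or> e \<inter> Q = {}"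
proof -
  have "\<exists>Q. c \<in> Q \<and> c' \<notin> Q \<and> (\<forall>e\<in>E. e \<noteq> {c, c'} \<longrightarrow> e \<subseteq> Q \<or> e \<inter> Q = {})"
    using assms
  proof (induction arbitrary: c c' rule: tree.induct)
    case (add_leaf S E u z)
    show ?case
    proof (cases "{c, c'} = {u, z}")
      case True
      from add_leaf have uz: "u \<noteq> z" by auto
      have nz: "z \<notin> e" if "e \<in> E" for e
        using tree_edge_subset[OF add_leaf.hyps(1) that] add_leaf.hyps by auto
      show ?thesis
      proof (cases "c = z")
        case True
        with \<open>{c, c'} = {u, z}\<close> uz nz show ?thesis
          by (intro exI[of _ "{z}"]) (auto simp: doubleton_eq_iff)
      next
        case False
        with \<open>{c, c'} = {u, z}\<close> uz nz show ?thesis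
          by (intro exI[of _ "- {z}"]) (auto simp: doubleton_eq_iff)
      qed
    next
      case False
      with add_leaf.prems have "{c, c'} \<in> E" by auto
      from add_leaf.IH[OF this] obtain Q where Q: "c \<in> Q" "c' \<notin> Q"
        "\<forall>e\<in>E. e \<noteq> {c, c'} \<longrightarrow> e \<subseteq> Q \<or> e \<inter> Q = {}" by blast
      have cS: "c \<in> S" "c' \<in> S" using tree_edge_subset[OF add_leaf.hyps(1) \<open>{c, c'} \<in> E\<close>] by auto
      have nz: "z \<notin> e" if "e \<in> E" for e
        using tree_edge_subset[OF add_leaf.hyps(1) that] add_leaf.hyps by auto
      \<comment> \<open>The new vertex \<open>z\<close> goes to the side of \<open>u\<close>, its
        only neighbour, so that the new edge does not cross the cut.\<close>
      define Q' where "Q' = (if u \<in> Q then insert z Q else Q - {z})"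
      have "c \<in> Q'" "c' \<notin> Q'" using Q cS add_leaf.hyps by (auto simp: Q'_def)
      moreover have "e \<subseteq> Q' \<or> e \<inter> Q' = {}" if "e \<in> insert {u, z} E" "e \<noteq> {c, c'}" for e
      proof (cases "e = {u, z}")
        case True
        then show ?thesis using add_leaf.hyps by (auto simp: Q'_def)
      next
        case False
        then have "e \<in> E" using that by auto
        then have "e \<subseteq> Q \<or> e \<inter> Q = {}" "z \<notin> e" using Q(3) that nz by auto
        then show ?thesis by (auto simp: Q'_def)
      qed
      ultimately show ?thesis by (intro exI[of _ Q']) auto
    qed
  qed simp
  then show thesis using that by blast
qed

text \<open>The inductive definition only undoes the last attachment, whereas \<open>v\<close> is an
  arbitrary leaf. Either \<open>v\<close> was attached last; or the last vertex \<open>z\<close> was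
  attached to \<open>v\<close>, which then had no other neighbour, so that only \<open>z\<close>
  remains; or removing \<open>v\<close> commutes with the last attachment.\<close>

lemma tree_remove_leaf:
  "tree S E \<Longrightarrow> nbrs E v = {u} \<Longrightarrow> tree (S - {v}) (E - {{u, v}})"
proof (induction arbitrary: u v rule: tree.induct)
  case (singleton v)
  then show ?case by (simp add: nbrs_def)
next
  case (add_leaf S E w z)
  have wz: "w \<noteq> z" using add_leaf by auto
  show ?case
  proof (cases "v = z")
    case True
    then have "u = w" using add_leaf by (auto simp: nbrs_add_leaf)
    moreover have "{w, z} \<notin> E" using tree_edge_subset[OF add_leaf.hyps(1)] add_leaf.hyps by auto
    ultimately show ?thesis using True add_leaf.hyps by (simp add: Diff_insert_absorb)
  next
    case vz: False
    show ?thesis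
    proof (cases "v = w")
      case True
      then have "insert z (nbrs E v) = {u}" using add_leaf.prems add_leaf.hyps vz
        by (simp add: nbrs_add_leaf)
      moreover have "z \<notin> nbrs E v" using tree_nbrs_subset[OF add_leaf.hyps(1)] add_leaf.hyps by auto
      ultimately have "nbrs E v = {}" "u = z" by auto
      then have "S = {v}" using tree_nbrs_nonempty[OF add_leaf.hyps(1)] add_leaf.hyps True by blast
      with add_leaf.hyps(1) have "E = {}"
        using tree_edge_subset[OF add_leaf.hyps(1)] by (auto elim!: tree_edgeE[OF add_leaf.hyps(1)])
      with \<open>S = {v}\<close> \<open>u = z\<close> True vz show ?thesis by (auto simp: insert_commute intro: tree.singleton)
    next
      case False
      then have nb: "nbrs E v = {u}" using add_leaf.prems add_leaf.hyps vz by (simp add: nbrs_add_leaf)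
      have "tree (insert z (S - {v})) (insert {w, z} (E - {{u, v}}))"
        using add_leaf.IH[OF nb] False add_leaf.hyps by (intro tree.add_leaf) auto
      moreover have "{w, z} \<noteq> {u, v}" using False vz by (auto simp: doubleton_eq_iff)
      then have "insert {w, z} (E - {{u, v}}) = insert {w, z} E - {{u, v}}" by auto
      moreover have "insert z (S - {v}) = insert z S - {v}" using vz by auto
      ultimately show ?thesis by simp
    qed
  qed
qed

lemma tree_doubleton:
  assumes "tree {a, b} E" "a \<noteq> b"
  shows "E = {{a, b}}"
proof -
  have "e = {a, b}" if "e \<in> E" for e
    using assms(1) that by (rule tree_edgeE) auto
  moreover have "E \<noteq> {}" using tree_nbrs_nonempty[OF assms(1), of a] assms(2) by (auto simp: nbrs_def)
  ultimately show ?thesis by auto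
qed

subsection \<open>The weighted enumeration of trees without monochromatic edges\<close>

definition colored_trees :: "('a \<Rightarrow> nat) \<Rightarrow> 'a set \<Rightarrow> 'a set set set" where
  "colored_trees color C = {E. tree C E \<and> (\<forall>u v. {u, v} \<in> E \<longrightarrow> color u \<noteq> color v)}"

lemma finite_colored_trees: "finite C \<Longrightarrow> finite (colored_trees color C)"
  by (rule finite_subset[of _ "Pow (Pow C)"]) (auto simp: colored_trees_def dest: tree_edge_subset)

text \<open>The degree generating function of the trees, with every degree lowered by one. For
  \<open>2 \<le> card C\<close> all degrees are positive, so the truncated subtraction is exact. If
  all colours are distinct, this is the sum in Cayley's formula, with value
  \<open>sum x C ^ (card C - 2)\<close>.\<close>

definition tree_sum :: "('a \<Rightarrow> nat) \<Rightarrow> 'a set \<Rightarrow> ('a \<Rightarrow> real) \<Rightarrow> real" where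
  "tree_sum color C x = (\<Sum>E\<in>colored_trees color C. \<Prod>v\<in>C. x v ^ (card (nbrs E v) - 1))"

definition class_product :: "('a \<Rightarrow> nat) \<Rightarrow> 'a set \<Rightarrow> ('a \<Rightarrow> real) \<Rightarrow> real" where
  "class_product color C x = sum x C ^ (card (color ` C) - 2) *
     (\<Prod>i\<in>color ` C. (sum x C - sum x {c\<in>C. color c = i}) ^ (card {c\<in>C. color c = i} - 1))"

text \<open>A tree with leaf \<open>v\<close> is the choice of the vertex that carries
  \<open>v\<close> and, independently of it, of a tree on the other vertices; the colours restrict
  only the former choice.\<close>

lemma colored_trees_leaf_bij:
  assumes "v \<in> C"
  shows "bij_betw (\<lambda>(u, E). insert {u, v} E)
     ({u \<in> C. color u \<noteq> color v} \<times> colored_trees color (C - {v}))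
     {E \<in> colored_trees color C. card (nbrs E v) = 1}"
proof -
  define g where "g E = (let u = THE u. nbrs E v = {u} in (u, E - {{u, v}}))" for E
  have g: "g E = (u, E - {{u, v}})" if "nbrs E v = {u}" for u E
    using that by (simp add: g_def)
  have leaf: "nbrs (insert {u, v} E) v = {u}" "{u, v} \<notin> E"
    if "u \<in> C" "color u \<noteq> color v" "tree (C - {v}) E" for u E
    using nbrs_add_leaf[OF that(3), of u v v] tree_edge_subset[OF that(3), of "{u, v}"] that by auto
  show ?thesis
  proof (rule bij_betwI[where g = g])
    show "(\<lambda>(u, E). insert {u, v} E) \<in>
       {u \<in> C. color u \<noteq> color v} \<times> colored_trees color (C - {v}) \<rightarrow>
       {E \<in> colored_trees color C. card (nbrs E v) = 1}"
    proof
      fix p assume "p \<in> {u \<in> C. color u \<noteq> color v} \<times> colored_trees color (C - {v})"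
      then obtain u E where p: "p = (u, E)" and u: "u \<in> C" "color u \<noteq> color v"
        and E: "E \<in> colored_trees color (C - {v})" by auto
      then have "tree (insert v (C - {v})) (insert {u, v} E)"
        by (intro tree.add_leaf) (auto simp: colored_trees_def)
      then show "(case p of (u, E) \<Rightarrow> insert {u, v} E) \<in> {E \<in> colored_trees color C. card (nbrs E v) = 1}"
        using u E assms leaf[OF u] by (auto simp: p colored_trees_def insert_absorb doubleton_eq_iff)
    qed
    show "g \<in>
      {E \<in> colored_trees color C. card (nbrs E v) = 1} \<rightarrow>
      {u \<in> C. color u \<noteq> color v} \<times> colored_trees color (C - {v})"
    proof clarify
      fix E assume E: "E \<in> colored_trees color C" "card (nbrs E v) = 1"
      then obtain u where u: "nbrs E v = {u}" by (auto simp: card_1_singleton_iff)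
      then have "{u, v} \<in> E" by (auto simp: nbrs_def insert_commute)
      then show "g E
         \<in> {u \<in> C. color u \<noteq> color v} \<times> colored_trees color (C - {v})"
        using E u tree_remove_leaf[OF _ u, of C] tree_nbrs_subset[of C E v]
        by (auto simp: colored_trees_def g[OF u])
    qed
    show "g ((\<lambda>(u, E). insert {u, v} E) p) = p"
      if "p \<in> {u \<in> C. color u \<noteq> color v} \<times> colored_trees color (C - {v})" for p
      using that leaf by (auto simp: colored_trees_def g)
    show "(\<lambda>(u, E). insert {u, v} E) (g E) = E"
      if "E \<in> {E \<in> colored_trees color C. card (nbrs E v) = 1}" for E
    proof -
      from that obtain u where u: "nbrs E v = {u}" by (auto simp: card_1_singleton_iff)
      then have "{u, v} \<in> E" by (auto simp: nbrs_def insert_commute)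
      then show ?thesis by (auto simp: g[OF u])
    qed
  qed
qed

text \<open>Since \<open>0 ^ 0 = 1\<close>, exactly the trees in which \<open>v\<close> is a leaf
  survive. Hanging \<open>v\<close> on \<open>u\<close> raises the degree of \<open>u\<close> by one
  and contributes the factor \<open>x u\<close>, so the sum splits into a sum over \<open>u\<close>
  and a sum over the remaining trees.\<close>

lemma tree_sum_zero:
  assumes C: "finite C" "3 \<le> card C" "v \<in> C" and "x v = 0"
  shows "tree_sum color C x = sum x {u\<in>C. color u \<noteq> color v} * tree_sum color (C - {v}) x"
proof -
  define w where "w E = (\<Prod>u\<in>C. x u ^ (card (nbrs E u) - 1))" for E
  have card_Cv: "2 \<le> card (C - {v})" using C by simp
  have w: "w (insert {u, v} E) = x u * (\<Prod>z\<in>C - {v}. x z ^ (card (nbrs E z) - 1))"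
    if u: "u \<in> C" "color u \<noteq> color v" and E: "E \<in> colored_trees color (C - {v})" for u E
  proof -
    have t: "tree (C - {v}) E" and uC: "u \<in> C - {v}" using u E by (auto simp: colored_trees_def)
    have "v \<notin> nbrs E u" using tree_nbrs_subset[OF t] by auto
    \<comment> \<open>At least two vertices remain besides \<open>v\<close>, so \<open>u\<close>
      already has a neighbour in \<open>E\<close> and the truncated exponent really grows by
      one.\<close>
    then have d: "card (insert v (nbrs E u)) - 1 = Suc (card (nbrs E u) - 1)"
      using tree_card_nbrs_pos[OF t uC card_Cv] finite_nbrs[OF t] by simp
    have nb: "nbrs (insert {u, v} E) z =
        (if z = v then {u} else if z = u then insert v (nbrs E u) else nbrs E z)" for z
      using nbrs_add_leaf[OF t uC] by simp
    have "w (insert {u, v} E) = (\<Prod>z\<in>C - {v}. x z ^ (card (nbrs (insert {u, v} E) z) - 1))"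
      unfolding w_def using C by (subst prod.remove[of C v]) (auto simp: nb)
    also have "\<dots> = x u ^ (card (insert v (nbrs E u)) - 1) *
        (\<Prod>z\<in>C - {v} - {u}. x z ^ (card (nbrs (insert {u, v} E) z) - 1))"
      using C uC by (subst prod.remove[of _ u]) (auto simp: nb)
    also have "(\<Prod>z\<in>C - {v} - {u}. x z ^ (card (nbrs (insert {u, v} E) z) - 1)) =
        (\<Prod>z\<in>C - {v} - {u}. x z ^ (card (nbrs E z) - 1))"
      by (intro prod.cong) (auto simp: nb)
    also have "x u ^ (card (insert v (nbrs E u)) - 1) * \<dots> =
        x u * (\<Prod>z\<in>C - {v}. x z ^ (card (nbrs E z) - 1))"
      unfolding d using C uC by (subst (2) prod.remove[of _ u]) auto
    finally show ?thesis .
  qed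
  have "tree_sum color C x = (\<Sum>E\<in>{E \<in> colored_trees color C. card (nbrs E v) = 1}. w E)"
    unfolding tree_sum_def w_def
  proof (intro sum.mono_neutral_right ballI)
    fix E assume E: "E \<in> colored_trees color C - {E \<in> colored_trees color C. card (nbrs E v) = 1}"
    then have "0 < card (nbrs E v)" using tree_card_nbrs_pos[of C E v] C by (auto simp: colored_trees_def)
    with E have "x v ^ (card (nbrs E v) - 1) = 0" using \<open>x v = 0\<close> by auto
    then show "(\<Prod>u\<in>C. x u ^ (card (nbrs E u) - 1)) = 0" using C by (auto intro!: prod_zero)
  qed (use C in \<open>auto intro: finite_colored_trees\<close>)
  also have "\<dots> = (\<Sum>(u, E)\<in>{u \<in> C. color u \<noteq> color v} \<times> colored_trees color (C - {v}).
      w (insert {u, v} E))"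
    by (subst sum.reindex_bij_betw[OF colored_trees_leaf_bij[OF \<open>v \<in> C\<close>], symmetric])
       (simp add: case_prod_beta)
  also have "\<dots> = (\<Sum>(u, E)\<in>{u \<in> C. color u \<noteq> color v} \<times> colored_trees color (C - {v}).
      x u * (\<Prod>z\<in>C - {v}. x z ^ (card (nbrs E z) - 1)))"
    by (intro sum.cong) (auto simp: w)
  also have "\<dots> = sum x {u\<in>C. color u \<noteq> color v} * tree_sum color (C - {v}) x"
    by (simp add: tree_sum_def sum_product sum.cartesian_product)
  finally show ?thesis .
qed

lemma colored_trees_empty:
  assumes "finite C" "2 \<le> card C" "card (color ` C) < 2"
  shows "colored_trees color C = {}"
proof -
  have eq: "color u = color v" if "u \<in> C" "v \<in> C" for u v
  proof (rule ccontr)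
    assume "color u \<noteq> color v"
    then have "card {color u, color v} = 2" by simp
    moreover have "card {color u, color v} \<le> card (color ` C)"
      using assms that by (intro card_mono) auto
    ultimately show False using assms by simp
  qed
  have False if E: "tree C E" and col: "\<forall>u v. {u, v} \<in> E \<longrightarrow> color u \<noteq> color v" for E
  proof -
    obtain v where v: "v \<in> C" using assms by fastforce
    then obtain u where u: "u \<in> nbrs E v"
      using tree_card_nbrs_pos[OF E v] assms by (metis card_gt_0_iff ex_in_conv)
    then have "u \<in> C" using tree_nbrs_subset[OF E] by auto
    with u v col eq show False by (auto simp: nbrs_def)
  qed
  then show ?thesis unfolding colored_trees_def by blast
qed

text \<open>Putting \<open>x v\<close> to 0 changes no sum, only the exponents. If the class of
  \<open>v\<close> has other members, one factor \<open>l - l_i\<close> is split off. If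
  \<open>v\<close> is alone in its class, then \<open>l_i = 0\<close> and the factor split off is
  one \<open>l\<close> of the power \<open>l ^ (k - 2)\<close>. In both cases this factor is the sum
  over the vertices of other colours.\<close>

lemma class_product_zero:
  assumes C: "finite C" "3 \<le> card C" "v \<in> C" "2 \<le> card (color ` C)" and "x v = 0"
  shows "class_product color C x = sum x {u\<in>C. color u \<noteq> color v} *
    (if 2 \<le> card (color ` (C - {v})) then class_product color (C - {v}) x else 0)"
proof -
  define i where "i = color v"
  define cl where "cl D j = {c\<in>D. color c = j}" for D j
  define l where "l = sum x C"
  have l': "sum x (C - {v}) = l" using C \<open>x v = 0\<close> by (simp add: l_def sum_diff1)
  have fcl: "finite (cl C j)" for j using C by (simp add: cl_def)
  have cl': "cl (C - {v}) j = cl C j - {v}" for j by (auto simp: cl_def)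
  have scl': "sum x (cl (C - {v}) j) = sum x (cl C j)" for j
    using \<open>x v = 0\<close> fcl by (simp add: cl' sum_diff1)
  have vcl: "v \<in> cl C i" using C by (auto simp: cl_def i_def)
  have cl'j: "cl (C - {v}) j = cl C j" if "j \<noteq> i" for j using that by (auto simp: cl_def i_def)
  have others: "sum x {u\<in>C. color u \<noteq> color v} = l - sum x (cl C i)"
  proof -
    have "{u\<in>C. color u \<noteq> color v} = C - cl C i" by (auto simp: cl_def i_def)
    then show ?thesis using C by (simp add: l_def sum_diff cl_def)
  qed
  have iC: "i \<in> color ` C" using C by (auto simp: i_def)
  have cp: "class_product color D x = sum x D ^ (card (color ` D) - 2) *
     (\<Prod>j\<in>color ` D. (sum x D - sum x (cl D j)) ^ (card (cl D j) - 1))" for D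
    by (simp add: class_product_def cl_def)
  define rest where "rest = (\<Prod>j\<in>color ` C - {i}. (l - sum x (cl C j)) ^ (card (cl C j) - 1))"
  have cpC: "class_product color C x = l ^ (card (color ` C) - 2) *
     ((l - sum x (cl C i)) ^ (card (cl C i) - 1) * rest)"
    unfolding cp rest_def l_def[symmetric] using C iC by (subst prod.remove[of _ i]) auto
  show ?thesis
  proof (cases "cl C i = {v}")
    case False
    with vcl fcl[of i] have m: "2 \<le> card (cl C i)"
      by (metis One_nat_def Suc_leI card_1_singletonE card_gt_0_iff empty_iff le_antisym not_less_eq_eq numeral_2_eq_2 singletonD)
    from False vcl obtain w where "w \<in> cl C i" "w \<noteq> v" by auto
    then have "w \<in> C - {v}" "color w = color v" by (auto simp: cl_def i_def)
    then have col: "color ` (C - {v}) = color ` C"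
      by (metis C(3) image_insert insert_Diff insert_absorb)
    have "class_product color (C - {v}) x = l ^ (card (color ` C) - 2) *
       ((l - sum x (cl C i)) ^ (card (cl C i) - 2) * rest)"
    proof -
      have "(\<Prod>j\<in>color ` C - {i}. (l - sum x (cl (C - {v}) j)) ^ (card (cl (C - {v}) j) - 1)) = rest"
        unfolding rest_def by (intro prod.cong) (auto simp: cl'j)
      moreover have "card (cl (C - {v}) i) - 1 = card (cl C i) - 2" using vcl fcl[of i] by (simp add: cl')
      moreover have "(\<Prod>j\<in>color ` C. (l - sum x (cl (C - {v}) j)) ^ (card (cl (C - {v}) j) - 1)) =
          (l - sum x (cl (C - {v}) i)) ^ (card (cl (C - {v}) i) - 1) *
          (\<Prod>j\<in>color ` C - {i}. (l - sum x (cl (C - {v}) j)) ^ (card (cl (C - {v}) j) - 1))"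
        using C iC by (intro prod.remove) auto
      ultimately show ?thesis unfolding cp col l' by (simp only: scl')
    qed
    moreover have "card (cl C i) - 1 = Suc (card (cl C i) - 2)" using m by simp
    ultimately show ?thesis using C(4) by (simp add: cpC col others)
  next
    case True
    then have s0: "sum x (cl C i) = 0" using \<open>x v = 0\<close> by simp
    have col: "color ` (C - {v}) = color ` C - {i}"
    proof -
      have "color w \<noteq> i" if "w \<in> C - {v}" for w using that True by (auto simp: cl_def)
      then show ?thesis by (auto simp: i_def)
    qed
    have ccol: "card (color ` (C - {v})) = card (color ` C) - 1" using C iC by (simp add: col)
    show ?thesis
    proof (cases "2 \<le> card (color ` (C - {v}))")
      case k: True
      have "class_product color (C - {v}) x = l ^ (card (color ` C) - 3) * rest"
      proof -
        have "(\<Prod>j\<in>color ` C - {i}. (l - sum x (cl (C - {v}) j)) ^ (card (cl (C - {v}) j) - 1)) = rest"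
          unfolding rest_def by (intro prod.cong) (auto simp: cl'j)
        moreover have "card (color ` (C - {v})) - 2 = card (color ` C) - 3" using ccol by simp
        ultimately show ?thesis unfolding cp l' by (simp add: col)
      qed
      moreover have "card (color ` C) - 2 = Suc (card (color ` C) - 3)" using k ccol by simp
      ultimately show ?thesis using k by (simp add: cpC others s0 True \<open>x v = 0\<close>)
    next
      case False
      then have "card (color ` C - {i}) = 1" using ccol C(4) col by simp
      then obtain j where j: "color ` C - {i} = {j}" by (auto simp: card_1_singleton_iff)
      \<comment> \<open>Only the colour \<open>j\<close> remains. Its class carries the whole sum
        \<open>l\<close>, so its factor is 0, with a positive exponent because
        \<open>3 \<le> card C\<close>.\<close>
      have clj: "cl C j = C - {v}"
        using j True by (auto simp: cl_def i_def)
      then have "sum x (cl C j) = l" using l' by simp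
      moreover have "card (cl C j) - 1 \<noteq> 0" using clj C by simp
      ultimately have "rest = 0" by (simp add: rest_def j)
      with False show ?thesis by (simp add: cpC)
    qed
  qed
qed

text \<open>
  A sum of monomials each of which omits some variable is determined by its values on the
  coordinate hyperplanes, by inclusion-exclusion over the set \<open>S\<close> of variables put to zero.
\<close>

definition zero_on :: "'a set \<Rightarrow> ('a \<Rightarrow> real) \<Rightarrow> 'a \<Rightarrow> real" where
  "zero_on S x = (\<lambda>v. if v \<in> S then 0 else x v)"

definition alternating_sum :: "'a set \<Rightarrow> (('a \<Rightarrow> real) \<Rightarrow> real) \<Rightarrow> ('a \<Rightarrow> real) \<Rightarrow> real" where
  "alternating_sum C f x = (\<Sum>S\<in>Pow C. (- 1) ^ card S * f (zero_on S x))"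

text \<open>The terms of \<open>S\<close> and \<open>insert v S\<close> have equal values and
  opposite signs.\<close>

lemma alternating_sum_missing:
  assumes "finite C" "v \<in> C" and f: "\<And>S. S \<subseteq> C \<Longrightarrow> f (zero_on (insert v S) x) = f (zero_on S x)"
  shows "alternating_sum C f x = 0"
proof -
  have C: "C = insert v (C - {v})" using assms by auto
  have inj: "inj_on (insert v) (Pow (C - {v}))" by (auto simp: inj_on_def)
  have "alternating_sum C f x = (\<Sum>S\<in>Pow (C - {v}). (- 1) ^ card S * f (zero_on S x)) +
     (\<Sum>S\<in>insert v ` Pow (C - {v}). (- 1) ^ card S * f (zero_on S x))"
    unfolding alternating_sum_def
    by (subst C, subst Pow_insert, subst sum.union_disjoint) (use assms in auto)
  also have "(\<Sum>S\<in>insert v ` Pow (C - {v}). (- 1) ^ card S * f (zero_on S x)) =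
      (\<Sum>S\<in>Pow (C - {v}). - ((- 1) ^ card S * f (zero_on S x)))"
  proof (subst sum.reindex[OF inj], intro sum.cong refl)
    fix S assume S: "S \<in> Pow (C - {v})"
    then have "v \<notin> S" "finite S" using \<open>finite C\<close> by (auto intro: finite_subset)
    moreover have "f (zero_on (insert v S) x) = f (zero_on S x)" using S by (intro f) auto
    ultimately show "((\<lambda>S. (- 1) ^ card S * f (zero_on S x)) \<circ> insert v) S = - ((- 1) ^ card S * f (zero_on S x))"
      by simp
  qed
  finally show ?thesis by (simp add: sum_negf)
qed

text \<open>Multiplying out the first form replaces \<open>f\<close> by the functions
  \<open>f y * y v\<close>, which look at one more variable. Once all forms are multiplied out,
  fewer than \<open>card C\<close> variables have been touched and
  \<open>alternating_sum_missing\<close> applies. The induction carries along the factor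
  \<open>f\<close> and a set \<open>U\<close> of variables that determine it.\<close>

lemma alternating_sum_linear_forms:
  assumes "finite C" "U \<subseteq> C" "card U + length as < card C"
    and f: "\<And>S. f (zero_on S x) = f (zero_on (S \<inter> U) x)"
  shows "alternating_sum C (\<lambda>y. f y * (\<Prod>a\<leftarrow>as. \<Sum>v\<in>C. a v * y v)) x = 0"
  using assms(2-)
proof (induction as arbitrary: f U)
  case Nil
  then have "U \<noteq> C" by auto
  with Nil obtain v where v: "v \<in> C" "v \<notin> U" by auto
  have "f (zero_on (insert v S) x) = f (zero_on S x)" for S
    using Nil(3)[of "insert v S"] Nil(3)[of S] v by (simp add: Int_insert_left)
  with v assms(1) show ?case by (intro alternating_sum_missing[of _ v]) auto
next
  case (Cons a as)
  let ?p = "\<lambda>y. \<Prod>a\<leftarrow>as. \<Sum>v\<in>C. a v * y v"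
  have "alternating_sum C (\<lambda>y. f y * (\<Prod>a\<leftarrow>a # as. \<Sum>v\<in>C. a v * y v)) x =
     (\<Sum>v\<in>C. a v * alternating_sum C (\<lambda>y. (f y * y v) * ?p y) x)"
    unfolding alternating_sum_def sum_distrib_left sum_distrib_right
    by (subst sum.swap) (simp add: sum_distrib_left sum_distrib_right mult_ac)
  also have "\<dots> = 0"
  proof (rule sum.neutral, rule ballI)
    fix v assume v: "v \<in> C"
    have fU: "finite U" using Cons.prems assms(1) finite_subset by blast
    have "alternating_sum C (\<lambda>y. (f y * y v) * ?p y) x = 0"
    proof (rule Cons.IH[where U = "insert v U"])
      show "card (insert v U) + length as < card C" using Cons.prems(2) card_insert_le_m1[of "Suc (card U)" U v] fU
        by (auto simp: card_insert_if)
      fix S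
      have "f (zero_on S x) = f (zero_on (S \<inter> insert v U) x)"
        using Cons.prems(3)[of S] Cons.prems(3)[of "S \<inter> insert v U"] by (simp add: Int_assoc inf.absorb2 subset_insertI)
      then show "f (zero_on S x) * zero_on S x v = f (zero_on (S \<inter> insert v U) x) * zero_on (S \<inter> insert v U) x v"
        by (simp add: zero_on_def)
    qed (use v Cons.prems in auto)
    then show "a v * alternating_sum C (\<lambda>y. (f y * y v) * ?p y) x = 0" by simp
  qed
  finally show ?case .
qed

text \<open>The term \<open>S = {}\<close> is the value at \<open>x\<close> itself; all other terms
  live on coordinate hyperplanes.\<close>

lemma alternating_sum_unique:
  assumes "finite C" "alternating_sum C f x = 0" "alternating_sum C g x = 0"
    and "\<And>S. S \<subseteq> C \<Longrightarrow> S \<noteq> {} \<Longrightarrow> f (zero_on S x) = g (zero_on S x)"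
  shows "f x = g x"
proof -
  have "alternating_sum C h x = h x + (\<Sum>S\<in>Pow C - {{}}. (- 1) ^ card S * h (zero_on S x))" for h
    unfolding alternating_sum_def using assms(1) by (subst sum.remove[of _ "{}"]) (auto simp: zero_on_def)
  moreover have "(\<Sum>S\<in>Pow C - {{}}. (- 1) ^ card S * f (zero_on S x)) =
     (\<Sum>S\<in>Pow C - {{}}. (- 1) ^ card S * g (zero_on S x))"
    using assms(4) by (intro sum.cong) auto
  ultimately show ?thesis using assms(2,3) by simp
qed

text \<open>The variable of a leaf has exponent 0, so every single monomial misses a variable,
  though a different one for different trees.\<close>

lemma alternating_sum_tree_sum:
  assumes "finite C" "2 \<le> card C"
  shows "alternating_sum C (tree_sum color C) x = 0"
proof -
  have "alternating_sum C (tree_sum color C) x =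
      (\<Sum>E\<in>colored_trees color C. alternating_sum C (\<lambda>y. \<Prod>v\<in>C. y v ^ (card (nbrs E v) - 1)) x)"
    unfolding alternating_sum_def tree_sum_def sum_distrib_left by (rule sum.swap)
  also have "\<dots> = 0"
  proof (rule sum.neutral, rule ballI)
    fix E assume "E \<in> colored_trees color C"
    then obtain v where v: "v \<in> C" "card (nbrs E v) = 1"
      using tree_has_leaf[of C E] assms by (auto simp: colored_trees_def)
    show "alternating_sum C (\<lambda>y. \<Prod>v\<in>C. y v ^ (card (nbrs E v) - 1)) x = 0"
    proof (rule alternating_sum_missing[OF assms(1) v(1)])
      fix S
      show "(\<Prod>w\<in>C. zero_on (insert v S) x w ^ (card (nbrs E w) - 1)) =
         (\<Prod>w\<in>C. zero_on S x w ^ (card (nbrs E w) - 1))"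
        by (intro prod.cong) (use v in \<open>auto simp: zero_on_def\<close>)
    qed
  qed
  finally show ?thesis .
qed

text \<open>The list \<open>as\<close> holds the linear factors as coefficient functions: 1
  everywhere for the factor \<open>l\<close>, and 1 off the colour \<open>i\<close> for
  \<open>l - l_i\<close>. As the class sizes add up to \<open>card C\<close>, its length is
  \<open>card C - 2\<close>.\<close>

lemma alternating_sum_class_product:
  assumes "finite C" "2 \<le> card (color ` C)"
  shows "alternating_sum C (class_product color C) x = 0"
proof -
  define K where "K = color ` C"
  define m where "m i = card {c\<in>C. color c = i}" for i
  obtain js where js: "set js = K" "distinct js"
    using finite_distinct_list[of K] assms(1) by (auto simp: K_def)
  define as :: "('a \<Rightarrow> real) list" where "as = replicate (card K - 2) (\<lambda>_. 1) @
     concat (map (\<lambda>i. replicate (m i - 1) (\<lambda>v. if color v = i then 0 else 1)) js)"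
  have lin: "(\<Sum>v\<in>C. (if color v = i then 0 else 1) * y v) = sum y C - sum y {c\<in>C. color c = i}" for i and y :: "'a \<Rightarrow> real"
  proof -
    have "(\<Sum>v\<in>C. (if color v = i then 0 else 1) * y v) = sum y (C - {c\<in>C. color c = i})"
      using assms(1) by (intro sum.mono_neutral_cong_right) auto
    then show ?thesis using assms(1) by (simp add: sum_diff)
  qed
  have "(\<Prod>a\<leftarrow>as. \<Sum>v\<in>C. a v * y v) = class_product color C y" for y
  proof -
    have "(\<Prod>a\<leftarrow>as. \<Sum>v\<in>C. a v * y v) = sum y C ^ (card K - 2) *
       (\<Prod>i\<leftarrow>js. (sum y C - sum y {c\<in>C. color c = i}) ^ (m i - 1))"
    proof -
      have "(\<Prod>a\<leftarrow>concat (map (\<lambda>i. replicate (m i - 1) (\<lambda>v. if color v = i then 0 else 1)) ks). \<Sum>v\<in>C. a v * y v) =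
          (\<Prod>i\<leftarrow>ks. (sum y C - sum y {c\<in>C. color c = i}) ^ (m i - 1))" for ks
        by (induction ks) (simp_all only: list.map concat.simps map_append prod_list.append map_replicate prod_list_replicate lin prod_list.Nil prod_list.Cons)
      then show ?thesis unfolding as_def by simp
    qed
    also have "(\<Prod>i\<leftarrow>js. (sum y C - sum y {c\<in>C. color c = i}) ^ (m i - 1)) =
       (\<Prod>i\<in>K. (sum y C - sum y {c\<in>C. color c = i}) ^ (m i - 1))"
      unfolding js(1)[symmetric] by (rule prod.distinct_set_conv_list[OF js(2), symmetric])
    finally show ?thesis by (simp add: class_product_def K_def m_def)
  qed
  moreover have "length as < card C"
  proof -
    have C: "card C = (\<Sum>i\<in>K. m i)"
    proof -
      have "card C = (\<Sum>c\<in>C. 1)" by simp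
      also have "\<dots> = (\<Sum>i\<in>K. \<Sum>c\<in>{c\<in>C. color c = i}. 1)"
        unfolding K_def by (rule sum.image_gen[OF assms(1)])
      finally show ?thesis by (simp add: m_def)
    qed
    have m1: "1 \<le> m i" if "i \<in> K" for i
      using that assms(1) by (auto simp: m_def K_def Suc_le_eq card_gt_0_iff)
    have "length as = card K - 2 + (\<Sum>i\<leftarrow>js. m i - 1)"
      by (simp add: as_def length_concat o_def)
    moreover have "(\<Sum>i\<leftarrow>js. m i - 1) = (\<Sum>i\<in>K. m i - 1)"
      unfolding js(1)[symmetric] by (rule sum.distinct_set_conv_list[OF js(2), symmetric])
    moreover have "(\<Sum>i\<in>K. m i - 1) = (\<Sum>i\<in>K. m i) - card K"
      using m1 by (subst sum_subtractf_nat) auto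
    moreover have "card K \<le> (\<Sum>i\<in>K. m i)"
      using sum_mono[of K "\<lambda>_. 1" m] m1 by simp
    ultimately show ?thesis using assms(2) C by (simp add: K_def)
  qed
  then have "alternating_sum C (\<lambda>y. (\<lambda>_. 1) y * (\<Prod>a\<leftarrow>as. \<Sum>v\<in>C. a v * y v)) x = 0"
    using assms(1) by (intro alternating_sum_linear_forms[where U = "{}"]) auto
  ultimately show ?thesis by simp
qed

text \<open>Deleting a vertex may leave a single colour; then both recursions give 0, by
  \<open>colored_trees_empty\<close> on one side and by the case distinction of
  \<open>class_product_zero\<close> on the other. The weights are generalised because the induction
  hypothesis is applied at \<open>zero_on S x\<close>. Two vertices form the base, as the recursion
  starts from three.\<close>

theorem tree_sum_eq_class_product:
  assumes "finite C" "2 \<le> card (color ` C)"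
  shows "tree_sum color C x = class_product color C x"
  using assms
proof (induction "card C" arbitrary: C x rule: less_induct)
  case less
  have "2 \<le> card C" using less.prems card_image_le[of C color] by simp
  show ?case
  proof (cases "card C = 2")
    case True
    then obtain a b where ab: "C = {a, b}" "a \<noteq> b" by (auto simp: card_2_iff)
    then have col: "color a \<noteq> color b" using less.prems by (auto simp: card_insert_if split: if_splits)
    have "tree (insert b {a}) (insert {a, b} {})"
      using ab by (intro tree.add_leaf tree.singleton) auto
    then have "tree {a, b} {{a, b}}" by (simp add: insert_commute)
    moreover have "color u \<noteq> color w" if "{u, w} = {a, b}" for u w
      using that col by (metis doubleton_eq_iff)
    ultimately have "colored_trees color C = {{{a, b}}}"
      unfolding colored_trees_def ab(1) using tree_doubleton[OF _ ab(2)] by blast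
    moreover have "nbrs {{a, b}} a = {b}" "nbrs {{a, b}} b = {a}"
      using ab by (auto simp: nbrs_def doubleton_eq_iff)
    moreover have "{c. (c = a \<or> c = b) \<and> color c = color a} = {a}"
        "{c. (c = a \<or> c = b) \<and> color c = color b} = {b}"
      using ab col by auto
    ultimately show ?thesis using ab col by (simp add: tree_sum_def class_product_def)
  next
    case False
    with \<open>2 \<le> card C\<close> have C3: "3 \<le> card C" by simp
    show ?thesis
    proof (rule alternating_sum_unique[of C "tree_sum color C" x "class_product color C", OF less.prems(1)])
      show "alternating_sum C (tree_sum color C) x = 0"
        using less.prems \<open>2 \<le> card C\<close> by (intro alternating_sum_tree_sum)
      show "alternating_sum C (class_product color C) x = 0"
        using less.prems by (intro alternating_sum_class_product)
      fix S assume S: "S \<subseteq> C" "S \<noteq> {}"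
      then obtain v where v: "v \<in> S" "v \<in> C" by auto
      let ?y = "zero_on S x"
      have y0: "?y v = 0" using v by (simp add: zero_on_def)
      have fin: "finite (C - {v})" and c2: "2 \<le> card (C - {v})" and lt: "card (C - {v}) < card C"
        using less.prems(1) C3 v by (auto simp: card_gt_0_iff)
      have IH: "tree_sum color (C - {v}) ?y =
          (if 2 \<le> card (color ` (C - {v})) then class_product color (C - {v}) ?y else 0)"
      proof (cases "2 \<le> card (color ` (C - {v}))")
        case True
        then show ?thesis using less.hyps[OF lt fin True] by simp
      next
        case False
        then have "colored_trees color (C - {v}) = {}" by (intro colored_trees_empty[OF fin c2]) simp
        with False show ?thesis by (simp add: tree_sum_def)
      qed
      show "tree_sum color C ?y = class_product color C ?y"
        unfolding tree_sum_zero[of C v ?y color, OF less.prems(1) C3 v(2) y0]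
          class_product_zero[of C v color ?y, OF less.prems(1) C3 v(2) less.prems(2) y0] IH ..
    qed
  qed
qed


subsection \<open>The arcs of one circle\<close>

definition circle_gluings :: "('c \<times> real) set set \<Rightarrow> 'c \<Rightarrow> real set" where
  "circle_gluings V c = {y. (c, y) \<in> \<Union>V}"

lemma fst_arc_end [simp]: "fst (arc_end len V e) = fst e"
  by (simp add: arc_end_def)

lemma arc_length_eq_Min:
  "arc_length len V (c, x) = Min (arc_dist len c x ` circle_gluings V c)"
  unfolding arc_length_def circle_gluings_def by (simp add: setcompr_eq_image)

text \<open>On sorted positions the minimum in \<open>arc_length\<close> is attained at the cyclic
  successor. For the last position this wraps around by \<open>len c\<close>; if there is only one
  gluing point, the arc is the whole circle.\<close>

lemma
  assumes P: "finite (circle_gluings V c)" "circle_gluings V c \<subseteq> {0..<len c}"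
    and set: "set ys = circle_gluings V c" and sorted: "sorted_wrt (<) ys" and i: "i < length ys"
  shows arc_length_nth: "arc_length len V (c, ys ! i) =
      (if Suc i < length ys then ys ! Suc i - ys ! i else ys ! 0 + len c - ys ! i)" (is ?L)
    and arc_end_nth: "arc_end len V (c, ys ! i) = (c, ys ! (Suc i mod length ys))" (is ?R)
proof -
  have less: "ys ! j < ys ! k" if "j < k" "k < length ys" for j k
    using sorted_wrt_nth_less[OF sorted that] .
  have "ys ! j \<in> {0..<len c}" if "j < length ys" for j
    using P(2) set nth_mem[OF that] by blast
  then have rng: "0 \<le> ys ! j" "ys ! j < len c" if "j < length ys" for j
    using that by auto
  show ?L
    unfolding arc_length_eq_Min
  proof (rule Min_eqI)
    show "finite (arc_dist len c (ys ! i) ` circle_gluings V c)" using P by simp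
  next
    fix d assume "d \<in> arc_dist len c (ys ! i) ` circle_gluings V c"
    then obtain j where j: "j < length ys" "d = arc_dist len c (ys ! i) (ys ! j)"
      by (auto simp: set[symmetric] in_set_conv_nth)
    show "(if Suc i < length ys then ys ! Suc i - ys ! i else ys ! 0 + len c - ys ! i) \<le> d"
    proof (cases "j \<le> i")
      case True
      then have "ys ! j \<le> ys ! i" using less[of j i] i by (cases "j = i") auto
      moreover have "ys ! 0 \<le> ys ! j" using less[of 0 j] j by (cases "j = 0") auto
      moreover have "ys ! Suc i < len c" if "Suc i < length ys" using rng[OF that] by simp
      ultimately show ?thesis using rng[OF j(1)] by (auto simp: j(2) arc_dist_def)
    next
      case False
      then have "ys ! i < ys ! j" "Suc i < length ys" using less j by auto
      moreover have "ys ! Suc i \<le> ys ! j" using less[of "Suc i" j] False j by (cases "j = Suc i") auto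
      ultimately show ?thesis by (auto simp: j(2) arc_dist_def)
    qed
  next
    show "(if Suc i < length ys then ys ! Suc i - ys ! i else ys ! 0 + len c - ys ! i)
       \<in> arc_dist len c (ys ! i) ` circle_gluings V c"
    proof (cases "Suc i < length ys")
      case True
      then show ?thesis using less[of i "Suc i"] set
        by (auto simp: arc_dist_def intro!: image_eqI[of _ _ "ys ! Suc i"] dest: nth_mem)
    next
      case False
      have "ys ! 0 \<le> ys ! i" using less[of 0 i] i by (cases "i = 0") auto
      moreover have "ys ! 0 \<in> circle_gluings V c" using i set by (metis length_pos_if_in_set nth_mem)
      ultimately show ?thesis using False by (auto simp: arc_dist_def intro!: image_eqI[of _ _ "ys ! 0"])
    qed
  qed
  show ?R
  proof (cases "Suc i < length ys")
    case True
    then show ?thesis using \<open>?L\<close> rng[OF True] by (simp add: arc_end_def)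
  next
    case False
    then have "Suc i = length ys" using i by simp
    moreover have "(ys ! 0 + len c) rmod len c = ys ! 0"
    proof (rule rmod_unique[where n = 1])
      have "0 < length ys" using i by linarith
      then show "ys ! 0 \<in> {0..<\<bar>len c\<bar>}" using rng[of 0] by auto
    qed simp
    ultimately show ?thesis using \<open>?L\<close> by (simp add: arc_end_def)
  qed
qed

lemma mod_rotate:
  fixes j k n :: nat
  assumes "j < n" "k < n"
  obtains t where "t < n" "(j + t) mod n = k"
proof (cases "j \<le> k")
  case True
  then show ?thesis using assms that[of "k - j"] by auto
next
  case False
  then show ?thesis using assms that[of "n + k - j"] by auto
qed

lemma mod_rotate_neq:
  fixes j t n :: nat
  assumes "j < n" "0 < t" "t < n"
  shows "(j + t) mod n \<noteq> j"
  using assms by (cases "j + t < n") (auto simp: mod_if)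

locale circles =
  fixes C :: "'c set" and color :: "'c \<Rightarrow> nat" and len :: "'c \<Rightarrow> real"
  assumes finite_C: "finite C" and card_C: "2 \<le> card C" and len_pos: "c \<in> C \<Longrightarrow> 0 < len c"
begin

abbreviation "generic \<equiv> generic_cacti C color len"
abbreviation "labelled \<equiv> labelled_cacti C color len"
abbreviation "chart \<equiv> chart_image C color len"
abbreviation "rotation \<equiv> rotation_rel C color len"
abbreviation "relabs \<equiv> relabelings C color len"
abbreviation "rot \<equiv> rotate_circles len"
abbreviation "trees \<equiv> colored_trees color C"

definition sorted_gluings :: "('c \<times> real) set set \<Rightarrow> 'c \<Rightarrow> real list" where
  "sorted_gluings V c = sorted_list_of_set (circle_gluings V c)"

lemma nbrs_nonempty: "tree C E \<Longrightarrow> c \<in> C \<Longrightarrow> nbrs E c \<noteq> {}"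
  using tree_card_nbrs_pos[of C E c] card_C by auto

text \<open>\<open>arc_end\<close> is the cyclic successor, so following the arcs one meets every
  gluing point of the circle. This shows later that a cycle confined to one circle contains all of
  its arcs.\<close>

lemma circle_subset_closed:
  assumes P: "finite (circle_gluings V c)" "circle_gluings V c \<subseteq> {0..<len c}"
    and A: "(c, x) \<in> A" "x \<in> circle_gluings V c"
    and closed: "\<And>y. (c, y) \<in> A \<Longrightarrow> y \<in> circle_gluings V c \<Longrightarrow> arc_end len V (c, y) \<in> A"
    and y: "y \<in> circle_gluings V c"
  shows "(c, y) \<in> A"
proof -
  define ys where "ys = sorted_gluings V c"
  have ys: "set ys = circle_gluings V c" "sorted_wrt (<) ys"
    using P by (auto simp: ys_def sorted_gluings_def)
  define n where "n = length ys"
  obtain j where j: "j < n" "x = ys ! j" using A(2) ys by (metis in_set_conv_nth n_def)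
  obtain k where k: "k < n" "y = ys ! k" using y ys by (metis in_set_conv_nth n_def)
  have n: "n > 0" using j by simp
  have "(c, ys ! ((j + t) mod n)) \<in> A" for t
  proof (induction t)
    case 0
    then show ?case using A j by simp
  next
    case (Suc t)
    have lt: "(j + t) mod n < length ys" using n by (simp add: n_def)
    have "arc_end len V (c, ys ! ((j + t) mod n)) \<in> A"
      using ys lt by (intro closed Suc) (metis nth_mem)
    then show ?case using arc_end_nth[where len = len, OF P ys lt] by (simp add: n_def mod_Suc_eq)
  qed
  moreover obtain t where "(j + t) mod n = k" using j k mod_rotate by blast
  ultimately show ?thesis using k by metis
qed

subsection \<open>Generic cacti are trees with gluing positions\<close>

text \<open>\<open>p c a\<close> is the position on \<open>c\<close> of its gluing point with
  \<open>a\<close>. An edge is read in both orders and yields the same vertex each time; only the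
  values with \<open>a \<in> nbrs E c\<close> matter.\<close>

definition gluing :: "'c set set \<Rightarrow> ('c \<Rightarrow> 'c \<Rightarrow> real) \<Rightarrow> ('c \<times> real) set set" where
  "gluing E p = {{(c, p c a), (a, p a c)} | c a. {c, a} \<in> E}"

definition positions :: "'c set set \<Rightarrow> ('c \<Rightarrow> 'c \<Rightarrow> real) \<Rightarrow> bool" where
  "positions E p \<longleftrightarrow> (\<forall>c. inj_on (p c) (nbrs E c) \<and> (\<forall>a\<in>nbrs E c. 0 \<le> p c a \<and> p c a < len c))"

lemma gluing_point:
  assumes "v \<in> gluing E p" "(c, x) \<in> v"
  obtains a where "a \<in> nbrs E c" "x = p c a" "v = {(c, p c a), (a, p a c)}"
proof -
  from assms obtain d b where v: "v = {(d, p d b), (b, p b d)}" "{d, b} \<in> E" by (auto simp: gluing_def)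
  with assms(2) consider "c = d" "x = p d b" | "c = b" "x = p b d" by auto
  then show thesis
    by cases (use v that[of b] that[of d] in \<open>auto simp: nbrs_def insert_commute\<close>)
qed

lemma gluing_vertex:
  assumes "a \<in> nbrs E c"
  shows "{(c, p c a), (a, p a c)} \<in> gluing E p"
  using assms by (auto simp: gluing_def nbrs_def)

lemma gluing_point_unique:
  assumes "positions E p" "v \<in> gluing E p" "(c, p c a) \<in> v" "a \<in> nbrs E c"
  shows "v = {(c, p c a), (a, p a c)}"
  using assms(2,3)
proof (rule gluing_point)
  fix b assume b: "b \<in> nbrs E c" "p c a = p c b" "v = {(c, p c b), (b, p b c)}"
  then have "a = b" using assms(1,4) by (auto simp: positions_def dest: inj_onD)
  with b show ?thesis by simp
qed

lemma circle_gluings_gluing: "circle_gluings (gluing E p) c = p c ` nbrs E c"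
proof (intro equalityI subsetI)
  fix x assume "x \<in> circle_gluings (gluing E p) c"
  then show "x \<in> p c ` nbrs E c" by (auto simp: circle_gluings_def elim: gluing_point)
next
  fix x assume "x \<in> p c ` nbrs E c"
  then show "x \<in> circle_gluings (gluing E p) c"
    using gluing_vertex[of _ E c p] by (auto simp: circle_gluings_def)
qed

lemma gluing_circle_gluings_ok:
  assumes "tree C E" "positions E p"
  shows "finite (circle_gluings (gluing E p) c)" "circle_gluings (gluing E p) c \<subseteq> {0..<len c}"
  using assms finite_nbrs[OF assms(1)] by (auto simp: circle_gluings_gluing positions_def)

lemma disjoint_gluing:
  assumes "positions E p"
  shows "disjoint (gluing E p)"
  unfolding disjoint_def
proof (intro ballI impI)
  fix v w assume v: "v \<in> gluing E p" and w: "w \<in> gluing E p" and "v \<noteq> w"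
  show "v \<inter> w = {}"
  proof (rule ccontr)
    assume "v \<inter> w \<noteq> {}"
    then obtain c x where cx: "(c, x) \<in> v" "(c, x) \<in> w" by auto
    obtain a where a: "a \<in> nbrs E c" "x = p c a" "v = {(c, p c a), (a, p a c)}"
      using gluing_point[OF v cx(1)] .
    then have "w = v" using gluing_point_unique[OF assms w, of c a] cx by simp
    with \<open>v \<noteq> w\<close> show False by simp
  qed
qed

lemma gluing_fst_inj: "inj_on (image fst) (gluing E p)"
  by (rule inj_onI) (auto simp: gluing_def doubleton_eq_iff)

lemma gluing_fst_edge: "v \<in> gluing E p \<Longrightarrow> fst ` v \<in> E"
  by (auto simp: gluing_def)

lemma gluing_fst_unique:
  assumes "tree C E" "v \<in> gluing E p" "(c, x) \<in> v" "(c, y) \<in> v"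
  shows "x = y"
  using assms(2,3)
proof (rule gluing_point)
  fix a assume a: "a \<in> nbrs E c" "x = p c a" "v = {(c, p c a), (a, p a c)}"
  then have "a \<noteq> c" using tree_nbrs_subset[OF assms(1)] by auto
  with a assms(4) show ?thesis by auto
qed

lemma constellation_gluing:
  assumes "E \<in> trees" "positions E p"
  shows "constellation C color len (gluing E p)"
  unfolding constellation_def
proof (intro conjI)
  have t: "tree C E" and col: "\<And>u v. {u, v} \<in> E \<Longrightarrow> color u \<noteq> color v"
    using assms by (auto simp: colored_trees_def)
  have sub: "c \<in> C \<and> a \<in> C" if "{c, a} \<in> E" for c a using tree_edge_subset[OF t that] by auto
  have "gluing E p \<subseteq> (\<lambda>(c, a). {(c, p c a), (a, p a c)}) ` (C \<times> C)"
    using sub by (auto simp: gluing_def)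
  then show "finite (gluing E p)" by (rule finite_subset) (simp add: finite_C)
  show "disjoint (gluing E p)" using assms(2) by (rule disjoint_gluing)
  show "\<Union> (gluing E p) \<subseteq> circle_points C len"
    using sub assms(2) by (auto simp: gluing_def circle_points_def positions_def nbrs_def insert_commute)
  show "\<forall>v\<in>gluing E p. 2 \<le> card v \<and> inj_on (color \<circ> fst) v"
  proof
    fix v assume "v \<in> gluing E p"
    then obtain c a where v: "v = {(c, p c a), (a, p a c)}" "{c, a} \<in> E" by (auto simp: gluing_def)
    with col have "color c \<noteq> color a" by auto
    moreover from this have "c \<noteq> a" by auto
    ultimately show "2 \<le> card v \<and> inj_on (color \<circ> fst) v" by (simp add: v)
  qed
  have "{(a, b). {a, b} \<in> E} \<subseteq> {(c, c'). \<exists>v\<in>gluing E p. c \<in> fst ` v \<and> c' \<in> fst ` v}"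
  proof clarify
    fix a b assume "{a, b} \<in> E"
    then have "{(a, p a b), (b, p b a)} \<in> gluing E p" by (auto simp: gluing_def)
    then show "\<exists>v\<in>gluing E p. a \<in> fst ` v \<and> b \<in> fst ` v" by (rule bexI[rotated]) auto
  qed
  from rtrancl_mono[OF this]
  show "C \<times> C \<subseteq> {(c, c'). \<exists>v\<in>gluing E p. c \<in> fst ` v \<and> c' \<in> fst ` v}\<^sup>*"
    using tree_connected[OF t] by blast
qed

text \<open>If two consecutive arcs lie on different circles, the vertex between them is an edge of
  the tree, hence a bridge. A simple cycle does not meet this vertex again, so after crossing it
  stays on one side and cannot close up. All arcs thus lie on one circle, and a closed walk there
  with distinct arcs has to use every arc.\<close>

lemma gluing_cycle_is_circle:
  assumes E: "tree C E" and p: "positions E p"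
    and cyc: "graph_cycle len (gluing E p) vs es"
  shows "\<exists>c\<in>C. set es = {q \<in> \<Union>(gluing E p). fst q = c}"
proof -
  define V where "V = gluing E p"
  define n where "n = length es"
  define cc where "cc i = fst (es ! i)" for i
  have n: "n > 0" "length vs = n" "distinct vs" "distinct es" "set vs \<subseteq> V" "set es \<subseteq> \<Union>V"
    and joins: "\<And>i. i < n \<Longrightarrow> arc_joins len V (es ! i) (vs ! i) (vs ! (Suc i mod n))"
    using cyc by (auto simp: graph_cycle_def n_def V_def)
  have vsV: "vs ! i \<in> V" if "i < n" for i using n that by auto
  have cc: "cc i \<in> fst ` (vs ! i)" "cc i \<in> fst ` (vs ! (Suc i mod n))" if "i < n" for i
  proof -
    have "fst (arc_end len V (es ! i)) = cc i" by (simp add: cc_def)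
    then show "cc i \<in> fst ` (vs ! i)" "cc i \<in> fst ` (vs ! (Suc i mod n))"
      using joins[OF that] unfolding arc_joins_def cc_def by (metis imageI)+
  qed
  have step: "cc (Suc i mod n) = cc i" if i: "i < n" for i
  proof (rule ccontr)
    define s where "s = Suc i mod n"
    assume "cc (Suc i mod n) \<noteq> cc i"
    then have ne: "cc s \<noteq> cc i" by (simp add: s_def)
    have s: "s < n" using n by (simp add: s_def)
    obtain a b where ab: "fst ` (vs ! s) = {a, b}"
      using gluing_fst_edge[of "vs ! s" E p] vsV[OF s] tree_edgeE[OF E] by (metis V_def)
    have edge: "fst ` (vs ! s) = {cc s, cc i}"
      using cc(2)[OF i] cc(1)[OF s] ne unfolding ab s_def[symmetric] by auto
    then have "{cc s, cc i} \<in> E" using gluing_fst_edge[of "vs ! s" E p] vsV[OF s] by (simp add: V_def)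
    then obtain Q where Q: "cc s \<in> Q" "cc i \<notin> Q"
      "\<And>e. e \<in> E \<Longrightarrow> e \<noteq> {cc s, cc i} \<Longrightarrow> e \<subseteq> Q \<or> e \<inter> Q = {}"
      using tree_edge_cut[OF E] by metis
    \<comment> \<open>From \<open>vs ! s\<close> onwards the cycle meets only other vertices, whose
      pairs of circles do not cross the cut, until it arrives at the arc \<open>i\<close>, which
      lies on the far side.\<close>
    have "cc ((s + t) mod n) \<in> Q" if "t < n" for t
      using that
    proof (induction t)
      case 0
      then show ?case using Q s by simp
    next
      case (Suc t)
      define k where "k = (s + t) mod n"
      have k: "k < n" "Suc k mod n = (s + Suc t) mod n" using n by (auto simp: k_def mod_Suc_eq)
      have kn: "Suc k mod n < n" using n by simp
      have "Suc k mod n \<noteq> s"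
        unfolding k using s Suc.prems by (intro mod_rotate_neq) auto
      then have "vs ! (Suc k mod n) \<noteq> vs ! s" using n s kn by (metis nth_eq_iff_index_eq)
      then have "fst ` (vs ! (Suc k mod n)) \<noteq> {cc s, cc i}"
        using gluing_fst_inj[of E p] vsV[OF s] vsV[OF kn] edge unfolding V_def inj_on_def by metis
      then have "fst ` (vs ! (Suc k mod n)) \<subseteq> Q \<or> fst ` (vs ! (Suc k mod n)) \<inter> Q = {}"
        using Q(3) gluing_fst_edge vsV[OF kn] by (metis V_def)
      moreover have "cc k \<in> Q" using Suc by (simp add: k_def)
      ultimately show ?case using cc(2)[OF k(1)] cc(1)[OF kn] unfolding k by blast
    qed
    moreover obtain t where "t < n" "(s + t) mod n = i" using mod_rotate[OF s i] .
    ultimately show False using Q by metis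
  qed
  define c where "c = cc 0"
  have cc_c: "cc i = c" if "i < n" for i
    using that
  proof (induction i)
    case (Suc i)
    then show ?case using step[of i] by simp
  qed (simp add: c_def)
  have cC: "c \<in> C"
  proof -
    have "fst ` (vs ! 0) \<in> E" using vsV n gluing_fst_edge by (metis V_def)
    then show ?thesis using cc(1)[OF n(1)] tree_edge_subset[OF E] by (auto simp: c_def)
  qed
  have "\<exists>q. q \<in> vs ! i \<and> fst q = c" if "i < n" for i
    using cc(1)[OF that] cc_c[OF that] by auto
  then obtain q where q: "\<And>i. i < n \<Longrightarrow> q i \<in> vs ! i \<and> fst (q i) = c" by metis
  have q_unique: "r = q i" if "i < n" "r \<in> vs ! i" "fst r = c" for i r
    using gluing_fst_unique[OF E, of "vs ! i" p c "snd r" "snd (q i)"] that q[OF that(1)] vsV[OF that(1)]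
    by (metis V_def prod.collapse)
  have ends: "es ! i \<in> q ` {..<n}" "arc_end len V (es ! i) \<in> q ` {..<n}" if i: "i < n" for i
  proof -
    have s: "Suc i mod n < n" using n by simp
    have *: "fst (es ! i) = c" "fst (arc_end len V (es ! i)) = c" using cc_c[OF i] by (auto simp: cc_def)
    have "es ! i = q i \<or> es ! i = q (Suc i mod n)"
      using joins[OF i] q_unique[OF i _ *(1)] q_unique[OF s _ *(1)] unfolding arc_joins_def by auto
    then show "es ! i \<in> q ` {..<n}" using i s by auto
    have "arc_end len V (es ! i) = q i \<or> arc_end len V (es ! i) = q (Suc i mod n)"
      using joins[OF i] q_unique[OF i _ *(2)] q_unique[OF s _ *(2)] unfolding arc_joins_def by auto
    then show "arc_end len V (es ! i) \<in> q ` {..<n}" using i s by auto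
  qed
  \<comment> \<open>\<open>n\<close> distinct arcs start in at most \<open>n\<close> points, so
    every \<open>q i\<close> is the start of an arc of the cycle. Hence the end of each of these
    arcs starts another one. The joins alone do not show this, as arcs may be traversed against
    their orientation.\<close>
  have es_q: "set es = q ` {..<n}"
  proof (rule card_subset_eq)
    show "set es \<subseteq> q ` {..<n}" using ends(1) by (metis in_set_conv_nth n_def subsetI)
    have "card (q ` {..<n}) \<le> card (set es)" using card_image_le[of "{..<n}" q] n by (simp add: distinct_card n_def)
    moreover have "card (set es) \<le> card (q ` {..<n})" using \<open>set es \<subseteq> q ` {..<n}\<close> by (simp add: card_mono)
    ultimately show "card (set es) = card (q ` {..<n})" by simp
  qed simp
  have ok: "finite (circle_gluings V c)" "circle_gluings V c \<subseteq> {0..<len c}"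
    using gluing_circle_gluings_ok[OF E p] by (auto simp: V_def)
  have "set es = {q \<in> \<Union>V. fst q = c}"
  proof (intro equalityI subsetI)
    fix e assume e: "e \<in> set es"
    then obtain i where "i < n" "e = es ! i" by (auto simp: in_set_conv_nth n_def)
    then show "e \<in> {q \<in> \<Union>V. fst q = c}" using cc_c n e by (auto simp: cc_def)
  next
    fix r assume "r \<in> {q \<in> \<Union>V. fst q = c}"
    then obtain y where r: "r = (c, y)" "y \<in> circle_gluings V c" by (cases r) (auto simp: circle_gluings_def)
    have e0: "es ! 0 = (c, snd (es ! 0))" using cc_c[OF n(1)] by (metis cc_def prod.collapse)
    have e0': "es ! 0 \<in> set es" using n(1) by (simp add: n_def)
    show "r \<in> set es" unfolding r(1)
    proof (rule circle_subset_closed[OF ok, where x = "snd (es ! 0)"])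
      show "(c, snd (es ! 0)) \<in> set es" using e0 e0' by simp
      show "snd (es ! 0) \<in> circle_gluings V c"
        using e0 e0' n(6) unfolding circle_gluings_def by (metis mem_Collect_eq subsetD)
      fix z assume "(c, z) \<in> set es"
      then obtain i where "i < n" "(c, z) = es ! i" by (auto simp: in_set_conv_nth n_def)
      then show "arc_end len V (c, z) \<in> set es" using ends(2) es_q by metis
    qed (rule r(2))
  qed
  with cC show ?thesis by (auto simp: V_def)
qed

lemma gluing_generic_cactus:
  assumes "E \<in> trees" "positions E p"
  shows "gluing E p \<in> generic"
proof -
  have t: "tree C E" using assms by (auto simp: colored_trees_def)
  have "card v = 2" if "v \<in> gluing E p" for v
  proof -
    from that obtain c a where v: "v = {(c, p c a), (a, p a c)}" "{c, a} \<in> E" by (auto simp: gluing_def)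
    then have "c \<noteq> a" using tree_nbrs_subset[OF t, of c] by (auto simp: nbrs_def)
    with v show ?thesis by simp
  qed
  then show ?thesis
    using constellation_gluing[OF assms] gluing_cycle_is_circle[OF t assms(2)]
    by (auto simp: generic_cacti_def cacti_def)
qed

end

section \<open>Every generic cactus comes from a tree of circles\<close>

lemma rtrancl_crossing:
  assumes "(a, b) \<in> r\<^sup>*" "a \<in> S" "b \<notin> S"
  obtains u w where "(u, w) \<in> r" "u \<in> S" "w \<notin> S"
  using assms by (induction arbitrary: thesis rule: rtrancl_induct) blast+

text \<open>A largest subtree is spanning: a chain of circles that leaves it provides one more edge.
  Since several gluing points might a priori join the same two circles, the subtree is a set
  \<open>V'\<close> of gluing points on which \<open>f\<close> is injective.\<close>

lemma spanning_subtree: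
  assumes fin: "finite C" and ne: "c0 \<in> C"
    and conn: "C \<times> C \<subseteq> {(c, c'). \<exists>v\<in>V. c \<in> f v \<and> c' \<in> f v}\<^sup>*"
    and edges: "\<And>v. v \<in> V \<Longrightarrow> f v \<subseteq> C \<and> card (f v) = 2"
  obtains V' where "V' \<subseteq> V" "inj_on f V'" "tree C (f ` V')"
proof -
  define P where "P S \<longleftrightarrow> S \<subseteq> C \<and> c0 \<in> S \<and> (\<exists>V'\<subseteq>V. inj_on f V' \<and> tree S (f ` V'))" for S
  have "P {c0}" unfolding P_def using ne by (auto intro!: exI[of _ "{}"] tree.singleton)
  moreover have "\<forall>S. P S \<longrightarrow> card S \<le> card C" using card_mono[OF fin] by (simp add: P_def)
  ultimately have "\<exists>S. P S \<and> (\<forall>S'. P S' \<longrightarrow> card S' \<le> card S)"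
    using ex_has_greatest_nat[of P "{c0}" card "Suc (card C)"] by (simp add: less_Suc_eq_le)
  then obtain S where S: "P S" and max: "\<And>S'. P S' \<Longrightarrow> card S' \<le> card S" by blast
  from S obtain V' where V': "V' \<subseteq> V" "inj_on f V'" "tree S (f ` V')" and SC: "S \<subseteq> C" "c0 \<in> S"
    by (auto simp: P_def)
  have "S = C"
  proof (rule ccontr)
    assume "S \<noteq> C"
    then obtain c1 where c1: "c1 \<in> C" "c1 \<notin> S" using SC by auto
    have "(c0, c1) \<in> {(c, c'). \<exists>v\<in>V. c \<in> f v \<and> c' \<in> f v}\<^sup>*" using conn ne c1 by blast
    then obtain u w where uw: "(u, w) \<in> {(c, c'). \<exists>v\<in>V. c \<in> f v \<and> c' \<in> f v}" "u \<in> S" "w \<notin> S"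
      using SC(2) c1(2) by (rule rtrancl_crossing)
    then obtain v where v: "v \<in> V" "u \<in> f v" "w \<in> f v" by auto
    have "u \<noteq> w" using uw by auto
    with v edges[OF v(1)] have fv: "f v = {u, w}" by (auto simp: card_2_iff)
    then have nin: "f v \<notin> f ` V'" using tree_edge_subset[OF V'(3), of "f v"] uw by auto
    then have "inj_on f (insert v V')" using V'(2) by (auto simp: inj_on_def)
    moreover have "tree (insert w S) (f ` insert v V')"
      using tree.add_leaf[OF V'(3) uw(2,3)] fv by simp
    moreover have "insert v V' \<subseteq> V" "insert w S \<subseteq> C" "c0 \<in> insert w S"
      using SC V'(1) v(1) edges[OF v(1)] fv by auto
    ultimately have "P (insert w S)" unfolding P_def by blast
    then have "card (insert w S) \<le> card S" by (rule max)
    then show False using uw(3) SC(1) fin finite_subset by fastforce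
  qed
  with V' show thesis using that by simp
qed

context circles
begin

lemma generic_vertexE:
  assumes "V \<in> generic" "v \<in> V"
  obtains c x c' x' where "v = {(c, x), (c', x')}" "color c \<noteq> color c'" "c \<in> C" "c' \<in> C"
    "0 \<le> x" "x < len c" "0 \<le> x'" "x' < len c'"
proof -
  have con: "constellation C color len V" and c2: "card v = 2"
    using assms by (auto simp: generic_cacti_def cacti_def)
  from c2 obtain q r where v: "v = {q, r}" "q \<noteq> r" by (auto simp: card_2_iff)
  have "inj_on (color \<circ> fst) v" "v \<subseteq> circle_points C len"
    using con assms(2) by (auto simp: constellation_def)
  with v show thesis
    by (intro that[of "fst q" "snd q" "fst r" "snd r"]) (auto simp: circle_points_def)
qed

text \<open>
  A gluing point \<open>v\<close> outside a spanning tree lies on a cycle of the graph that leaves \<open>v\<close> along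
  one of its circles and returns along the other: deleting \<open>v\<close> does not disconnect the remaining
  gluing points of any circle.
\<close>

lemma generic_cactus_spanning_tree:
  assumes V: "V \<in> generic" and V': "V' \<subseteq> V" "tree C (image fst ` V')"
  shows "V' = V"
proof (rule ccontr)
  assume "V' \<noteq> V"
  then obtain v where v: "v \<in> V" "v \<notin> V'" using V' by auto
  have con: "finite V" "disjoint V" "\<Union>V \<subseteq> circle_points C len"
    and inj: "\<And>u. u \<in> V \<Longrightarrow> inj_on (color \<circ> fst) u"
    and cyc: "\<And>vs es. graph_cycle len V vs es \<Longrightarrow> \<exists>c\<in>C. set es = {p \<in> \<Union>V. fst p = c}"
    using V by (auto simp: generic_cacti_def cacti_def constellation_def)
  have unique_point: "x = y" if "u \<in> V" "(d, x) \<in> u" "(d, y) \<in> u" for u d x y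
    using inj_onD[OF inj[OF that(1)] _ that(2,3)] by simp
  have unique_vertex: "u = w" if "u \<in> V" "w \<in> V" "r \<in> u" "r \<in> w" for u w r
    using con(2) that unfolding disjoint_def by blast
  have ok: "finite (circle_gluings V d)" "circle_gluings V d \<subseteq> {0..<len d}" for d
  proof -
    have "finite (\<Union>V)" using con(1) by (auto elim!: generic_vertexE[OF V])
    then have "finite (snd ` \<Union>V)" by simp
    then show "finite (circle_gluings V d)" by (rule finite_subset[rotated]) (force simp: circle_gluings_def)
    show "circle_gluings V d \<subseteq> {0..<len d}" using con(3) by (auto simp: circle_gluings_def circle_points_def)
  qed
  define S where "S d = sorted_gluings V d" for d
  have S: "set (S d) = circle_gluings V d" "sorted_wrt (<) (S d)" "distinct (S d)" for d
    using ok by (auto simp: S_def sorted_gluings_def)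
  have arc_end_S: "arc_end len V (d, S d ! i) = (d, S d ! (Suc i mod length (S d)))"
    if "i < length (S d)" for d i
    using arc_end_nth[where len = len, OF ok[of d] S(1,2)[of d] that] .
  have vertex_at: "\<exists>u\<in>V. (d, S d ! i) \<in> u" if "i < length (S d)" for d i
    using nth_mem[OF that] unfolding S(1) circle_gluings_def by auto

  \<comment> \<open>The spanning tree has an edge at \<open>d\<close>, so \<open>d\<close> carries a
    gluing point different from \<open>v\<close>, and the arc that starts at \<open>v\<close> does
    not return to \<open>v\<close> at once.\<close>
  have leave: "\<exists>w\<in>V. w \<noteq> v \<and> arc_end len V (d, y) \<in> w" if dy: "(d, y) \<in> v" for d y
  proof -
    have dC: "d \<in> C" using dy v(1) con(3) by (auto simp: circle_points_def)
    obtain u where "{d, u} \<in> image fst ` V'"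
      using nbrs_nonempty[OF V'(2) dC] by (auto simp: nbrs_def)
    then obtain v1 where v1: "v1 \<in> V'" "fst ` v1 = {d, u}" by auto
    then obtain y1 where y1: "(d, y1) \<in> v1" by (metis imageE insertI1 prod.collapse)
    have "y1 \<noteq> y" using unique_vertex[of v v1 "(d, y)"] v v1 y1 dy V'(1) by auto
    have "y \<in> set (S d)" "y1 \<in> set (S d)"
      using dy y1 v v1 V'(1) by (auto simp: S circle_gluings_def)
    then obtain i j where ij: "i < length (S d)" "y = S d ! i" "j < length (S d)" "y1 = S d ! j"
      by (metis in_set_conv_nth)
    have "i \<noteq> j" using ij \<open>y1 \<noteq> y\<close> by auto
    then have "2 \<le> length (S d)" using ij by linarith
    then have ne: "Suc i mod length (S d) \<noteq> i" by (cases "Suc i = length (S d)") (use ij in auto)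
    have lt: "Suc i mod length (S d) < length (S d)" using ij by (intro mod_less_divisor) auto
    obtain w where w: "w \<in> V" "(d, S d ! (Suc i mod length (S d))) \<in> w" using vertex_at[OF lt] by auto
    have "w \<noteq> v" using unique_point[OF v(1), of d y "S d ! (Suc i mod length (S d))"] w dy ij ne lt S(3)[of d]
      by (auto simp: nth_eq_iff_index_eq)
    then show ?thesis using w arc_end_S[OF ij(1)] ij by auto
  qed

  define g where "g a b \<longleftrightarrow> a \<in> V - {v} \<and> b \<in> V - {v} \<and> (\<exists>e\<in>\<Union>V. arc_joins len V e a b)" for a b
  have symg: "g\<^sup>*\<^sup>* b a" if "g\<^sup>*\<^sup>* a b" for a b
  proof -
    have "symp g" by (auto simp: symp_def g_def arc_joins_def)
    then have "symp g\<^sup>*\<^sup>*" by (rule symp_rtranclp)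
    with that show ?thesis by (auto dest: sympD)
  qed
  \<comment> \<open>A circle passes through \<open>v\<close> at most once. Deleting \<open>v\<close>
    turns it at worst into a path through all its other gluing points.\<close>
  have same_circle: "g\<^sup>*\<^sup>* a b"
    if ab: "a \<in> V - {v}" "b \<in> V - {v}" "d \<in> fst ` a" "d \<in> fst ` b" for a b d
  proof -
    define n where "n = length (S d)"
    have "\<exists>u. u \<in> V \<and> (d, S d ! i) \<in> u" if "i < n" for i
      using vertex_at[of i d] that by (auto simp: n_def)
    then obtain u where u: "\<And>i. i < n \<Longrightarrow> u i \<in> V \<and> (d, S d ! i) \<in> u i" by metis
    have index: "\<exists>k<n. w = u k" if w: "w \<in> V" "d \<in> fst ` w" for w
    proof -
      from w obtain x where x: "(d, x) \<in> w" by (metis imageE prod.collapse)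
      then have "x \<in> set (S d)" using w by (auto simp: S circle_gluings_def)
      then obtain k where "k < n" "x = S d ! k" by (auto simp: in_set_conv_nth n_def)
      then show ?thesis using unique_vertex[OF w(1), of "u k" "(d, x)"] u x by auto
    qed
    have n: "n > 0" using index[of a] ab by auto
    have next_mod: "g (u k) (u (Suc k mod n))" if "k < n" "u k \<noteq> v" "u (Suc k mod n) \<noteq> v" for k
    proof -
      have "Suc k mod n < n" using n by simp
      from u[OF this] u[OF that(1)] have uk: "u k \<in> V" "u (Suc k mod n) \<in> V"
        "(d, S d ! k) \<in> u k" "arc_end len V (d, S d ! k) \<in> u (Suc k mod n)"
        using that(1) arc_end_S[of k d] by (auto simp: n_def)
      then have "arc_joins len V (d, S d ! k) (u k) (u (Suc k mod n))" by (simp add: arc_joins_def)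
      with uk that(2,3) show ?thesis unfolding g_def by blast
    qed
    \<comment> \<open>The indices of the gluing points other than \<open>v\<close> form one cyclic
      interval from \<open>s\<close> to \<open>s + T\<close>. If \<open>v\<close> lies on
      \<open>d\<close>, the interval begins right after \<open>v\<close> and has
      \<open>n - 1\<close> points; otherwise it is the whole circle, cut at index 0.\<close>
    obtain s T where sT: "\<And>t. t \<le> T \<Longrightarrow> u ((s + t) mod n) \<noteq> v"
      "\<And>k. k < n \<Longrightarrow> u k \<noteq> v \<Longrightarrow> \<exists>t\<le>T. k = (s + t) mod n"
    proof (cases "d \<in> fst ` v")
      case True
      then obtain j where j: "j < n" "v = u j" using index[OF v(1)] by auto
      have uj: "k = j" if "k < n" "u k = v" for k
        using unique_point[OF v(1), of d "S d ! k" "S d ! j"] u[OF that(1)] u[OF j(1)] j that S(3)[of d]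
        by (auto simp: n_def nth_eq_iff_index_eq)
      obtain a' where a': "a' < n" "a = u a'" using index[of a] ab by auto
      then have "a' \<noteq> j" using j ab by auto
      then have n2: "2 \<le> n" using a' j by linarith
      show thesis
      proof (rule that[of "n - 2" "Suc j"])
        fix t assume "t \<le> n - 2"
        then have t: "Suc t < n" using n2 by simp
        have "(Suc j + t) mod n \<noteq> j"
          using mod_rotate_neq[OF j(1) _ t] by simp
        then show "u ((Suc j + t) mod n) \<noteq> v" using uj[of "(Suc j + t) mod n"] n by auto
      next
        fix k assume k: "k < n" "u k \<noteq> v"
        obtain t where t: "t < n" "(j + t) mod n = k" using mod_rotate[OF j(1) k(1)] .
        with j k have "t \<noteq> 0" by (cases t) auto
        with t n2 show "\<exists>t\<le>n - 2. k = (Suc j + t) mod n" by (intro exI[of _ "t - 1"]) auto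
      qed
    next
      case False
      then have "u k \<noteq> v" if "k < n" for k using u[OF that] by force
      then show thesis using n
      proof (intro that[of "n - 1" 0])
        fix k assume "k < n"
        then show "\<exists>t\<le>n - 1. k = (0 + t) mod n" by (intro exI[of _ k]) auto
      qed auto
    qed
    have path: "g\<^sup>*\<^sup>* (u (s mod n)) (u ((s + t) mod n))" if "t \<le> T" for t
      using that
    proof (induction t)
      case (Suc t)
      have "g (u ((s + t) mod n)) (u (Suc ((s + t) mod n) mod n))"
        using n sT(1)[of t] sT(1)[of "Suc t"] Suc.prems by (intro next_mod) (auto simp: mod_Suc_eq)
      with Suc show ?case by (auto simp: mod_Suc_eq)
    qed simp
    have conn: "g\<^sup>*\<^sup>* (u (s mod n)) w" if w: "w \<in> V - {v}" "d \<in> fst ` w" for w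
    proof -
      obtain k where "k < n" "w = u k" using index[of w] w by auto
      then show ?thesis using sT(2)[of k] w path by auto
    qed
    show ?thesis using conn[of a] conn[of b] ab symg by (meson rtranclp_trans)
  qed
  \<comment> \<open>Circles are changed only at gluing points of the spanning tree, which does not
    contain \<open>v\<close>.\<close>
  have chain: "\<forall>b. b \<in> V - {v} \<and> d \<in> fst ` b \<longrightarrow> g\<^sup>*\<^sup>* a b"
    if "(c, d) \<in> {(a, b). {a, b} \<in> image fst ` V'}\<^sup>*" and a: "a \<in> V - {v}" "c \<in> fst ` a" for c d a
    using that(1)
  proof (induction rule: rtrancl_induct)
    case base
    then show ?case using same_circle a by blast
  next
    case (step d d')
    then obtain w where w: "w \<in> V'" "fst ` w = {d, d'}" by auto
    then have wV: "w \<in> V - {v}" using v V'(1) by auto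
    show ?case
    proof (intro allI impI)
      fix b assume b: "b \<in> V - {v} \<and> d' \<in> fst ` b"
      have "g\<^sup>*\<^sup>* a w" using step.IH w wV by blast
      moreover have "g\<^sup>*\<^sup>* w b" using same_circle[OF wV, of b d'] b w by auto
      ultimately show "g\<^sup>*\<^sup>* a b" by (rule rtranclp_trans)
    qed
  qed

  obtain c x c' x' where vc: "v = {(c, x), (c', x')}" "color c \<noteq> color c'" "c \<in> C" "c' \<in> C"
    using generic_vertexE[OF V v(1)] by metis
  obtain w where w: "w \<in> V" "w \<noteq> v" "arc_end len V (c, x) \<in> w" using leave[of c x] vc by auto
  obtain w' where w': "w' \<in> V" "w' \<noteq> v" "arc_end len V (c', x') \<in> w'" using leave[of c' x'] vc by auto
  have cw: "c \<in> fst ` w" using w(3) by (metis fst_arc_end fst_conv imageI)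
  have cw': "c' \<in> fst ` w'" using w'(3) by (metis fst_arc_end fst_conv imageI)
  have "g\<^sup>*\<^sup>* w w'"
    using chain[OF tree_connected[OF V'(2) vc(3,4)], of w] w w' cw cw' by auto
  then obtain us0 where "rtrancl_path g w us0 w'" by (auto simp: rtranclp_eq_rtrancl_path)
  then obtain us where us: "rtrancl_path g w us w'" "distinct (w # us)"
    by (rule rtrancl_path_distinct)
  define vs where "vs = v # w # us"
  define n where "n = length vs"
  have us_g: "g ((w # us) ! i) (us ! i)" if "i < length us" for i
    using rtrancl_path_nth[OF us(1) that] .
  have us_V: "set us \<subseteq> V - {v}"
    using us_g unfolding g_def by (metis in_set_conv_nth subsetI)
  have vs: "set vs \<subseteq> V" "distinct vs"
    using us_V us(2) w v by (auto simp: vs_def)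
  have n2: "2 \<le> n" by (simp add: n_def vs_def)
  have last: "vs ! (n - 1) = w'"
  proof (cases "us = []")
    case True
    with us(1) have "w = w'" by (auto elim: rtrancl_path.cases)
    with True show ?thesis by (simp add: n_def vs_def)
  next
    case False
    then show ?thesis using rtrancl_path_last[OF us(1) False]
      by (simp add: n_def vs_def last_conv_nth nth_Cons')
  qed
  have "\<exists>e\<in>\<Union>V. arc_joins len V e (vs ! i) (vs ! Suc i)" if "0 < i" "Suc i < n" for i
    using us_g[of "i - 1"] that by (auto simp: g_def vs_def n_def nth_Cons')
  then obtain f where f: "\<And>i. 0 < i \<Longrightarrow> Suc i < n \<Longrightarrow> f i \<in> \<Union>V \<and> arc_joins len V (f i) (vs ! i) (vs ! Suc i)"
    by metis
  \<comment> \<open>Both extreme arcs start at \<open>v\<close>: the first leaves it along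
    \<open>c\<close>, the last is traversed backwards from \<open>w'\<close> to \<open>v\<close>
    along \<open>c'\<close>. For \<open>w = w'\<close> the cycle consists of just these two parallel
    arcs.\<close>
  define h where "h i = (if i = 0 then (c, x) else if Suc i = n then (c', x') else f i)" for i
  have h: "h i \<in> \<Union>V \<and> arc_joins len V (h i) (vs ! i) (vs ! (Suc i mod n))" if "i < n" for i
  proof -
    consider "i = 0" | "Suc i = n" "i \<noteq> 0" | "0 < i" "Suc i < n" using \<open>i < n\<close> by linarith
    then show ?thesis
    proof cases
      case 1
      then show ?thesis using n2 v vc w by (auto simp: h_def arc_joins_def vs_def)
    next
      case 2
      moreover from 2 have "vs ! i = w'" using last by auto
      ultimately show ?thesis using v vc w' by (auto simp: h_def arc_joins_def vs_def)
    next
      case 3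
      then show ?thesis using f[OF 3] by (simp add: h_def)
    qed
  qed
  have ends: "a \<in> {a', b'}" if "arc_joins len V e a b" "arc_joins len V e a' b'" "{a, b, a', b'} \<subseteq> V" for e a b a' b'
  proof -
    have *: "a \<in> V" "a' \<in> V" "b' \<in> V" using that(3) by auto
    from that(1) have "e \<in> a \<or> arc_end len V e \<in> a" by (auto simp: arc_joins_def)
    moreover from that(2) have "e \<in> a' \<or> e \<in> b'" "arc_end len V e \<in> a' \<or> arc_end len V e \<in> b'"
      by (auto simp: arc_joins_def)
    ultimately show ?thesis using unique_vertex[OF *(1,2)] unique_vertex[OF *(1,3)] by blast
  qed
  \<comment> \<open>An arc determines its end vertices. As the vertices are distinct, equal arcs at
    positions \<open>i < j\<close> would have to be the first and the last one, but these lie on the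
    different circles \<open>c\<close> and \<open>c'\<close>.\<close>
  have h_neq: "h i \<noteq> h j" if ij: "i < j" "j < n" for i j
  proof
    assume eq: "h i = h j"
    have in_V: "vs ! k \<in> V" if "k < n" for k using vs that by (auto simp: n_def)
    have "vs ! i \<in> {vs ! j, vs ! (Suc j mod n)}"
      using h[of i] h[of j] ij eq in_V by (intro ends[of "h i" "vs ! i" "vs ! (Suc i mod n)"]) auto
    moreover have "Suc j mod n < n" using ij by (intro mod_less_divisor) linarith
    ultimately have "i = Suc j mod n"
      using vs(2) ij unfolding n_def by (metis insertE nth_eq_iff_index_eq order.strict_trans order_less_irrefl singletonD)
    with ij have "i = 0" "Suc j = n" by (cases "Suc j = n"; simp)+
    with eq ij vc show False by (auto simp: h_def split: if_splits)
  qed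
  define es where "es = map h [0..<n]"
  have "graph_cycle len V vs es"
    unfolding graph_cycle_def
  proof (intro conjI allI impI)
    show "es \<noteq> []" using n2 by (simp add: es_def)
    show "distinct es"
      unfolding es_def distinct_map using h_neq by (auto simp: inj_on_def) (metis nat_neq_iff)
    show "set es \<subseteq> \<Union>V" using h by (auto simp: es_def)
    fix i assume "i < length es"
    then show "arc_joins len V (es ! i) (vs ! i) (vs ! (Suc i mod length es))"
      using h[of i] by (simp add: es_def)
  qed (use vs in \<open>auto simp: es_def n_def\<close>)
  from cyc[OF this] obtain d where d: "set es = {p \<in> \<Union>V. fst p = d}" by auto
  have "h 0 \<in> set es" "h (n - 1) \<in> set es" using n2 by (auto simp: es_def)
  then have "fst (h 0) = d" "fst (h (n - 1)) = d" unfolding d by auto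
  then have "c = c'" using n2 by (auto simp: h_def split: if_splits)
  with vc show False by simp
qed

text \<open>The spanning subtree exhausts all gluing points, so a gluing point is determined by its
  two circles. This makes the position of the gluing point of \<open>c\<close> with \<open>a\<close>
  a function \<open>p c a\<close>.\<close>

theorem generic_cactusE:
  assumes V: "V \<in> generic"
  obtains E p where "E \<in> trees" "positions E p" "V = gluing E p"
proof -
  have con: "constellation C color len V" using V by (simp add: generic_cacti_def cacti_def)
  obtain c0 where c0: "c0 \<in> C" using card_C by fastforce
  have "fst ` v \<subseteq> C \<and> card (fst ` v) = 2" if v: "v \<in> V" for v
  proof -
    obtain c x c' x' where vc: "v = {(c, x), (c', x')}" "color c \<noteq> color c'" "c \<in> C" "c' \<in> C"
      using generic_vertexE[OF V v] by metis
    then have "c \<noteq> c'" by auto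
    with vc show ?thesis by simp
  qed
  then obtain V' where V': "V' \<subseteq> V" "inj_on (image fst) V'" "tree C (image fst ` V')"
    using spanning_subtree[OF finite_C c0, of V "image fst"] con unfolding constellation_def by metis
  define E where "E = image fst ` V"
  have VV: "V' = V" using generic_cactus_spanning_tree[OF V V'(1,3)] .
  have inj: "inj_on (image fst) V" using V'(2) unfolding VV .
  have t: "tree C E" using V'(3) unfolding VV E_def .
  define p where "p c a = (THE x. \<exists>v\<in>V. (c, x) \<in> v \<and> a \<in> fst ` v)" for c a
  have p: "p c c' = x" if v: "v \<in> V" "v = {(c, x), (c', x')}" "c \<noteq> c'" for v c x c' x'
    unfolding p_def
  proof (rule the_equality)
    show "\<exists>v\<in>V. (c, x) \<in> v \<and> c' \<in> fst ` v" using v(1) by (rule bexI[rotated]) (simp add: v(2))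
    fix y assume "\<exists>w\<in>V. (c, y) \<in> w \<and> c' \<in> fst ` w"
    then obtain w where w: "w \<in> V" "(c, y) \<in> w" "c' \<in> fst ` w" by auto
    obtain d z d' z' where wd: "w = {(d, z), (d', z')}" using generic_vertexE[OF V w(1)] by metis
    have "fst ` w = {c, c'}"
      using w(2,3) \<open>c \<noteq> c'\<close> unfolding wd by auto
    then have "fst ` w = fst ` v" by (simp add: v(2))
    then have "w = v" using inj_onD[OF inj _ w(1) v(1)] by simp
    then show "y = x" using w(2) v(2,3) by auto
  qed
  have E_vertex: "\<exists>v\<in>V. v = {(c, p c a), (a, p a c)}" if "{c, a} \<in> E" for c a
  proof -
    from that obtain v where v: "v \<in> V" "fst ` v = {c, a}" by (auto simp: E_def)
    obtain d x d' x' where vd: "v = {(d, x), (d', x')}" "color d \<noteq> color d'"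
      using generic_vertexE[OF V v(1)] by metis
    then have "d \<noteq> d'" "v = {(d', x'), (d, x)}" by auto
    then have "p d d' = x" "p d' d = x'" using p v vd by blast+
    moreover have "c = d \<and> a = d' \<or> c = d' \<and> a = d" using v vd by (auto simp: doubleton_eq_iff)
    ultimately show ?thesis using v vd by (auto simp: insert_commute)
  qed
  have V_eq: "V = gluing E p"
  proof (intro equalityI subsetI)
    fix v assume v: "v \<in> V"
    obtain d x d' x' where vd: "v = {(d, x), (d', x')}" "color d \<noteq> color d'"
      using generic_vertexE[OF V v(1)] by metis
    then have "d \<noteq> d'" "v = {(d', x'), (d, x)}" by auto
    then have "p d d' = x" "p d' d = x'" using p v vd by blast+
    moreover have "fst ` v \<in> E" using v unfolding E_def by (rule imageI)
    then have "{d, d'} \<in> E" using vd(1) by simp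
    ultimately show "v \<in> gluing E p" unfolding gluing_def using vd(1) by blast
  next
    fix v assume "v \<in> gluing E p"
    then obtain c a where ca: "{c, a} \<in> E" "v = {(c, p c a), (a, p a c)}" unfolding gluing_def by blast
    show "v \<in> V" using E_vertex[OF ca(1)] ca(2) by simp
  qed
  have col: "color u \<noteq> color w" if "{u, w} \<in> E" for u w
  proof -
    from that obtain v where v: "v \<in> V" "fst ` v = {u, w}" by (auto simp: E_def)
    obtain d z d' z' where vd: "v = {(d, z), (d', z')}" "color d \<noteq> color d'"
      using generic_vertexE[OF V v(1)] by metis
    then have "{d, d'} = {u, w}" using v(2) by simp
    with vd(2) show ?thesis by (metis doubleton_eq_iff)
  qed
  have "positions E p"
    unfolding positions_def
  proof (intro allI conjI ballI inj_onI)
    fix c a assume "a \<in> nbrs E c"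
    then obtain v where v: "v \<in> V" "v = {(c, p c a), (a, p a c)}" using E_vertex by (auto simp: nbrs_def)
    then have "(c, p c a) \<in> circle_points C len" using con by (auto simp: constellation_def)
    then show "0 \<le> p c a" "p c a < len c" by (auto simp: circle_points_def)
    fix b assume "b \<in> nbrs E c" and eq: "p c a = p c b"
    then obtain w where w: "w \<in> V" "w = {(c, p c b), (b, p b c)}" using E_vertex by (auto simp: nbrs_def)
    have "disjoint V" using con by (simp add: constellation_def)
    moreover have "(c, p c a) \<in> v \<inter> w" using v(2) w(2) eq by simp
    ultimately have "v = w" using v(1) w(1) by (metis disjointD empty_iff)
    then have "fst ` {(c, p c a), (a, p a c)} = fst ` {(c, p c b), (b, p b c)}" using v w by simp
    moreover have "a \<noteq> c" "b \<noteq> c" using tree_nbrs_subset[OF t, of c] \<open>a \<in> nbrs E c\<close> \<open>b \<in> nbrs E c\<close> by auto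
    ultimately show "a = b" by (auto simp: doubleton_eq_iff)
  qed
  then show thesis using that V_eq t col by (auto simp: colored_trees_def)
qed

end


subsection \<open>Rotations\<close>

lemma rmod_eqE:
  obtains k :: int where "x rmod m = x + of_int k * m"
proof -
  have "[x = x rmod m] (rmod m)" by simp
  then show thesis using that by (auto simp: rcong_altdef)
qed

lemma multiple_eq_0_if_small:
  fixes d L :: real and k :: int
  assumes "d = of_int k * L" "\<bar>d\<bar> < L"
  shows "d = 0"
proof -
  have "0 < L" using assms(2) by linarith
  moreover from this have "\<bar>of_int k :: real\<bar> * L < 1 * L" using assms by (simp add: abs_mult)
  ultimately have "\<bar>of_int k :: real\<bar> < 1" by (simp only: mult_less_cancel_right_pos)
  then have "k = 0" by linarith
  then show ?thesis using assms by simp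
qed

lemma rmod_add_cancel:
  assumes "0 \<le> x" "x < L" "0 \<le> y" "y < L" "(x + t) rmod L = (y + t) rmod L"
  shows "x = y"
proof -
  obtain k1 where k1: "(x + t) rmod L = x + t + of_int k1 * L" by (rule rmod_eqE)
  obtain k2 where k2: "(y + t) rmod L = y + t + of_int k2 * L" by (rule rmod_eqE)
  have "x - y = of_int (k2 - k1) * L" using k1 k2 assms(5) by (simp add: algebra_simps)
  moreover have "\<bar>x - y\<bar> < L" using assms by auto
  ultimately have "x - y = 0" by (rule multiple_eq_0_if_small)
  then show ?thesis by simp
qed

lemma rmod_add_rmod: "(x rmod m + y) rmod m = (x + y) rmod m"
  by (metis rmod_add rmod_rmod)

text \<open>Both distances are congruent modulo \<open>len c\<close> and lie in
  \<open>{0<..len c}\<close>, a set of representatives; so they agree.\<close>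

lemma arc_dist_rotate:
  assumes "0 \<le> x" "x < len c" "0 \<le> y" "y < len c"
  shows "arc_dist len c ((x + t) rmod len c) ((y + t) rmod len c) = arc_dist len c x y"
proof -
  define L where "L = len c"
  have L: "0 < L" using assms by (simp add: L_def)
  define x' y' where "x' = (x + t) rmod L" and "y' = (y + t) rmod L"
  obtain k1 where k1: "x' = x + t + of_int k1 * L" unfolding x'_def by (rule rmod_eqE)
  obtain k2 where k2: "y' = y + t + of_int k2 * L" unfolding y'_def by (rule rmod_eqE)
  have rng: "0 \<le> x'" "x' < L" "0 \<le> y'" "y' < L" using L by (auto simp: x'_def y'_def rmod_nonneg rmod_less)
  define d1 d2 where "d1 = arc_dist len c x' y'" and "d2 = arc_dist len c x y"
  obtain j1 :: int where j1: "d1 = y' - x' + of_int j1 * L"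
    unfolding d1_def arc_dist_def L_def by (metis add_0_right mult_1 mult_zero_left of_int_0 of_int_1)
  obtain j2 :: int where j2: "d2 = y - x + of_int j2 * L"
    unfolding d2_def arc_dist_def L_def by (metis add_0_right mult_1 mult_zero_left of_int_0 of_int_1)
  have "d1 - d2 = of_int (k2 - k1 + j1 - j2) * L" using j1 j2 k1 k2 by (simp add: algebra_simps)
  moreover have "0 < d1" "d1 \<le> L" "0 < d2" "d2 \<le> L"
    using rng assms by (auto simp: d1_def d2_def arc_dist_def L_def)
  then have "\<bar>d1 - d2\<bar> < L" by auto
  ultimately have "d1 - d2 = 0" by (rule multiple_eq_0_if_small)
  then show ?thesis by (simp add: d1_def d2_def x'_def y'_def L_def)
qed

context circles
begin

lemma gluing_cong:
  assumes "\<And>c a. a \<in> nbrs E c \<Longrightarrow> p c a = q c a"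
  shows "gluing E p = gluing E q"
proof -
  have "p c a = q c a \<and> p a c = q a c" if "{c, a} \<in> E" for c a
    using assms[of a c] assms[of c a] that by (simp add: nbrs_def insert_commute)
  then show ?thesis unfolding gluing_def by (metis (no_types, opaque_lifting))
qed

definition rotate_positions :: "('c \<Rightarrow> real) \<Rightarrow> ('c \<Rightarrow> 'c \<Rightarrow> real) \<Rightarrow> 'c \<Rightarrow> 'c \<Rightarrow> real" where
  "rotate_positions t p c a = (p c a + t c) rmod len c"

lemma rotate_gluing: "rot t (gluing E p) = gluing E (rotate_positions t p)"
proof -
  have *: "(\<lambda>(c, x). (c, (x + t c) rmod len c)) ` {(c, p c a), (a, p a c)} =
     {(c, rotate_positions t p c a), (a, rotate_positions t p a c)}" for c a
    by (simp add: rotate_positions_def)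
  show ?thesis
  proof (intro equalityI subsetI)
    fix v assume "v \<in> rot t (gluing E p)"
    then obtain c a where "{c, a} \<in> E"
      "v = (\<lambda>(c, x). (c, (x + t c) rmod len c)) ` {(c, p c a), (a, p a c)}"
      unfolding rotate_circles_def gluing_def by blast
    then show "v \<in> gluing E (rotate_positions t p)" unfolding * gluing_def by blast
  next
    fix v assume "v \<in> gluing E (rotate_positions t p)"
    then obtain c a where "{c, a} \<in> E"
      "v = (\<lambda>(c, x). (c, (x + t c) rmod len c)) ` {(c, p c a), (a, p a c)}"
      unfolding * gluing_def by blast
    then show "v \<in> rot t (gluing E p)" unfolding rotate_circles_def gluing_def by blast
  qed
qed

lemma nbrs_in_C: "tree C E \<Longrightarrow> a \<in> nbrs E c \<Longrightarrow> c \<in> C \<and> a \<in> C \<and> a \<noteq> c"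
  using tree_nbrs_outside[of C E c] tree_nbrs_subset[of C E c] by auto

lemma positions_rotate:
  assumes "tree C E" "positions E p"
  shows "positions E (rotate_positions t p)"
  unfolding positions_def
proof (intro allI conjI ballI inj_onI)
  fix c a assume a: "a \<in> nbrs E c"
  then have "0 < len c" using nbrs_in_C[OF assms(1)] len_pos by blast
  then show "0 \<le> rotate_positions t p c a" "rotate_positions t p c a < len c"
    by (auto simp: rotate_positions_def rmod_nonneg rmod_less)
  fix b assume b: "b \<in> nbrs E c" and "rotate_positions t p c a = rotate_positions t p c b"
  then have "p c a = p c b" using a assms(2)
    by (intro rmod_add_cancel[of "p c a" "len c" "p c b" "t c"]) (auto simp: positions_def rotate_positions_def)
  then show "a = b" using a b assms(2) by (auto simp: positions_def dest: inj_onD)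
qed

definition gluing_arc :: "'c set set \<Rightarrow> ('c \<Rightarrow> 'c \<Rightarrow> real) \<Rightarrow> 'c \<Rightarrow> 'c \<Rightarrow> real" where
  "gluing_arc E p c a = arc_length len (gluing E p) (c, p c a)"

lemma gluing_arc_rotate:
  assumes "positions E p" "a \<in> nbrs E c"
  shows "gluing_arc E (rotate_positions t p) c a = gluing_arc E p c a"
proof -
  have "arc_dist len c (rotate_positions t p c a) ` rotate_positions t p c ` nbrs E c =
        arc_dist len c (p c a) ` p c ` nbrs E c"
    unfolding image_image
    by (rule image_cong[OF refl]) (use assms in \<open>auto simp: rotate_positions_def positions_def intro!: arc_dist_rotate\<close>)
  then show ?thesis
    by (simp add: gluing_arc_def arc_length_eq_Min circle_gluings_gluing)
qed

subsection \<open>Types and coordinates of a gluing\<close>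

lemma arc_end_in_gluing:
  assumes "tree C E" "positions E p" "a \<in> nbrs E c"
  obtains b where "b \<in> nbrs E c" "arc_end len (gluing E p) (c, p c a) = (c, p c b)"
proof -
  let ?V = "gluing E p"
  define ys where "ys = sorted_gluings ?V c"
  note ok = gluing_circle_gluings_ok[OF assms(1,2), of c]
  have ys: "set ys = circle_gluings ?V c" "sorted_wrt (<) ys" using ok by (auto simp: ys_def sorted_gluings_def)
  have "p c a \<in> set ys" using assms(3) by (simp add: ys circle_gluings_gluing)
  then obtain i where i: "i < length ys" "p c a = ys ! i" by (metis in_set_conv_nth)
  have "Suc i mod length ys < length ys" using i by (intro mod_less_divisor) linarith
  then have "ys ! (Suc i mod length ys) \<in> p c ` nbrs E c"
    using nth_mem ys(1) circle_gluings_gluing[of E p c] by auto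
  then show thesis using arc_end_nth[where len = len, OF ok ys i(1)] that i by auto
qed

lemma arc_type_gluing:
  assumes "tree C E" "positions E p"
  shows "arc_type len (gluing E p) =
    {(c, a, b). a \<in> nbrs E c \<and> b \<in> nbrs E c \<and> arc_end len (gluing E p) (c, p c a) = (c, p c b)}"
proof -
  let ?V = "gluing E p"
  have "(c, a, b) \<in> arc_type len ?V \<longleftrightarrow>
    a \<in> nbrs E c \<and> b \<in> nbrs E c \<and> arc_end len ?V (c, p c a) = (c, p c b)" for c a b
  proof
    assume "(c, a, b) \<in> arc_type len ?V"
    then obtain v w x where v: "v \<in> ?V" "w \<in> ?V" "(c, x) \<in> v" "arc_end len ?V (c, x) \<in> w"
      "a \<in> fst ` v - {c}" "b \<in> fst ` w - {c}" unfolding arc_type_def by blast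
    obtain a0 where a0: "a0 \<in> nbrs E c" "x = p c a0" "v = {(c, p c a0), (a0, p a0 c)}"
      using gluing_point[OF v(1,3)] .
    obtain b0 where b0: "b0 \<in> nbrs E c" "arc_end len ?V (c, p c a0) = (c, p c b0)"
      using arc_end_in_gluing[OF assms a0(1)] .
    have w: "w = {(c, p c b0), (b0, p b0 c)}"
      using gluing_point_unique[OF assms(2) v(2) _ b0(1)] v(4) a0(2) b0(2) by simp
    have "a = a0" using v(5) a0(3) by auto
    moreover have "b = b0" using v(6) w by auto
    ultimately show "a \<in> nbrs E c \<and> b \<in> nbrs E c \<and> arc_end len ?V (c, p c a) = (c, p c b)"
      using a0 b0 by simp
  next
    assume *: "a \<in> nbrs E c \<and> b \<in> nbrs E c \<and> arc_end len ?V (c, p c a) = (c, p c b)"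
    then have "a \<noteq> c" "b \<noteq> c" using nbrs_in_C[OF assms(1)] by blast+
    moreover have "{(c, p c a), (a, p a c)} \<in> ?V" "{(c, p c b), (b, p b c)} \<in> ?V"
      using * gluing_vertex by blast+
    ultimately show "(c, a, b) \<in> arc_type len ?V"
      unfolding arc_type_def mem_Collect_eq prod.case
      by (intro bexI[of _ "{(c, p c a), (a, p a c)}"] bexI[of _ "{(c, p c b), (b, p b c)}"]
          exI[of _ "p c a"]) (use * in auto)
  qed
  then show ?thesis by auto
qed

lemma arc_type_rotate:
  assumes "tree C E" "positions E p"
  shows "arc_type len (gluing E (rotate_positions t p)) = arc_type len (gluing E p)"
proof -
  let ?q = "rotate_positions t p"
  note q = positions_rotate[OF assms, of t]
  have "arc_end len (gluing E ?q) (c, ?q c a) = (c, ?q c b) \<longleftrightarrow>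
        arc_end len (gluing E p) (c, p c a) = (c, p c b)" if ab: "a \<in> nbrs E c" "b \<in> nbrs E c" for a b c
  proof -
    define g where "g = gluing_arc E p c a"
    have "(?q c a + g) rmod len c = ((p c a + g) rmod len c + t c) rmod len c"
      unfolding rotate_positions_def rmod_add_rmod by (simp add: ac_simps)
    moreover have "0 < len c" using ab nbrs_in_C[OF assms(1)] len_pos by blast
    then have "((p c a + g) rmod len c + t c) rmod len c = (p c b + t c) rmod len c \<longleftrightarrow>
        (p c a + g) rmod len c = p c b"
      using assms(2) ab rmod_add_cancel[of "(p c a + g) rmod len c" "len c" "p c b" "t c"]
      by (auto simp: rmod_nonneg rmod_less positions_def)
    ultimately show ?thesis
      using gluing_arc_rotate[OF assms(2) ab(1), of t]
      by (simp add: arc_end_def gluing_arc_def g_def rotate_positions_def)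
  qed
  then show ?thesis unfolding arc_type_gluing[OF assms] arc_type_gluing[OF assms(1) q] by blast
qed

lemma gluing_position_gluing:
  assumes "tree C E" "positions E p" "a \<in> nbrs E c"
  shows "gluing_position (gluing E p) c a = p c a"
  unfolding gluing_position_def
proof (rule the_equality)
  show "\<exists>v\<in>gluing E p. (c, p c a) \<in> v \<and> a \<in> fst ` v"
    using gluing_vertex[OF assms(3), of p] by (rule bexI[rotated]) simp
  fix x assume "\<exists>v\<in>gluing E p. (c, x) \<in> v \<and> a \<in> fst ` v"
  then obtain v where v: "v \<in> gluing E p" "(c, x) \<in> v" "a \<in> fst ` v" by blast
  obtain b where b: "b \<in> nbrs E c" "x = p c b" "v = {(c, p c b), (b, p b c)}" using gluing_point[OF v(1,2)] .
  have "a \<noteq> c" using nbrs_in_C[OF assms(1,3)] by simp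
  then have "a = b" using v(3) b(3) by auto
  then show "x = p c a" using b by simp
qed

text \<open>Spelled with the same choice operator as \<open>omitted_arc\<close>, so that the omitted
  arc of a type is literally \<open>base E c\<close>. It depends on the tree alone and is shared by
  all cyclic orders on it, hence so is the set of coordinates.\<close>

definition base :: "'c set set \<Rightarrow> 'c \<Rightarrow> 'c" where
  "base E c = (SOME a. a \<in> nbrs E c)"

definition coords :: "'c set set \<Rightarrow> ('c \<times> 'c) set" where
  "coords E = (SIGMA c:C. nbrs E c - {base E c})"

definition cyclic_pairs :: "'a list \<Rightarrow> ('a \<times> 'a) set" where
  "cyclic_pairs xs = {(xs ! i, xs ! (Suc i mod length xs)) | i. i < length xs}"

text \<open>A cyclic order of the neighbours, cut open at \<open>base E c\<close> to become a
  list.\<close>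

abbreviation circle_orders :: "'c set set \<Rightarrow> 'c \<Rightarrow> 'c list set" where
  "circle_orders E c \<equiv> {xs. distinct xs \<and> set xs = nbrs E c \<and> hd xs = base E c}"

definition orders :: "'c set set \<Rightarrow> ('c \<Rightarrow> 'c list) set" where
  "orders E = (\<Pi>\<^sub>E c\<in>C. circle_orders E c)"

definition order_type :: "('c \<Rightarrow> 'c list) \<Rightarrow> ('c \<times> 'c \<times> 'c) set" where
  "order_type L = {(c, a, b). c \<in> C \<and> (a, b) \<in> cyclic_pairs (L c)}"

lemma base_in_nbrs: "tree C E \<Longrightarrow> c \<in> C \<Longrightarrow> base E c \<in> nbrs E c"
  unfolding base_def using nbrs_nonempty[of E c] by (simp add: some_in_eq)

lemma ordersD:
  assumes "L \<in> orders E" "c \<in> C"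
  shows "distinct (L c)" "set (L c) = nbrs E c" "hd (L c) = base E c"
  using assms by (auto simp: orders_def PiE_iff)

lemma ex_cyclic_pair: "(\<exists>b. (a, b) \<in> cyclic_pairs xs) \<longleftrightarrow> a \<in> set xs"
  by (auto simp: cyclic_pairs_def in_set_conv_nth)

lemma order_type_ex:
  assumes "tree C E" "L \<in> orders E"
  shows "(\<exists>b. (c, a, b) \<in> order_type L) \<longleftrightarrow> a \<in> nbrs E c"
proof -
  have "(\<exists>b. (c, a, b) \<in> order_type L) \<longleftrightarrow> c \<in> C \<and> a \<in> set (L c)"
    by (simp add: order_type_def ex_cyclic_pair)
  then show ?thesis using ordersD(2)[OF assms(2)] nbrs_in_C[OF assms(1)] by auto
qed

lemma omitted_arc_order_type:
  "tree C E \<Longrightarrow> L \<in> orders E \<Longrightarrow> omitted_arc (order_type L) c = base E c"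
  by (simp add: omitted_arc_def base_def order_type_ex)

lemma coord_arcs_order_type:
  "tree C E \<Longrightarrow> L \<in> orders E \<Longrightarrow> coord_arcs (order_type L) = coords E"
  using nbrs_in_C[of E] by (auto simp: coord_arcs_def coords_def omitted_arc_order_type order_type_ex)

text \<open>Starting from the common head, the successor relation reproduces the list entry by
  entry.\<close>

lemma cyclic_pairs_inject:
  assumes "distinct xs" "distinct ys" "hd xs = hd ys" "cyclic_pairs xs = cyclic_pairs ys"
  shows "xs = ys"
proof (rule nth_equalityI)
  have "set xs = set ys" using assms(4) by (metis ex_cyclic_pair subsetI subset_antisym)
  then show len: "length xs = length ys" using assms(1,2) by (metis distinct_card)
  fix i assume "i < length xs"
  then show "xs ! i = ys ! i"
  proof (induction i)
    case 0
    then have "xs \<noteq> []" "ys \<noteq> []" using len by auto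
    then show ?case using assms(3) by (simp add: hd_conv_nth)
  next
    case (Suc i)
    then have "(xs ! i, xs ! Suc i) \<in> cyclic_pairs xs"
      unfolding cyclic_pairs_def by (intro CollectI exI[of _ i]) simp
    then obtain j where j: "j < length ys" "xs ! i = ys ! j" "xs ! Suc i = ys ! (Suc j mod length ys)"
      unfolding assms(4) by (auto simp: cyclic_pairs_def)
    then have "j = i" using Suc assms(2) len by (simp add: nth_eq_iff_index_eq)
    then show ?case using j Suc.prems len by simp
  qed
qed

text \<open>The arcs named in a type give the neighbourhoods and hence the tree; the successors then
  give the cyclic order on each circle. Different pairs of a tree and an order therefore contribute
  different charts.\<close>

lemma order_type_inject:
  assumes "tree C E" "tree C E'" "L \<in> orders E" "L' \<in> orders E'" "order_type L = order_type L'"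
  shows "E = E' \<and> L = L'"
proof -
  have nb: "nbrs E c = nbrs E' c" for c
    using order_type_ex[OF assms(1,3)] order_type_ex[OF assms(2,4)] unfolding assms(5) by blast
  have E_iff: "e \<in> F \<longleftrightarrow> (\<exists>c a. e = {c, a} \<and> a \<in> nbrs F c)" if "tree C F" for e F
    using tree_edgeE[OF that] by (auto simp: nbrs_def) metis
  have EE: "E = E'" using E_iff[OF assms(1)] E_iff[OF assms(2)] nb by (metis subsetI subset_antisym)
  have "L c = L' c" if "c \<in> C" for c
  proof (rule cyclic_pairs_inject)
    show "cyclic_pairs (L c) = cyclic_pairs (L' c)"
      using assms(5) that by (auto simp: order_type_def set_eq_iff)
  qed (use ordersD[OF assms(3) that] ordersD[OF assms(4) that] EE in auto)
  then have "L = L'" using assms(3,4) unfolding orders_def by (intro PiE_ext) (auto simp: EE)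
  with EE show ?thesis by simp
qed

section \<open>Charts and normal forms of generic cacti\<close>

definition chart_domain :: "'c set set \<Rightarrow> ('c \<times> 'c \<Rightarrow> real) set" where
  "chart_domain E = {x \<in> coords E \<rightarrow>\<^sub>E UNIV. (\<forall>q\<in>coords E. 0 < x q) \<and>
     (\<forall>c\<in>C. (\<Sum>a\<in>nbrs E c - {base E c}. x (c, a)) < len c)}"

definition arc_weight :: "'c set set \<Rightarrow> ('c \<times> 'c \<Rightarrow> real) \<Rightarrow> 'c \<Rightarrow> 'c \<Rightarrow> real" where
  "arc_weight E x c a = (if a = base E c then len c - (\<Sum>b\<in>nbrs E c - {base E c}. x (c, b)) else x (c, a))"

definition index_of :: "'a list \<Rightarrow> 'a \<Rightarrow> nat" where
  "index_of xs a = (THE i. i < length xs \<and> xs ! i = a)"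

lemma index_of_nth: "distinct xs \<Longrightarrow> i < length xs \<Longrightarrow> index_of xs (xs ! i) = i"
  unfolding index_of_def by (rule the_equality) (auto simp: nth_eq_iff_index_eq)

text \<open>The representative of a rotation class in which the gluing point with
  \<open>base E c\<close>, the head of \<open>L c\<close>, sits at 0 on every circle. The omitted
  arc is the one that starts there.\<close>

definition normal_positions ::
  "'c set set \<Rightarrow> ('c \<Rightarrow> 'c list) \<Rightarrow> ('c \<times> 'c \<Rightarrow> real) \<Rightarrow> 'c \<Rightarrow> 'c \<Rightarrow> real" where
  "normal_positions E L x c a = (\<Sum>j<index_of (L c) a. arc_weight E x c (L c ! j))"

abbreviation "normal E L x \<equiv> gluing E (normal_positions E L x)"

lemma gluing_sorted:
  assumes "tree C E" "positions E p" and xs: "set xs = nbrs E c" "sorted_wrt (<) (map (p c) xs)"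
    and i: "i < length xs"
  shows "gluing_arc E p c (xs ! i) =
      (if Suc i < length xs then p c (xs ! Suc i) - p c (xs ! i) else p c (xs ! 0) + len c - p c (xs ! i))"
    and "arc_end len (gluing E p) (c, p c (xs ! i)) = (c, p c (xs ! (Suc i mod length xs)))"
proof -
  note ok = gluing_circle_gluings_ok[OF assms(1,2), of c]
  have s: "set (map (p c) xs) = circle_gluings (gluing E p) c" by (simp add: circle_gluings_gluing xs(1))
  have i': "i < length (map (p c) xs)" using i by simp
  have 0: "0 < length xs" "Suc i mod length xs < length xs" using i by (linarith, intro mod_less_divisor, linarith)
  show "gluing_arc E p c (xs ! i) =
      (if Suc i < length xs then p c (xs ! Suc i) - p c (xs ! i) else p c (xs ! 0) + len c - p c (xs ! i))"
    using arc_length_nth[where len = len, OF ok s xs(2) i'] i 0 by (simp add: gluing_arc_def split: if_splits)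
  show "arc_end len (gluing E p) (c, p c (xs ! i)) = (c, p c (xs ! (Suc i mod length xs)))"
    using arc_end_nth[where len = len, OF ok s xs(2) i'] i 0 by simp
qed

lemma arc_type_sorted:
  assumes t: "tree C E" and p: "positions E p"
    and L: "\<And>c. c \<in> C \<Longrightarrow> set (L c) = nbrs E c" "\<And>c. c \<in> C \<Longrightarrow> sorted_wrt (<) (map (p c) (L c))"
  shows "arc_type len (gluing E p) = order_type L"
proof -
  have "(a \<in> nbrs E c \<and> b \<in> nbrs E c \<and> arc_end len (gluing E p) (c, p c a) = (c, p c b)) \<longleftrightarrow>
      c \<in> C \<and> (a, b) \<in> cyclic_pairs (L c)" for c a b
  proof (cases "c \<in> C")
    case True
    note L' = L[OF True]
    have inj: "inj_on (p c) (nbrs E c)" using p by (simp add: positions_def)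
    have lt: "Suc i mod length (L c) < length (L c)" if "i < length (L c)" for i
      using that by (intro mod_less_divisor) linarith
    show ?thesis
    proof
      assume *: "a \<in> nbrs E c \<and> b \<in> nbrs E c \<and> arc_end len (gluing E p) (c, p c a) = (c, p c b)"
      then obtain i where i: "i < length (L c)" "a = L c ! i" using L'(1) by (metis in_set_conv_nth)
      have "p c b = p c (L c ! (Suc i mod length (L c)))" using * gluing_sorted(2)[OF t p L' i(1)] i by simp
      moreover have "L c ! (Suc i mod length (L c)) \<in> nbrs E c" using L'(1) lt[OF i(1)] nth_mem by blast
      ultimately have "b = L c ! (Suc i mod length (L c))" using * inj by (auto dest: inj_onD)
      then show "c \<in> C \<and> (a, b) \<in> cyclic_pairs (L c)" using i True unfolding cyclic_pairs_def by blast
    next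
      assume "c \<in> C \<and> (a, b) \<in> cyclic_pairs (L c)"
      then obtain i where i: "i < length (L c)" "a = L c ! i" "b = L c ! (Suc i mod length (L c))"
        unfolding cyclic_pairs_def by blast
      then show "a \<in> nbrs E c \<and> b \<in> nbrs E c \<and> arc_end len (gluing E p) (c, p c a) = (c, p c b)"
        using gluing_sorted(2)[OF t p L' i(1)] L'(1) lt[OF i(1)] nth_mem by metis
    qed
  next
    case False
    then show ?thesis using nbrs_in_C[OF t] by blast
  qed
  then show ?thesis unfolding arc_type_gluing[OF t p] order_type_def by auto
qed

lemma arc_coords_gluing:
  assumes "tree C E" "positions E p" "arc_type len (gluing E p) = order_type L" "L \<in> orders E"
  shows "arc_coords len (gluing E p) = (\<lambda>(c, a)\<in>coords E. gluing_arc E p c a)"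
  unfolding arc_coords_def assms(3) coord_arcs_order_type[OF assms(1,4)]
  by (rule restrict_ext) (auto simp: coords_def gluing_arc_def gluing_position_gluing[OF assms(1,2)])

lemma sum_arc_weight:
  assumes "tree C E" "c \<in> C"
  shows "(\<Sum>a\<in>nbrs E c. arc_weight E x c a) = len c"
proof -
  have "(\<Sum>a\<in>nbrs E c. arc_weight E x c a) = arc_weight E x c (base E c) +
      (\<Sum>a\<in>nbrs E c - {base E c}. arc_weight E x c a)"
    using base_in_nbrs[OF assms] finite_nbrs[OF assms(1)] by (intro sum.remove) auto
  also have "(\<Sum>a\<in>nbrs E c - {base E c}. arc_weight E x c a) = (\<Sum>a\<in>nbrs E c - {base E c}. x (c, a))"
    by (intro sum.cong) (auto simp: arc_weight_def)
  finally show ?thesis by (simp add: arc_weight_def)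
qed

lemma arc_weight_pos:
  assumes "x \<in> chart_domain E" "c \<in> C" "a \<in> nbrs E c"
  shows "0 < arc_weight E x c a"
  using assms by (auto simp: chart_domain_def arc_weight_def coords_def)

lemma sum_list_order:
  assumes "tree C E" "L \<in> orders E" "c \<in> C"
  shows "(\<Sum>j<length (L c). f (L c ! j)) = (\<Sum>a\<in>nbrs E c. f a)"
proof -
  have "bij_betw (\<lambda>j. L c ! j) {..<length (L c)} (nbrs E c)"
    using ordersD[OF assms(2,3)] bij_betw_nth[of "L c" "{..<length (L c)}" "nbrs E c"] by simp
  then show ?thesis by (rule sum.reindex_bij_betw)
qed

lemma normal_positions_nth:
  assumes "L \<in> orders E" "c \<in> C" "i < length (L c)"
  shows "normal_positions E L x c (L c ! i) = (\<Sum>j<i. arc_weight E x c (L c ! j))"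
  unfolding normal_positions_def using index_of_nth[OF ordersD(1)[OF assms(1,2)] assms(3)] by simp

text \<open>The positions are partial sums of positive weights with total \<open>len c\<close>, so
  they increase strictly along \<open>L c\<close> and stay below \<open>len c\<close>.\<close>

lemma
  assumes E: "tree C E" and L: "L \<in> orders E" and x: "x \<in> chart_domain E"
  shows positions_normal: "positions E (normal_positions E L x)"
    and normal_sorted: "c \<in> C \<Longrightarrow> sorted_wrt (<) (map (normal_positions E L x c) (L c))"
proof -
  let ?p = "normal_positions E L x"
  have pos: "0 < arc_weight E x c (L c ! j)" if "c \<in> C" "j < length (L c)" for c j
    using arc_weight_pos[OF x that(1)] ordersD(2)[OF L that(1)] nth_mem[OF that(2)] by blast
  have less: "?p c (L c ! i) < ?p c (L c ! j)" if "c \<in> C" "i < j" "j < length (L c)" for c i j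
  proof -
    have "(\<Sum>k<i. arc_weight E x c (L c ! k)) < (\<Sum>k<j. arc_weight E x c (L c ! k))"
      using that pos by (intro sum_strict_mono2[of _ _ i]) (auto intro: less_imp_le)
    then show ?thesis using that normal_positions_nth[OF L that(1)] by simp
  qed
  show sorted: "sorted_wrt (<) (map (?p c) (L c))" if "c \<in> C" for c
    using less[OF that] by (auto simp: sorted_wrt_iff_nth_less)
  show "positions E ?p"
    unfolding positions_def
  proof (intro allI)
    fix c
    show "inj_on (?p c) (nbrs E c) \<and> (\<forall>a\<in>nbrs E c. 0 \<le> ?p c a \<and> ?p c a < len c)"
    proof (cases "c \<in> C")
      case True
      have "distinct (map (?p c) (L c))" using sorted[OF True] by (simp add: strict_sorted_iff)
      then have "inj_on (?p c) (nbrs E c)" using ordersD(2)[OF L True] by (simp add: distinct_map)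
      moreover have "0 \<le> ?p c a \<and> ?p c a < len c" if a: "a \<in> nbrs E c" for a
      proof -
        obtain i where i: "i < length (L c)" "a = L c ! i"
          using a ordersD(2)[OF L True] by (metis in_set_conv_nth)
        have "0 \<le> (\<Sum>k<i. arc_weight E x c (L c ! k))"
          using i pos[OF True] by (intro sum_nonneg) (auto intro: less_imp_le)
        moreover have "(\<Sum>k<i. arc_weight E x c (L c ! k)) < (\<Sum>k<length (L c). arc_weight E x c (L c ! k))"
          using i pos[OF True] by (intro sum_strict_mono2[of _ _ i]) (auto intro: less_imp_le)
        ultimately show ?thesis
          using sum_list_order[OF E L True, of "arc_weight E x c"] sum_arc_weight[OF E True, of x] i
          by (simp add: normal_positions_nth[OF L True])
      qed
      ultimately show ?thesis by blast
    next
      case False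
      then show ?thesis using tree_nbrs_outside[OF E] by simp
    qed
  qed
qed

lemma gluing_arc_normal:
  assumes E: "tree C E" and L: "L \<in> orders E" and x: "x \<in> chart_domain E" and c: "c \<in> C" and a: "a \<in> nbrs E c"
  shows "gluing_arc E (normal_positions E L x) c a = arc_weight E x c a"
proof -
  let ?p = "normal_positions E L x"
  obtain i where i: "i < length (L c)" "a = L c ! i"
    using a ordersD(2)[OF L c] by (metis in_set_conv_nth)
  have n0: "0 < length (L c)" using i by linarith
  note g = gluing_sorted(1)[OF E positions_normal[OF E L x] ordersD(2)[OF L c] normal_sorted[OF E L x c] i(1)]
  show ?thesis
  proof (cases "Suc i < length (L c)")
    case True
    then show ?thesis using g i by (simp add: normal_positions_nth[OF L c])
  next
    case False
    then have "length (L c) = Suc i" using i by simp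
    then have "len c = (\<Sum>k<i. arc_weight E x c (L c ! k)) + arc_weight E x c (L c ! i)"
      using sum_list_order[OF E L c, of "arc_weight E x c"] sum_arc_weight[OF E c, of x] by simp
    then show ?thesis using g False i n0 normal_positions_nth[OF L c n0] normal_positions_nth[OF L c i(1)] by simp
  qed
qed

text \<open>Every point of the chart domain is realised, for every choice of the cyclic orders.
  Together with \<open>generic_cactus_normal_form\<close> this identifies the image of each
  chart.\<close>

lemma
  assumes E: "E \<in> trees" and L: "L \<in> orders E" and x: "x \<in> chart_domain E"
  shows normal_generic: "normal E L x \<in> generic"
    and normal_type: "arc_type len (normal E L x) = order_type L"
    and normal_coords: "arc_coords len (normal E L x) = x"
proof -
  let ?p = "normal_positions E L x"
  have t: "tree C E" using E by (simp add: colored_trees_def)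
  note p = positions_normal[OF t L x]
  show "gluing E ?p \<in> generic" by (rule gluing_generic_cactus[OF E p])
  show type: "arc_type len (gluing E ?p) = order_type L"
    using arc_type_sorted[OF t p] ordersD(2)[OF L] normal_sorted[OF t L x] by blast
  have "(\<lambda>(c, a)\<in>coords E. gluing_arc E ?p c a) = (\<lambda>(c, a)\<in>coords E. x (c, a))"
  proof (rule restrict_ext)
    fix r assume "r \<in> coords E"
    then obtain c a where "r = (c, a)" "c \<in> C" "a \<in> nbrs E c" "a \<noteq> base E c" by (auto simp: coords_def)
    then show "(case r of (c, a) \<Rightarrow> gluing_arc E ?p c a) = (case r of (c, a) \<Rightarrow> x (c, a))"
      by (simp add: gluing_arc_normal[OF t L x] arc_weight_def)
  qed
  also have "\<dots> = x" using x by (auto simp: chart_domain_def)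
  finally show "arc_coords len (gluing E ?p) = x" using arc_coords_gluing[OF t p type L] by simp
qed

text \<open>Rotating each circle so that its gluing point with \<open>base E c\<close> moves to 0
  changes neither type nor arc lengths. The order of the positions then gives \<open>L\<close>, and
  the positions are recovered as partial sums of arc lengths.\<close>

lemma generic_cactus_normal_form:
  assumes "V \<in> generic"
  obtains E L x t where "E \<in> trees" "L \<in> orders E" "x \<in> chart_domain E"
    "arc_type len V = order_type L" "arc_coords len V = x"
    "rot t V = normal E L x"
proof -
  obtain E p where E: "E \<in> trees" and p: "positions E p" and V: "V = gluing E p"
    using generic_cactusE[OF assms] .
  have t: "tree C E" using E by (simp add: colored_trees_def)
  define s where "s c = - p c (base E c)" for c
  define q where "q = rotate_positions s p"
  have q: "positions E q" unfolding q_def by (rule positions_rotate[OF t p])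
  have q0: "q c (base E c) = 0" for c by (simp add: q_def rotate_positions_def s_def)
  have "\<exists>xs. distinct xs \<and> set xs = nbrs E c \<and> sorted_wrt (<) (map (q c) xs)" for c
  proof -
    obtain ys where ys: "set ys = nbrs E c" "distinct ys" using finite_distinct_list[OF finite_nbrs[OF t]] by blast
    let ?xs = "sort_key (q c) ys"
    have "distinct (map (q c) ?xs)" using ys q by (simp add: distinct_map positions_def)
    then have "sorted_wrt (<) (map (q c) ?xs)" by (simp add: strict_sorted_iff)
    then show ?thesis using ys by (intro exI[of _ ?xs]) simp
  qed
  then obtain L0 where L0: "\<And>c. distinct (L0 c)" "\<And>c. set (L0 c) = nbrs E c" "\<And>c. sorted_wrt (<) (map (q c) (L0 c))"
    by metis
  \<comment> \<open>Positions are nonnegative and that of \<open>base E c\<close> is 0, so it comes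
    first in the sorted list.\<close>
  have hd0: "L0 c ! 0 = base E c" "0 < length (L0 c)" if c: "c \<in> C" for c
  proof -
    obtain i where i: "i < length (L0 c)" "base E c = L0 c ! i"
      using base_in_nbrs[OF t c] L0(2)[of c] by (metis in_set_conv_nth)
    show n0: "0 < length (L0 c)" using i by linarith
    have "L0 c ! 0 \<in> nbrs E c" using n0 L0(2)[of c] nth_mem by blast
    then have "0 \<le> q c (L0 c ! 0)" using q by (simp add: positions_def)
    moreover have "q c (L0 c ! 0) < q c (L0 c ! i)" if "0 < i"
      using sorted_wrt_nth_less[OF L0(3)[of c], of 0 i] i that n0 by simp
    ultimately have "i = 0" using q0[of c] i by (cases "i = 0") auto
    then show "L0 c ! 0 = base E c" using i by simp
  qed
  define L where "L = restrict L0 C"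
  have LC: "L c = L0 c" if "c \<in> C" for c using that by (simp add: L_def)
  have L: "L \<in> orders E"
    unfolding orders_def
  proof (rule PiE_I)
    fix c assume c: "c \<in> C"
    then show "L c \<in> circle_orders E c"
      using L0 hd0[OF c] by (simp add: LC hd_conv_nth)
  qed (simp add: L_def)
  have typeq: "arc_type len (gluing E q) = order_type L"
    using arc_type_sorted[OF t q, of L] L0 LC by simp
  have type: "arc_type len V = order_type L"
    using typeq arc_type_rotate[OF t p, of s] by (simp add: V q_def)
  define x where "x = arc_coords len V"
  have x_eq: "x = (\<lambda>(c, a)\<in>coords E. gluing_arc E q c a)"
  proof -
    have "x = (\<lambda>(c, a)\<in>coords E. gluing_arc E p c a)"
      unfolding x_def V using arc_coords_gluing[OF t p _ L] type by (simp add: V)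
    also have "\<dots> = (\<lambda>(c, a)\<in>coords E. gluing_arc E q c a)"
      unfolding q_def by (rule restrict_ext) (auto simp: coords_def gluing_arc_rotate[OF p])
    finally show ?thesis .
  qed
  have arc: "gluing_arc E q c (L c ! i) =
      (if Suc i < length (L c) then q c (L c ! Suc i) - q c (L c ! i) else len c - q c (L c ! i))"
    if "c \<in> C" "i < length (L c)" for c i
    using gluing_sorted(1)[OF t q L0(2) L0(3), of i c] that hd0[OF that(1)] q0[of c] by (simp add: LC)
  have pos_sum: "q c (L c ! i) = (\<Sum>j<i. gluing_arc E q c (L c ! j))" if c: "c \<in> C" and "i < length (L c)" for c i
    using that(2)
  proof (induction i)
    case 0
    then show ?case using hd0[OF c] q0 c by (simp add: LC)
  next
    case (Suc i)
    then show ?case using arc[OF c, of i] by simp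
  qed
  \<comment> \<open>The arcs of a circle add up to its length, so the arc that is not a coordinate
    is recovered as well and \<open>arc_weight\<close> is correct for all arcs.\<close>
  have total: "(\<Sum>a\<in>nbrs E c. gluing_arc E q c a) = len c" if c: "c \<in> C" for c
  proof -
    obtain n where n: "length (L c) = Suc n" using hd0[OF c] c by (metis LC Suc_pred)
    have "(\<Sum>a\<in>nbrs E c. gluing_arc E q c a) = (\<Sum>j<Suc n. gluing_arc E q c (L c ! j))"
      using sum_list_order[OF t L c, of "gluing_arc E q c"] n by simp
    then show ?thesis using pos_sum[OF c, of n] arc[OF c, of n] n by simp
  qed
  have weight: "arc_weight E x c a = gluing_arc E q c a" if c: "c \<in> C" and a: "a \<in> nbrs E c" for c a
  proof -
    have eq: "x (c, b) = gluing_arc E q c b" if "b \<in> nbrs E c - {base E c}" for b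
      using that c by (simp add: x_eq coords_def)
    have "(\<Sum>b\<in>nbrs E c. gluing_arc E q c b) = gluing_arc E q c (base E c) +
        (\<Sum>b\<in>nbrs E c - {base E c}. gluing_arc E q c b)"
      using base_in_nbrs[OF t c] finite_nbrs[OF t] by (intro sum.remove) auto
    also have "(\<Sum>b\<in>nbrs E c - {base E c}. gluing_arc E q c b) = (\<Sum>b\<in>nbrs E c - {base E c}. x (c, b))"
      by (intro sum.cong) (auto simp: eq)
    finally show ?thesis using total[OF c] eq[of a] a by (auto simp: arc_weight_def)
  qed
  have arc_pos: "0 < gluing_arc E q c a" if c: "c \<in> C" and a: "a \<in> nbrs E c" for c a
  proof -
    obtain i where i: "i < length (L c)" "a = L c ! i"
      using a ordersD(2)[OF L c] by (metis in_set_conv_nth)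
    show ?thesis
    proof (cases "Suc i < length (L c)")
      case True
      then have "q c (L c ! i) < q c (L c ! Suc i)"
        using sorted_wrt_nth_less[OF L0(3)[of c], of i "Suc i"] c by (simp add: LC)
      then show ?thesis using arc[OF c i(1)] True i by simp
    next
      case False
      have "q c a < len c" using q a by (simp add: positions_def)
      then show ?thesis using arc[OF c i(1)] False i by simp
    qed
  qed
  have x: "x \<in> chart_domain E"
  proof -
    have "x \<in> coords E \<rightarrow>\<^sub>E UNIV" by (simp add: x_eq)
    moreover have "0 < x r" if "r \<in> coords E" for r
      using that arc_pos by (auto simp: x_eq coords_def)
    moreover have "(\<Sum>a\<in>nbrs E c - {base E c}. x (c, a)) < len c" if c: "c \<in> C" for c
      using weight[OF c base_in_nbrs[OF t c]] arc_pos[OF c base_in_nbrs[OF t c]] by (simp add: arc_weight_def)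
    ultimately show ?thesis by (simp add: chart_domain_def)
  qed
  have "gluing E q = normal E L x"
  proof (rule gluing_cong)
    fix c a assume a: "a \<in> nbrs E c"
    then have c: "c \<in> C" using nbrs_in_C[OF t] by blast
    obtain i where i: "i < length (L c)" "a = L c ! i"
      using a ordersD(2)[OF L c] by (metis in_set_conv_nth)
    have "(\<Sum>j<i. gluing_arc E q c (L c ! j)) = (\<Sum>j<i. arc_weight E x c (L c ! j))"
    proof (rule sum.cong[OF refl])
      fix j assume "j \<in> {..<i}"
      then have "L c ! j \<in> nbrs E c" using ordersD(2)[OF L c] nth_mem[of j "L c"] i by auto
      then show "gluing_arc E q c (L c ! j) = arc_weight E x c (L c ! j)" using weight[OF c] by simp
    qed
    then show "q c a = normal_positions E L x c a"
      using pos_sum[OF c i(1)] normal_positions_nth[OF L c i(1)] i by simp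
  qed
  then have "rot s V = normal E L x"
    by (simp add: V rotate_gluing q_def)
  with E L x type x_def show thesis using that by blast
qed

end


subsection \<open>Lebesgue measure on finite products\<close>

abbreviation Leb :: "'i set \<Rightarrow> ('i \<Rightarrow> real) measure" where
  "Leb I \<equiv> PiM I (\<lambda>_. lborel)"

interpretation lborel_prod: product_sigma_finite "\<lambda>_. lborel :: real measure"
  by standard

text \<open>By Fubini in the coordinate \<open>i\<close>: as \<open>a i \<noteq> 0\<close>, each
  line in this direction meets the set in at most one point.\<close>

lemma null_sets_hyperplane:
  fixes a :: "'i \<Rightarrow> real"
  assumes I: "finite I" "i \<in> I" and a: "a i \<noteq> 0"
  shows "{x \<in> space (Leb I). (\<Sum>j\<in>I. a j * x j) = b} \<in> null_sets (Leb I)"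
    (is "?S \<in> _")
proof -
  define J where "J = I - {i}"
  have J: "finite J" "i \<notin> J" "I = insert i J" using I by (auto simp: J_def)
  have meas: "?S \<in> sets (Leb I)" by measurable
  have "emeasure (Leb I) ?S = (\<integral>\<^sup>+x. indicator ?S x \<partial>Leb I)"
    using meas by simp
  also have "\<dots> = (\<integral>\<^sup>+x. \<integral>\<^sup>+y. indicator ?S (x(i := y)) \<partial>lborel \<partial>Leb J)"
    using meas unfolding J(3) by (intro lborel_prod.product_nn_integral_insert J) simp
  also have "\<dots> = (\<integral>\<^sup>+x. 0 \<partial>Leb J)"
  proof (rule nn_integral_cong)
    fix x :: "'i \<Rightarrow> real"
    define y0 where "y0 = (b - (\<Sum>j\<in>J. a j * x j)) / a i"
    have "y = y0" if "x(i := y) \<in> ?S" for y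
    proof -
      have "(\<Sum>j\<in>I. a j * (x(i := y)) j) = a i * y + (\<Sum>j\<in>J. a j * (x(i := y)) j)"
        unfolding J(3) using J by simp
      also have "(\<Sum>j\<in>J. a j * (x(i := y)) j) = (\<Sum>j\<in>J. a j * x j)"
        using J by (intro sum.cong) auto
      finally show ?thesis using that a by (simp add: y0_def field_simps)
    qed
    then have "(\<integral>\<^sup>+y. indicator ?S (x(i := y)) \<partial>lborel) \<le> (\<integral>\<^sup>+y. indicator {y0} y \<partial>lborel)"
      by (intro nn_integral_mono) (auto simp: indicator_def)
    then show "(\<integral>\<^sup>+y. indicator ?S (x(i := y)) \<partial>lborel) = (0::ennreal)" by simp
  qed
  finally show ?thesis using meas by (intro null_setsI) auto
qed

definition open_simplex :: "'i set \<Rightarrow> real \<Rightarrow> ('i \<Rightarrow> real) set" where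
  "open_simplex I t = {x \<in> I \<rightarrow>\<^sub>E UNIV. (\<forall>i\<in>I. 0 < x i) \<and> sum x I < t}"

lemma sets_open_simplex [measurable]:
  assumes "finite I"
  shows "open_simplex I t \<in> sets (Leb I)"
proof -
  have "open_simplex I t = {x \<in> space (Leb I). (\<forall>i\<in>I. 0 < x i) \<and> sum x I < t}"
    by (simp add: open_simplex_def space_PiM)
  also have "\<dots> \<in> sets (Leb I)" using assms by measurable
  finally show ?thesis .
qed

text \<open>\<open>emeasure_std_simplex_aux\<close> yields the volume of the closed simplex; the
  faces that distinguish it from the open one lie in hyperplanes and are null.\<close>

lemma emeasure_open_simplex:
  assumes "finite I" "0 < t"
  shows "emeasure (Leb I) (open_simplex I t) = ennreal (t ^ card I / fact (card I))"
proof -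
  let ?M = "Leb I"
  define B where "B = {x. (\<forall>i\<in>I. 0 \<le> x i) \<and> sum x I \<le> t} \<inter> space ?M"
  \<comment> \<open>The coordinate faces and the slanted face. For \<open>I = {}\<close> the
    equation of the latter would be \<open>0 = t\<close>, which is no hyperplane and has no
    solution.\<close>
  define N where "N = (\<Union>i\<in>I. {x \<in> space ?M. (\<Sum>j\<in>I. (if j = i then 1 else 0) * x j) = 0}) \<union>
     (if I = {} then {} else {x \<in> space ?M. (\<Sum>j\<in>I. 1 * x j) = t})"
  have "B = {x \<in> space ?M. (\<forall>i\<in>I. 0 \<le> x i) \<and> sum x I \<le> t}" by (auto simp: B_def)
  also have "\<dots> \<in> sets ?M" using assms by measurable
  finally have B: "B \<in> sets ?M" .
  have "{x \<in> space ?M. (\<Sum>j\<in>I. 1 * x j) = t} \<in> null_sets ?M" if "I \<noteq> {}"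
  proof -
    from that obtain i where "i \<in> I" by auto
    then show ?thesis using assms by (intro null_sets_hyperplane[of I i]) auto
  qed
  moreover have "(\<Union>i\<in>I. {x \<in> space ?M. (\<Sum>j\<in>I. (if j = i then 1 else 0) * x j) = 0}) \<in> null_sets ?M"
    using assms(1) by (intro null_sets_UN' null_sets_hyperplane countable_finite) auto
  ultimately have N: "N \<in> null_sets ?M" unfolding N_def by auto
  have delta: "(\<Sum>j\<in>I. (if j = i then 1 else 0) * x j) = x i" if "i \<in> I" for i and x :: "'a \<Rightarrow> real"
    using that assms(1) by (simp add: if_distrib[of "\<lambda>u. u * _"] cong: if_cong)
  have "open_simplex I t = B - N"
  proof (cases "I = {}")
    case True
    then show ?thesis using assms(2) by (auto simp: open_simplex_def B_def N_def space_PiM)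
  next
    case False
    then show ?thesis
      by (auto simp: open_simplex_def B_def N_def space_PiM delta less_le)
  qed
  then have "emeasure ?M (open_simplex I t) = emeasure ?M B"
    using emeasure_Diff_null_set[OF N B] by simp
  also have "\<dots> = ennreal (t ^ card I / fact (card I))"
    unfolding B_def using assms by (intro emeasure_std_simplex_aux) auto
  finally show ?thesis .
qed

text \<open>The arc lengths of different circles vary independently: a condition on each of several
  disjoint blocks of coordinates defines, up to the isomorphism \<open>merge\<close>, a product set.
  The induction splits off one block at a time.\<close>

lemma
  fixes I :: "'c \<Rightarrow> 'i set" and A :: "'c \<Rightarrow> ('i \<Rightarrow> real) set"
  assumes "finite K" "disjoint_family_on I K" "\<And>c. c \<in> K \<Longrightarrow> finite (I c)"
    and "\<And>c. c \<in> K \<Longrightarrow> A c \<in> sets (Leb (I c))"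
  shows sets_PiM_blocks: "{x \<in> (\<Union>c\<in>K. I c) \<rightarrow>\<^sub>E UNIV. \<forall>c\<in>K. restrict x (I c) \<in> A c}
      \<in> sets (Leb (\<Union>c\<in>K. I c))"
    and emeasure_PiM_blocks: "emeasure (Leb (\<Union>c\<in>K. I c))
      {x \<in> (\<Union>c\<in>K. I c) \<rightarrow>\<^sub>E UNIV. \<forall>c\<in>K. restrict x (I c) \<in> A c} =
      (\<Prod>c\<in>K. emeasure (Leb (I c)) (A c))"
proof -
  have sets: "{x \<in> (\<Union>c\<in>K. I c) \<rightarrow>\<^sub>E UNIV. \<forall>c\<in>K. restrict x (I c) \<in> A c}
      \<in> sets (Leb (\<Union>c\<in>K. I c))"
    if "finite K" "\<And>c. c \<in> K \<Longrightarrow> A c \<in> sets (Leb (I c))" for K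
  proof -
    let ?M = "Leb (\<Union>c\<in>K. I c)"
    have "{x \<in> space ?M. restrict x (I c) \<in> A c} \<in> sets ?M" if c: "c \<in> K" for c
    proof -
      have "(\<lambda>x. restrict x (I c)) \<in> measurable ?M (Leb (I c))"
        using c by (intro measurable_restrict_subset) auto
      from measurable_sets[OF this \<open>\<And>c. c \<in> K \<Longrightarrow> A c \<in> sets (Leb (I c))\<close>[OF c]]
      show ?thesis by (simp add: vimage_def Int_def conj_commute)
    qed
    then have "{x \<in> space ?M. \<forall>c\<in>K. restrict x (I c) \<in> A c} \<in> sets ?M"
      using \<open>finite K\<close> by (intro sets.sets_Collect_finite_All) auto
    then show ?thesis by (simp add: space_PiM)
  qed
  show "{x \<in> (\<Union>c\<in>K. I c) \<rightarrow>\<^sub>E UNIV. \<forall>c\<in>K. restrict x (I c) \<in> A c}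
      \<in> sets (Leb (\<Union>c\<in>K. I c))"
    using sets assms by blast
  show "emeasure (Leb (\<Union>c\<in>K. I c))
      {x \<in> (\<Union>c\<in>K. I c) \<rightarrow>\<^sub>E UNIV. \<forall>c\<in>K. restrict x (I c) \<in> A c} =
      (\<Prod>c\<in>K. emeasure (Leb (I c)) (A c))"
    using assms
  proof (induction K rule: finite_induct)
    case empty
    then show ?case by (simp add: PiM_empty)
  next
    case (insert d K)
    let ?J = "\<Union>c\<in>K. I c"
    let ?M = "\<lambda>I. Leb I"
    let ?X = "\<lambda>K. {x \<in> (\<Union>c\<in>K. I c) \<rightarrow>\<^sub>E UNIV. \<forall>c\<in>K. restrict x (I c) \<in> A c}"
    have "I d \<inter> I c = {}" if "c \<in> K" for c
      using disjoint_family_onD[OF insert.prems(1), of d c] that insert.hyps(2) by auto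
    then have disj: "I d \<inter> ?J = {}" by auto
    have fin: "finite (I d)" "finite ?J" using insert by auto
    have U: "(\<Union>c\<in>insert d K. I c) = I d \<union> ?J" by auto
    have X: "?X (insert d K) \<in> sets (?M (I d \<union> ?J))"
      using sets[of "insert d K"] insert.hyps(1) insert.prems(3) unfolding U by simp
    have XK: "?X K \<in> sets (?M ?J)" using sets[of K] insert.hyps(1) insert.prems(3) by simp
    have Ad: "A d \<in> sets (?M (I d))" using insert.prems(3) by simp
    interpret P: sigma_finite_measure "?M ?J" using fin(2) by (rule lborel_prod.sigma_finite)
    have "emeasure (?M (I d \<union> ?J)) (?X (insert d K)) =
        emeasure (distr (?M (I d) \<Otimes>\<^sub>M ?M ?J) (?M (I d \<union> ?J)) (merge (I d) ?J)) (?X (insert d K))"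
      using lborel_prod.distr_merge[OF disj fin] by simp
    also have "\<dots> = emeasure (?M (I d) \<Otimes>\<^sub>M ?M ?J)
        (merge (I d) ?J -` ?X (insert d K) \<inter> space (?M (I d) \<Otimes>\<^sub>M ?M ?J))"
      by (rule emeasure_distr[OF measurable_merge X])
    also have "merge (I d) ?J -` ?X (insert d K) \<inter> space (?M (I d) \<Otimes>\<^sub>M ?M ?J) = A d \<times> ?X K"
    proof -
      have Asub: "A d \<subseteq> I d \<rightarrow>\<^sub>E UNIV" using sets.sets_into_space[OF Ad] by (simp add: space_PiM)
      have merge_iff: "merge (I d) ?J (x, y) \<in> ?X (insert d K) \<longleftrightarrow> x \<in> A d \<and> y \<in> ?X K"
        if x: "x \<in> I d \<rightarrow>\<^sub>E UNIV" and y: "y \<in> ?J \<rightarrow>\<^sub>E UNIV" for x y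
      proof -
        have "restrict (merge (I d) ?J (x, y)) (I d) = x"
          using x by (auto simp: merge_def fun_eq_iff PiE_def extensional_def)
        moreover have "restrict (merge (I d) ?J (x, y)) (I c) = restrict y (I c)" if "c \<in> K" for c
        proof
          fix i show "restrict (merge (I d) ?J (x, y)) (I c) i = restrict y (I c) i"
            using that disj by (auto simp: merge_def restrict_def)
        qed
        moreover have "merge (I d) ?J (x, y) \<in> (\<Union>c\<in>insert d K. I c) \<rightarrow>\<^sub>E UNIV"
          by (auto simp: merge_def PiE_def extensional_def)
        ultimately show ?thesis using y by auto
      qed
      show ?thesis
      proof (rule set_eqI)
        fix z :: "('i \<Rightarrow> real) \<times> ('i \<Rightarrow> real)"
        obtain x y where z: "z = (x, y)" by (cases z)
        have sp: "z \<in> space (?M (I d) \<Otimes>\<^sub>M ?M ?J) \<longleftrightarrow> x \<in> I d \<rightarrow>\<^sub>E UNIV \<and> y \<in> ?J \<rightarrow>\<^sub>E UNIV"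
          unfolding z by (simp add: space_pair_measure space_PiM)
        show "z \<in> merge (I d) ?J -` ?X (insert d K) \<inter> space (?M (I d) \<Otimes>\<^sub>M ?M ?J) \<longleftrightarrow> z \<in> A d \<times> ?X K"
        proof (cases "x \<in> I d \<rightarrow>\<^sub>E UNIV \<and> y \<in> ?J \<rightarrow>\<^sub>E UNIV")
          case True
          have "z \<in> merge (I d) ?J -` ?X (insert d K) \<longleftrightarrow> z \<in> A d \<times> ?X K"
            unfolding z vimage_eq mem_Sigma_iff by (rule merge_iff[OF conjunct1[OF True] conjunct2[OF True]])
          moreover have "z \<in> space (?M (I d) \<Otimes>\<^sub>M ?M ?J)" unfolding sp by (rule True)
          ultimately show ?thesis by (simp only: Int_iff simp_thms)
        next
          case False
          then have "z \<notin> A d \<times> ?X K" using Asub unfolding z mem_Sigma_iff mem_Collect_eq by blast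
          moreover have "z \<notin> space (?M (I d) \<Otimes>\<^sub>M ?M ?J)" unfolding sp by (rule False)
          ultimately show ?thesis by (simp only: Int_iff simp_thms)
        qed
      qed
    qed
    also have "emeasure (?M (I d) \<Otimes>\<^sub>M ?M ?J) (A d \<times> ?X K) = emeasure (?M (I d)) (A d) * emeasure (?M ?J) (?X K)"
      using Ad XK by (rule P.emeasure_pair_measure_Times)
    also have "emeasure (?M ?J) (?X K) = (\<Prod>c\<in>K. emeasure (?M (I c)) (A c))"
      using insert.prems by (intro insert.IH) (auto simp: disjoint_family_on_def)
    finally show ?case using insert.hyps unfolding U by simp
  qed
qed

context circles
begin

abbreviation circle_volume :: "'c set set \<Rightarrow> 'c \<Rightarrow> real" where
  "circle_volume E c \<equiv> len c ^ (card (nbrs E c) - 1) / fact (card (nbrs E c) - 1)"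

lemma finite_coords: "tree C E \<Longrightarrow> finite (coords E)"
  unfolding coords_def using finite_C finite_nbrs[of C E] by (intro finite_SigmaI) auto

text \<open>The block of a circle \<open>c\<close> consists of its arcs other than the omitted one,
  so it has one coordinate less than \<open>c\<close> has neighbours, and positivity of the omitted
  arc cuts out an open simplex of size \<open>len c\<close>.\<close>

lemma
  assumes "tree C E"
  shows sets_chart_domain: "chart_domain E \<in> sets (Leb (coords E))"
    and emeasure_chart_domain: "emeasure (Leb (coords E)) (chart_domain E) =
      ennreal (\<Prod>c\<in>C. circle_volume E c)"
proof -
  define I where "I c = Pair c ` (nbrs E c - {base E c})" for c
  have U: "(\<Union>c\<in>C. I c) = coords E" by (auto simp: I_def coords_def)
  have fin: "finite (I c)" for c using finite_nbrs[OF assms] by (simp add: I_def)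
  have disj: "disjoint_family_on I C" by (auto simp: disjoint_family_on_def I_def)
  have sub: "I c \<subseteq> coords E" if "c \<in> C" for c using that U by blast
  have sum: "sum x (I c) = (\<Sum>a\<in>nbrs E c - {base E c}. x (c, a))" for x :: "'c \<times> 'c \<Rightarrow> real" and c
    unfolding I_def by (subst sum.reindex) (auto simp: inj_on_def)
  have dom: "chart_domain E = {x \<in> (\<Union>c\<in>C. I c) \<rightarrow>\<^sub>E UNIV. \<forall>c\<in>C. restrict x (I c) \<in> open_simplex (I c) (len c)}"
  proof -
    have "restrict x (I c) \<in> open_simplex (I c) (len c) \<longleftrightarrow>
       (\<forall>i\<in>I c. 0 < x i) \<and> (\<Sum>a\<in>nbrs E c - {base E c}. x (c, a)) < len c" for x c
      by (simp add: open_simplex_def sum[symmetric])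
    moreover have "(\<forall>q\<in>coords E. 0 < x q) \<longleftrightarrow> (\<forall>c\<in>C. \<forall>i\<in>I c. 0 < x i)" for x :: "'c \<times> 'c \<Rightarrow> real"
      unfolding U[symmetric] by blast
    ultimately show ?thesis unfolding chart_domain_def U by auto
  qed
  have A: "open_simplex (I c) (len c) \<in> sets (Leb (I c))" for c
    by (rule sets_open_simplex[OF fin])
  show "chart_domain E \<in> sets (Leb (coords E))"
    unfolding dom U[symmetric] using finite_C disj fin A by (rule sets_PiM_blocks)
  have "emeasure (Leb (coords E)) (chart_domain E) =
     (\<Prod>c\<in>C. emeasure (Leb (I c)) (open_simplex (I c) (len c)))"
    unfolding dom U[symmetric] using finite_C disj fin A by (rule emeasure_PiM_blocks)
  also have "\<dots> = (\<Prod>c\<in>C. ennreal (circle_volume E c))"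
  proof (rule prod.cong[OF refl])
    fix c assume c: "c \<in> C"
    have "card (I c) = card (nbrs E c) - 1"
      using base_in_nbrs[OF assms c] by (simp add: I_def card_image inj_on_def)
    then show "emeasure (Leb (I c)) (open_simplex (I c) (len c)) =
       ennreal (circle_volume E c)"
      using emeasure_open_simplex[OF fin len_pos[OF c], of c] by simp
  qed
  also have "\<dots> = ennreal (\<Prod>c\<in>C. circle_volume E c)"
    using len_pos by (intro prod_ennreal) (auto intro!: divide_nonneg_nonneg zero_le_power less_imp_le)
  finally show "emeasure (Leb (coords E)) (chart_domain E) =
      ennreal (\<Prod>c\<in>C. circle_volume E c)" .
qed

subsection \<open>The space of labelled cacti\<close>

lemma rotate_rotate: "rot t (rot s V) = rot (\<lambda>c. s c + t c) V"
  unfolding rotate_circles_def image_image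
  by (intro image_cong refl) (auto simp: rmod_add_rmod add.assoc)

lemma rotate_0:
  assumes "V \<in> cacti C color len"
  shows "rot (\<lambda>_. 0) V = V"
proof -
  have sub: "\<Union>V \<subseteq> circle_points C len" using assms by (simp add: cacti_def constellation_def)
  have "(\<lambda>(c, x). (c, (x + 0) rmod len c)) ` v = v" if "v \<in> V" for v
  proof -
    have "(\<lambda>(c, x). (c, (x + 0) rmod len c)) r = r" if "r \<in> v" for r
      using that \<open>v \<in> V\<close> sub by (auto simp: circle_points_def)
    then show ?thesis by (metis (no_types, lifting) image_cong image_ident)
  qed
  then show ?thesis unfolding rotate_circles_def by simp
qed

lemma equiv_rotation: "equiv (cacti C color len) (rotation)"
proof (rule equivI)
  show "rotation \<subseteq> cacti C color len \<times> cacti C color len"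
    by (auto simp: rotation_rel_def)
  show "refl_on (cacti C color len) (rotation)"
  proof (rule refl_onI)
    fix V assume V: "V \<in> cacti C color len"
    then have "V = rot (\<lambda>_. 0) V" by (simp add: rotate_0)
    with V show "(V, V) \<in> rotation" unfolding rotation_rel_def by blast
  qed
  show "sym (rotation)"
  proof (rule symI)
    fix V W assume "(V, W) \<in> rotation"
    then obtain t where t: "V \<in> cacti C color len" "W \<in> cacti C color len" "W = rot t V"
      by (auto simp: rotation_rel_def)
    then have "rot (\<lambda>c. - t c) W = V" by (simp add: rotate_rotate rotate_0)
    then have "V = rot (\<lambda>c. - t c) W" ..
    with t(1,2) show "(W, V) \<in> rotation" unfolding rotation_rel_def by blast
  qed
  show "trans (rotation)"
  proof (rule transI)
    fix U V W assume "(U, V) \<in> rotation" "(V, W) \<in> rotation"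
    then obtain s t where "U \<in> cacti C color len" "V = rot s U"
      "W \<in> cacti C color len" "W = rot t V"
      by (auto simp: rotation_rel_def)
    then show "(U, W) \<in> rotation" unfolding rotation_rel_def
      using rotate_rotate[of t s U] by blast
  qed
qed

lemma Union_labelled: "\<Union>(labelled) = cacti C color len"
  unfolding labelled_cacti_def by (rule Union_quotient[OF equiv_rotation])

lemma generic_imp_cactus: "V \<in> generic \<Longrightarrow> V \<in> cacti C color len"
  by (simp add: generic_cacti_def)

lemma generic_rotate:
  assumes "V \<in> generic"
  shows "rot t V \<in> generic" "(V, rot t V) \<in> rotation"
proof -
  obtain E p where E: "E \<in> trees" and p: "positions E p" and V: "V = gluing E p"
    using generic_cactusE[OF assms] .
  then have "tree C E" by (simp add: colored_trees_def)
  then show g: "rot t V \<in> generic"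
    unfolding V rotate_gluing using gluing_generic_cactus[OF E positions_rotate] p by blast
  show "(V, rot t V) \<in> rotation"
    unfolding rotation_rel_def using generic_imp_cactus[OF g] generic_imp_cactus[OF assms] by blast
qed

lemma labelled_class_eq:
  assumes "X \<in> labelled" "Y \<in> labelled"
    "V \<in> X" "W \<in> Y" "(V, W) \<in> rotation"
  shows "X = Y"
  using quotient_eqI[OF equiv_rotation] assms unfolding labelled_cacti_def by metis

text \<open>Both cacti are rotations of the same normal form, which depends only on type and
  coordinates.\<close>

lemma chart_injective:
  assumes "V \<in> generic" "W \<in> generic"
    "arc_type len V = arc_type len W" "arc_coords len V = arc_coords len W"
  shows "(V, W) \<in> rotation"
proof -
  obtain E L x t where V: "E \<in> trees" "L \<in> orders E"
    "arc_type len V = order_type L" "arc_coords len V = x"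
    "rot t V = normal E L x"
    using generic_cactus_normal_form[OF assms(1)] by metis
  obtain E' L' x' t' where W: "E' \<in> trees" "L' \<in> orders E'"
    "arc_type len W = order_type L'" "arc_coords len W = x'"
    "rot t' W = normal E' L' x'"
    using generic_cactus_normal_form[OF assms(2)] by metis
  have "E = E' \<and> L = L'"
    using V W assms(3) by (intro order_type_inject) (auto simp: colored_trees_def)
  then have "rot t V = rot t' W" using V W assms(4) by simp
  then have "(V, rot t' W) \<in> rotation" using generic_rotate(2)[OF assms(1)] by metis
  moreover have "(rot t' W, W) \<in> rotation"
    using generic_rotate(2)[OF assms(2)] equiv_rotation by (meson equivE symD)
  ultimately show ?thesis using equiv_rotation by (meson equivE transD)
qed

abbreviation types :: "('c \<times> 'c \<times> 'c) set set" where
  "types \<equiv> arc_type len ` generic"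

lemma typesE:
  assumes "\<tau> \<in> types"
  obtains E L where "E \<in> trees" "L \<in> orders E" "\<tau> = order_type L"
  using assms generic_cactus_normal_form by (metis imageE)

text \<open>All arcs of a circle are taken equally long. The point shows that each pair of a tree
  and an order is realised as a type, so that the sum over types becomes a double sum.\<close>

lemma chart_domain_nonempty:
  assumes "tree C E"
  obtains x where "x \<in> chart_domain E"
proof
  define x where "x = (\<lambda>(c, a)\<in>coords E. len c / real (card (nbrs E c)))"
  have pos: "0 < card (nbrs E c)" if "c \<in> C" for c using tree_card_nbrs_pos[OF assms that card_C] .
  have "(\<Sum>a\<in>nbrs E c - {base E c}. x (c, a)) < len c" if c: "c \<in> C" for c
  proof -
    have "(\<Sum>a\<in>nbrs E c - {base E c}. x (c, a)) = (\<Sum>a\<in>nbrs E c - {base E c}. len c / real (card (nbrs E c)))"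
      using c by (intro sum.cong) (auto simp: x_def coords_def)
    also have "\<dots> = real (card (nbrs E c) - 1) * (len c / real (card (nbrs E c)))"
      using base_in_nbrs[OF assms c] by simp
    also have "\<dots> < real (card (nbrs E c)) * (len c / real (card (nbrs E c)))"
      using pos[OF c] len_pos[OF c] by (intro mult_strict_right_mono) auto
    finally show ?thesis using pos[OF c] by simp
  qed
  moreover have "0 < x q" if "q \<in> coords E" for q
    using that pos len_pos by (auto simp: x_def coords_def)
  moreover have "x \<in> coords E \<rightarrow>\<^sub>E UNIV" by (simp add: x_def)
  ultimately show "x \<in> chart_domain E" by (simp add: chart_domain_def)
qed

lemma types_eq: "types = (\<lambda>(E, L). order_type L) ` (SIGMA E:trees. orders E)"
proof (intro equalityI subsetI)
  fix \<tau> assume "\<tau> \<in> types"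
  then show "\<tau> \<in> (\<lambda>(E, L). order_type L) ` (SIGMA E:trees. orders E)"
    by (rule typesE) force
next
  fix \<tau> assume "\<tau> \<in> (\<lambda>(E, L). order_type L) ` (SIGMA E:trees. orders E)"
  then obtain E L where E: "E \<in> trees" and L: "L \<in> orders E" and \<tau>: "\<tau> = order_type L" by auto
  obtain x where x: "x \<in> chart_domain E" using chart_domain_nonempty E by (auto simp: colored_trees_def)
  show "\<tau> \<in> types" unfolding \<tau> using normal_type[OF E L x] normal_generic[OF E L x] by (metis imageI)
qed

lemma chart_image_labelled:
  assumes "E \<in> trees" "L \<in> orders E"
  shows "chart (order_type L) (labelled) = chart_domain E"
proof (intro equalityI subsetI)
  fix x assume "x \<in> chart (order_type L) (labelled)"
  then obtain V where V: "V \<in> generic" "arc_type len V = order_type L" "x = arc_coords len V"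
    unfolding chart_image_def by blast
  obtain E' L' where "E' \<in> trees" "L' \<in> orders E'" "x \<in> chart_domain E'" "arc_type len V = order_type L'"
    using generic_cactus_normal_form[OF V(1)] V(3) by metis
  moreover from this have "E = E'" using order_type_inject[of E E' L L'] assms V by (auto simp: colored_trees_def)
  ultimately show "x \<in> chart_domain E" by simp
next
  fix x assume x: "x \<in> chart_domain E"
  let ?V = "normal E L x"
  have "?V \<in> \<Union>(labelled)"
    unfolding Union_labelled using generic_imp_cactus[OF normal_generic[OF assms x]] .
  then show "x \<in> chart (order_type L) (labelled)"
    unfolding chart_image_def
    by (intro image_eqI[of _ _ ?V]) (simp_all add: normal_generic[OF assms x] normal_type[OF assms x] normal_coords[OF assms x])
qed

lemma chart_image_not_type:
  "\<tau> \<notin> types \<Longrightarrow> chart \<tau> A = {}"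
  unfolding chart_image_def by blast

text \<open>Injectivity of the charts on rotation classes turns disjoint sets of classes into
  disjoint sets of coordinate vectors. Complements and countable additivity of the labelled volume
  rest on this.\<close>

lemma chart_image_disjoint:
  assumes "A \<subseteq> labelled" "B \<subseteq> labelled" "A \<inter> B = {}"
  shows "chart \<tau> A \<inter> chart \<tau> B = {}"
proof (rule ccontr)
  assume "chart \<tau> A \<inter> chart \<tau> B \<noteq> {}"
  then obtain V W X Y where "V \<in> generic" "W \<in> generic"
    "arc_type len V = \<tau>" "arc_type len W = \<tau>" "arc_coords len V = arc_coords len W"
    and XY: "X \<in> A" "Y \<in> B" "V \<in> X" "W \<in> Y"
    unfolding chart_image_def by blast
  then have "(V, W) \<in> rotation" using chart_injective by simp
  then have "X = Y" using labelled_class_eq XY assms by blast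
  with XY assms show False by blast
qed

lemma chart_image_UN: "chart \<tau> (\<Union>i. A i) = (\<Union>i. chart \<tau> (A i))"
  unfolding chart_image_def by blast

lemma chart_image_Un: "chart \<tau> (A \<union> B) = chart \<tau> A \<union> chart \<tau> B"
  unfolding chart_image_def by blast

lemma chart_image_Diff:
  assumes "A \<subseteq> labelled"
  shows "chart \<tau> (labelled - A) =
    chart \<tau> (labelled) - chart \<tau> A"
proof -
  let ?\<Omega> = "labelled"
  have "chart \<tau> ?\<Omega> = chart \<tau> (A \<union> (?\<Omega> - A))"
    using assms by (simp add: Un_absorb1)
  then have "chart \<tau> ?\<Omega> = chart \<tau> A \<union> chart \<tau> (?\<Omega> - A)"
    by (simp only: chart_image_Un)
  moreover have "chart \<tau> A \<inter> chart \<tau> (?\<Omega> - A) = {}"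
    using assms by (intro chart_image_disjoint) auto
  ultimately show ?thesis by blast
qed

definition labelled_sets :: "('c \<times> real) set set set set set" where
  "labelled_sets = {A. A \<subseteq> labelled \<and>
     (\<forall>\<tau>. chart \<tau> A \<in> sets (Leb (coord_arcs \<tau>)))}"

definition labelled_volume :: "('c \<times> real) set set set set \<Rightarrow> ennreal" where
  "labelled_volume A = (\<Sum>\<tau>\<in>types. emeasure (Leb (coord_arcs \<tau>)) (chart \<tau> A))"

lemma chart_image_space_sets:
  "chart \<tau> (labelled) \<in> sets (Leb (coord_arcs \<tau>))"
proof (cases "\<tau> \<in> types")
  case True
  then obtain E L where E: "E \<in> trees" "L \<in> orders E" "\<tau> = order_type L" by (rule typesE)
  then have "tree C E" by (simp add: colored_trees_def)
  then show ?thesis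
    unfolding E(3) chart_image_labelled[OF E(1,2)] coord_arcs_order_type[OF \<open>tree C E\<close> E(2)]
    by (rule sets_chart_domain)
next
  case False
  then show ?thesis by (simp add: chart_image_not_type)
qed

text \<open>\<open>measure_of\<close> assigns 0 to everything if the given set function is not a
  measure on the generated sigma-algebra. Before any volume can be computed, the sigma-algebra and
  the additivity must therefore be verified, both by transport through the charts.\<close>

lemma sigma_algebra_labelled: "sigma_algebra (labelled) labelled_sets"
  unfolding sigma_algebra_iff2
proof (intro conjI ballI allI impI)
  show "labelled_sets \<subseteq> Pow (labelled)" by (auto simp: labelled_sets_def)
  show "{} \<in> labelled_sets" by (simp add: labelled_sets_def chart_image_def)
  fix A assume "A \<in> labelled_sets"
  then show "labelled - A \<in> labelled_sets"
    by (auto simp: labelled_sets_def chart_image_Diff intro!: chart_image_space_sets)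
next
  fix A :: "nat \<Rightarrow> ('c \<times> real) set set set set" assume A: "range A \<subseteq> labelled_sets"
  have "chart \<tau> (\<Union>i. A i) \<in> sets (Leb (coord_arcs \<tau>))" for \<tau>
    unfolding chart_image_UN using A by (intro sets.countable_UN) (auto simp: labelled_sets_def)
  moreover have "(\<Union>i. A i) \<subseteq> labelled" using A unfolding labelled_sets_def by blast
  ultimately show "(\<Union>i. A i) \<in> labelled_sets" by (simp add: labelled_sets_def)
qed

lemma measure_space_labelled:
  "positive labelled_sets labelled_volume" "countably_additive labelled_sets labelled_volume"
proof -
  show "positive labelled_sets labelled_volume"
    by (simp add: positive_def labelled_volume_def chart_image_def)
  show "countably_additive labelled_sets labelled_volume"
  proof (rule countably_additiveI)
    fix A :: "nat \<Rightarrow> _" assume A: "range A \<subseteq> labelled_sets" "disjoint_family A"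
    have "(\<Sum>i. labelled_volume (A i)) = (\<Sum>\<tau>\<in>types. \<Sum>i. emeasure (Leb (coord_arcs \<tau>)) (chart \<tau> (A i)))"
      unfolding labelled_volume_def by (rule suminf_sum) (rule summableI)
    also have "\<dots> = labelled_volume (\<Union>i. A i)"
      unfolding labelled_volume_def
    proof (rule sum.cong[OF refl])
      fix \<tau>
      show "(\<Sum>i. emeasure (Leb (coord_arcs \<tau>)) (chart \<tau> (A i))) =
         emeasure (Leb (coord_arcs \<tau>)) (chart \<tau> (\<Union>i. A i))"
        unfolding chart_image_UN
      proof (rule suminf_emeasure)
        show "range (\<lambda>i. chart \<tau> (A i)) \<subseteq> sets (Leb (coord_arcs \<tau>))"
          using A(1) by (auto simp: labelled_sets_def)
        show "disjoint_family (\<lambda>i. chart \<tau> (A i))"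
          unfolding disjoint_family_on_def
        proof (intro ballI impI)
          fix i j :: nat assume "i \<noteq> j"
          then have "A i \<inter> A j = {}" using A(2) by (simp add: disjoint_family_on_def)
          moreover have "A k \<subseteq> labelled" for k using A(1) by (auto simp: labelled_sets_def)
          ultimately show "chart \<tau> (A i) \<inter> chart \<tau> (A j) = {}"
            by (intro chart_image_disjoint)
        qed
      qed
    qed
    finally show "(\<Sum>i. labelled_volume (A i)) = labelled_volume (\<Union>i. A i)" .
  qed
qed

lemma labelled_measure_eq:
  "labelled_measure C color len = measure_of (labelled) labelled_sets labelled_volume"
  by (simp add: labelled_measure_def labelled_sets_def labelled_volume_def[abs_def])

lemma
  shows space_labelled_measure: "space (labelled_measure C color len) = labelled"
    and sets_labelled_measure: "sets (labelled_measure C color len) = labelled_sets"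
    and emeasure_labelled_measure: "A \<in> labelled_sets \<Longrightarrow> emeasure (labelled_measure C color len) A = labelled_volume A"
proof -
  interpret S: sigma_algebra "labelled" labelled_sets by (rule sigma_algebra_labelled)
  show "space (labelled_measure C color len) = labelled"
    unfolding labelled_measure_eq using S.space_closed by (rule space_measure_of)
  show "sets (labelled_measure C color len) = labelled_sets"
    unfolding labelled_measure_eq by (rule S.sets_measure_of_eq)
  show "A \<in> labelled_sets \<Longrightarrow> emeasure (labelled_measure C color len) A = labelled_volume A"
    unfolding labelled_measure_eq
    using sigma_algebra_labelled measure_space_labelled by (rule emeasure_measure_of_sigma)
qed

section \<open>The total volume of the labelled space\<close>

lemma card_orders:
  assumes "tree C E"
  shows "finite (orders E)" "card (orders E) = (\<Prod>c\<in>C. fact (card (nbrs E c) - 1))"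
proof -
  have *: "finite (circle_orders E c)"
      "card (circle_orders E c) = fact (card (nbrs E c) - 1)"
    if c: "c \<in> C" for c
  proof -
    have b: "base E c \<in> nbrs E c" by (rule base_in_nbrs[OF assms c])
    have eq: "circle_orders E c =
        (#) (base E c) ` permutations_of_set (nbrs E c - {base E c})"
    proof (intro equalityI subsetI)
      fix xs assume "xs \<in> circle_orders E c"
      then have xs: "distinct xs" "set xs = nbrs E c" "hd xs = base E c" by auto
      then obtain ys where ys: "xs = base E c # ys" using b by (cases xs) auto
      then have "ys \<in> permutations_of_set (nbrs E c - {base E c})"
        using xs by (auto simp: permutations_of_set_def)
      with ys show "xs \<in> (#) (base E c) ` permutations_of_set (nbrs E c - {base E c})" by simp
    next
      fix xs assume "xs \<in> (#) (base E c) ` permutations_of_set (nbrs E c - {base E c})"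
      then obtain ys where ys: "xs = base E c # ys" "set ys = nbrs E c - {base E c}" "distinct ys"
        unfolding permutations_of_set_def by blast
      have "set xs = nbrs E c" unfolding ys(1) list.set ys(2) using b by (rule insert_Diff)
      then show "xs \<in> circle_orders E c" using ys by simp
    qed
    have fin: "finite (nbrs E c - {base E c})" using finite_nbrs[OF assms] by simp
    show "finite (circle_orders E c)" unfolding eq by simp
    show "card (circle_orders E c) = fact (card (nbrs E c) - 1)"
      unfolding eq using b fin by (simp add: card_image card_permutations_of_set)
  qed
  show "finite (orders E)" unfolding orders_def using finite_C *(1) by (intro finite_PiE)
  show "card (orders E) = (\<Prod>c\<in>C. fact (card (nbrs E c) - 1))"
    unfolding orders_def card_PiE[OF finite_C] by (intro prod.cong) (auto simp: *(2))
qed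

lemma sum_types:
  fixes f :: "('c \<times> 'c \<times> 'c) set \<Rightarrow> ennreal"
  shows "(\<Sum>\<tau>\<in>types. f \<tau>) = (\<Sum>E\<in>trees. \<Sum>L\<in>orders E. f (order_type L))"
proof -
  have inj: "inj_on (\<lambda>(E, L). order_type L) (SIGMA E:trees. orders E)"
    by (rule inj_onI) (auto simp: colored_trees_def dest: order_type_inject)
  have "(\<Sum>\<tau>\<in>types. f \<tau>) = (\<Sum>(E, L)\<in>(SIGMA E:trees. orders E). f (order_type L))"
    unfolding types_eq by (subst sum.reindex[OF inj]) (simp add: case_prod_beta)
  also have "\<dots> = (\<Sum>E\<in>trees. \<Sum>L\<in>orders E. f (order_type L))"
    using finite_colored_trees[OF finite_C] card_orders(1)
    by (subst sum.Sigma) (auto simp: colored_trees_def)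
  finally show ?thesis .
qed

lemma emeasure_labelled_cacti:
  "emeasure (labelled_measure C color len) (labelled) = ennreal (tree_sum color C len)"
proof -
  have S: "labelled \<in> labelled_sets"
    by (simp add: labelled_sets_def chart_image_space_sets)
  have "labelled_volume (labelled) =
     (\<Sum>E\<in>trees. \<Sum>L\<in>orders E.
        ennreal (\<Prod>c\<in>C. circle_volume E c))"
    unfolding labelled_volume_def sum_types
  proof (intro sum.cong refl)
    fix E L assume E: "E \<in> trees" "L \<in> orders E"
    then have t: "tree C E" by (simp add: colored_trees_def)
    show "emeasure (Leb (coord_arcs (order_type L)))
        (chart (order_type L) (labelled)) =
        ennreal (\<Prod>c\<in>C. circle_volume E c)"
      unfolding chart_image_labelled[OF E] coord_arcs_order_type[OF t E(2)] by (rule emeasure_chart_domain[OF t])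
  qed
  also have "\<dots> = (\<Sum>E\<in>trees. ennreal (\<Prod>c\<in>C. len c ^ (card (nbrs E c) - 1)))"
  proof (rule sum.cong[OF refl])
    fix E assume "E \<in> trees"
    then have t: "tree C E" by (simp add: colored_trees_def)
    have nn: "0 \<le> (\<Prod>c\<in>C. circle_volume E c)"
      using len_pos by (intro prod_nonneg) (auto intro!: divide_nonneg_nonneg zero_le_power less_imp_le)
    have "(\<Sum>L\<in>orders E. ennreal (\<Prod>c\<in>C. circle_volume E c)) =
       ennreal (real (card (orders E)) * (\<Prod>c\<in>C. circle_volume E c))"
      using nn by (simp add: ennreal_mult ennreal_of_nat_eq_real_of_nat)
    \<comment> \<open>On each circle the number of cyclic orders cancels the factorial in the volume
      of the simplex.\<close>
    also have "real (card (orders E)) * (\<Prod>c\<in>C. circle_volume E c) =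
       (\<Prod>c\<in>C. fact (card (nbrs E c) - 1) * (circle_volume E c))"
      unfolding card_orders(2)[OF t] prod.distrib by simp
    also have "\<dots> = (\<Prod>c\<in>C. len c ^ (card (nbrs E c) - 1))" by simp
    finally show "(\<Sum>L\<in>orders E. ennreal (\<Prod>c\<in>C. circle_volume E c)) =
       ennreal (\<Prod>c\<in>C. len c ^ (card (nbrs E c) - 1))" .
  qed
  also have "\<dots> = ennreal (tree_sum color C len)"
    unfolding tree_sum_def using len_pos by (intro sum_ennreal prod_nonneg) (auto intro: less_imp_le)
  finally show ?thesis using emeasure_labelled_measure[OF S] by simp
qed

end


subsection \<open>The quotient by relabelings\<close>

text \<open>Where classes have \<open>n\<close> elements the density is constant, so the quotient
  measure of \<open>B\<close> is \<open>1 / n\<close> times the measure of \<open>\<Union>B\<close>.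
  Distinct classes are disjoint, which makes \<open>\<Union>\<close> compatible with complements and
  disjoint unions; this has to be established first for \<open>measure_of\<close> to return the
  intended value.\<close>

lemma emeasure_quotient_measure:
  assumes R: "equiv (space M) R" and AE: "AE x in M. card (R `` {x}) = n"
  shows "emeasure (quotient_measure M R) (space M // R) = ennreal (1 / real n) * emeasure M (space M)"
proof -
  define \<B> where "\<B> = {B. B \<subseteq> space M // R \<and> \<Union>B \<in> sets M}"
  define \<nu> where "\<nu> B = (\<integral>\<^sup>+x\<in>\<Union>B. ennreal (1 / real (card (R `` {x}))) \<partial>M)" for B
  have \<nu>: "\<nu> B = ennreal (1 / real n) * emeasure M (\<Union>B)" if "B \<in> \<B>" for B
  proof -
    \<comment> \<open>Measurability of the class size is not at hand; under the integral it is
      replaced almost everywhere by the constant \<open>n\<close>.\<close>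
    have "\<nu> B = (\<integral>\<^sup>+x. ennreal (1 / real n) * indicator (\<Union>B) x \<partial>M)"
      unfolding \<nu>_def using AE by (intro nn_integral_cong_AE) auto
    also have "\<dots> = ennreal (1 / real n) * emeasure M (\<Union>B)"
      using that by (intro nn_integral_cmult_indicator) (simp add: \<B>_def)
    finally show ?thesis .
  qed
  have disj: "\<Union>A \<inter> \<Union>B = {}" if "A \<subseteq> space M // R" "B \<subseteq> space M // R" "A \<inter> B = {}" for A B
  proof (rule ccontr)
    assume "\<Union>A \<inter> \<Union>B \<noteq> {}"
    then obtain X Y x where X: "X \<in> A" "Y \<in> B" "x \<in> X" "x \<in> Y" by blast
    then have "X = Y" using quotient_disj[OF R, of X Y] that by blast
    with X that show False by blast
  qed
  have U: "\<Union>(space M // R) = space M" by (rule Union_quotient[OF R])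
  have diff: "\<Union>(space M // R - B) = space M - \<Union>B" if "B \<subseteq> space M // R" for B
  proof -
    have "\<Union>(space M // R - B) \<union> \<Union>B = space M" unfolding Union_Un_distrib[symmetric] using that U by (simp add: Un_absorb1 Un_commute)
    moreover have "\<Union>(space M // R - B) \<inter> \<Union>B = {}" using that by (intro disj) auto
    ultimately show ?thesis by blast
  qed
  have "sigma_algebra (space M // R) \<B>"
    unfolding sigma_algebra_iff2
  proof (intro conjI ballI allI impI)
    show "\<B> \<subseteq> Pow (space M // R)" "{} \<in> \<B>" by (auto simp: \<B>_def)
    fix B assume "B \<in> \<B>"
    then show "space M // R - B \<in> \<B>" by (auto simp: \<B>_def diff)
  next
    fix B :: "nat \<Rightarrow> 'a set set" assume B: "range B \<subseteq> \<B>"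
    have "\<Union>(\<Union>i. B i) = (\<Union>i. \<Union>(B i))" by blast
    moreover have "(\<Union>i. \<Union>(B i)) \<in> sets M" using B by (intro sets.countable_UN) (auto simp: \<B>_def)
    ultimately show "(\<Union>i. B i) \<in> \<B>" using B by (auto simp: \<B>_def)
  qed
  moreover have "positive \<B> \<nu>" by (simp add: positive_def \<nu>_def)
  moreover have "countably_additive \<B> \<nu>"
  proof (rule countably_additiveI)
    fix B :: "nat \<Rightarrow> 'a set set" assume B: "range B \<subseteq> \<B>" "disjoint_family B" "(\<Union>i. B i) \<in> \<B>"
    have "(\<Sum>i. \<nu> (B i)) = (\<Sum>i. ennreal (1 / real n) * emeasure M (\<Union>(B i)))"
      using B by (intro suminf_cong \<nu>) auto
    also have "\<dots> = ennreal (1 / real n) * (\<Sum>i. emeasure M (\<Union>(B i)))" by simp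
    also have "(\<Sum>i. emeasure M (\<Union>(B i))) = emeasure M (\<Union>i. \<Union>(B i))"
    proof (rule suminf_emeasure)
      show "range (\<lambda>i. \<Union>(B i)) \<subseteq> sets M" using B(1) by (auto simp: \<B>_def)
      show "disjoint_family (\<lambda>i. \<Union>(B i))"
        unfolding disjoint_family_on_def
      proof (intro ballI impI)
        fix i j :: nat assume "i \<noteq> j"
        then have "B i \<inter> B j = {}" using B(2) by (simp add: disjoint_family_on_def)
        moreover have "B k \<subseteq> space M // R" for k using B(1) by (auto simp: \<B>_def)
        ultimately show "\<Union>(B i) \<inter> \<Union>(B j) = {}" by (intro disj)
      qed
    qed
    also have "(\<Union>i. \<Union>(B i)) = \<Union>(\<Union>i. B i)" by blast
    also have "ennreal (1 / real n) * emeasure M (\<Union>(\<Union>i. B i)) = \<nu> (\<Union>i. B i)"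
      using \<nu>[OF B(3)] by simp
    finally show "(\<Sum>i. \<nu> (B i)) = \<nu> (\<Union>i. B i)" .
  qed
  moreover have top: "space M // R \<in> \<B>" by (simp add: \<B>_def U)
  ultimately have "emeasure (measure_of (space M // R) \<B> \<nu>) (space M // R) = \<nu> (space M // R)"
    by (rule emeasure_measure_of_sigma)
  moreover have "quotient_measure M R = measure_of (space M // R) \<B> \<nu>"
    by (simp add: quotient_measure_def \<B>_def \<nu>_def[abs_def])
  ultimately show ?thesis using \<nu>[OF top] U by simp
qed

section \<open>The action of relabelings on gluings and rotation classes\<close>

lemma tree_image:
  assumes "tree S E" "inj f"
  shows "tree (f ` S) (image f ` E)"
  using assms(1)
proof (induction rule: tree.induct)
  case (singleton v)
  then show ?case by (simp add: tree.singleton)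
next
  case (add_leaf S E u v)
  then have "tree (insert (f v) (f ` S)) (insert {f u, f v} (image f ` E))"
    using assms(2) by (intro tree.add_leaf) (auto dest: injD)
  then show ?case by simp
qed

lemma nbrs_image:
  assumes "inj f"
  shows "nbrs (image f ` E) (f c) = f ` nbrs E c"
proof (intro equalityI subsetI)
  fix b assume "b \<in> nbrs (image f ` E) (f c)"
  then obtain e where e: "e \<in> E" "f ` e = {f c, b}" by (auto simp: nbrs_def)
  then obtain a where a: "b = f a" "a \<in> e" by (metis imageE insertI1 insert_commute)
  then have "f ` e = f ` {c, a}" using e by simp
  then have "e = {c, a}" using assms by (simp only: inj_image_eq_iff)
  then show "b \<in> f ` nbrs E c" using a e by (simp add: nbrs_def)
next
  fix b assume "b \<in> f ` nbrs E c"
  then obtain a where a: "b = f a" "{c, a} \<in> E" by (auto simp: nbrs_def)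
  then have "f ` {c, a} \<in> image f ` E" by (intro imageI)
  then show "b \<in> nbrs (image f ` E) (f c)" using a by (simp add: nbrs_def)
qed

context circles
begin

lemma relabelingsD:
  assumes "\<sigma> \<in> relabs"
  shows "\<sigma> permutes C" "bij \<sigma>" "inj \<sigma>" "color (\<sigma> c) = color c" "len (\<sigma> c) = len c" "\<sigma> ` C = C"
proof -
  show p: "\<sigma> permutes C" using assms by (simp add: relabelings_def)
  show "bij \<sigma>" "inj \<sigma>" "\<sigma> ` C = C" using p by (auto simp: permutes_bij permutes_inj permutes_image)
  show "color (\<sigma> c) = color c" "len (\<sigma> c) = len c"
    using assms permutes_not_in[OF p, of c] by (cases "c \<in> C"; simp add: relabelings_def)+
qed

lemma relabelings_group:
  shows "id \<in> relabs"
    and "\<sigma> \<in> relabs \<Longrightarrow> \<tau> \<in> relabs \<Longrightarrow> \<sigma> \<circ> \<tau> \<in> relabs"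
    and "\<sigma> \<in> relabs \<Longrightarrow> inv \<sigma> \<in> relabs"
proof -
  show "id \<in> relabs" by (simp add: relabelings_def)
  show "\<sigma> \<circ> \<tau> \<in> relabs" if s: "\<sigma> \<in> relabs" "\<tau> \<in> relabs"
    using relabelingsD[OF s(1)] relabelingsD[OF s(2)]
    by (simp add: relabelings_def permutes_compose)
  show "inv \<sigma> \<in> relabs" if s: "\<sigma> \<in> relabs"
  proof -
    have "\<sigma> (inv \<sigma> c) = c" for c using relabelingsD(1)[OF s] by (simp add: permutes_inverses)
    then have "color (inv \<sigma> c) = color c" "len (inv \<sigma> c) = len c" for c
      using relabelingsD(4,5)[OF s, of "inv \<sigma> c"] by simp_all
    then show ?thesis using permutes_inv[OF relabelingsD(1)[OF s]] by (simp add: relabelings_def)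
  qed
qed

lemma relabel_comp: "relabel (\<sigma> \<circ> \<tau>) V = relabel \<sigma> (relabel \<tau> V)"
  by (simp add: relabel_def image_image map_prod_def case_prod_beta)

lemma relabel_id: "relabel id V = V"
  by (simp add: relabel_def map_prod.id)

lemma relabel_inv:
  assumes "\<sigma> \<in> relabs"
  shows "relabel (inv \<sigma>) (relabel \<sigma> V) = V"
  using relabelingsD(3)[OF assms] by (simp add: relabel_comp[symmetric] relabel_id)

lemma equiv_relabel: "equiv (labelled) (relabel_rel C color len)"
proof (rule equivI)
  show "relabel_rel C color len \<subseteq> labelled \<times> labelled"
    by (auto simp: relabel_rel_def)
  show "refl_on (labelled) (relabel_rel C color len)"
  proof (rule refl_onI)
    fix X assume X: "X \<in> labelled"
    have "X = relabel id ` X" by (simp add: relabel_id)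
    with X relabelings_group(1) show "(X, X) \<in> relabel_rel C color len" unfolding relabel_rel_def by blast
  qed
  show "sym (relabel_rel C color len)"
  proof (rule symI)
    fix X Y assume "(X, Y) \<in> relabel_rel C color len"
    then obtain \<sigma> where s: "X \<in> labelled" "Y \<in> labelled"
      "\<sigma> \<in> relabs" "Y = relabel \<sigma> ` X" unfolding relabel_rel_def by blast
    have "X = relabel (inv \<sigma>) ` Y" unfolding s(4) image_image by (simp add: relabel_inv[OF s(3)])
    with s relabelings_group(3)[OF s(3)] show "(Y, X) \<in> relabel_rel C color len" unfolding relabel_rel_def by blast
  qed
  show "trans (relabel_rel C color len)"
  proof (rule transI)
    fix X Y Z assume "(X, Y) \<in> relabel_rel C color len" "(Y, Z) \<in> relabel_rel C color len"
    then obtain \<sigma> \<tau> where s: "X \<in> labelled" "Z \<in> labelled"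
      "\<sigma> \<in> relabs" "\<tau> \<in> relabs" "Y = relabel \<sigma> ` X" "Z = relabel \<tau> ` Y"
      unfolding relabel_rel_def by blast
    have "Z = relabel (\<tau> \<circ> \<sigma>) ` X" unfolding s(5,6) image_image by (simp add: relabel_comp)
    with s relabelings_group(2)[OF s(4,3)] show "(X, Z) \<in> relabel_rel C color len" unfolding relabel_rel_def by blast
  qed
qed

definition relabel_positions :: "('c \<Rightarrow> 'c) \<Rightarrow> ('c \<Rightarrow> 'c \<Rightarrow> real) \<Rightarrow> 'c \<Rightarrow> 'c \<Rightarrow> real" where
  "relabel_positions \<sigma> p c a = p (inv \<sigma> c) (inv \<sigma> a)"

lemma relabel_gluing:
  assumes "inj \<sigma>"
  shows "relabel \<sigma> (gluing E p) = gluing (image \<sigma> ` E) (relabel_positions \<sigma> p)"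
proof -
  let ?q = "relabel_positions \<sigma> p"
  have *: "map_prod \<sigma> id ` {(c, p c a), (a, p a c)} = {(\<sigma> c, ?q (\<sigma> c) (\<sigma> a)), (\<sigma> a, ?q (\<sigma> a) (\<sigma> c))}" for c a
    using assms by (simp add: relabel_positions_def)
  show ?thesis
  proof (intro equalityI subsetI)
    fix v assume "v \<in> relabel \<sigma> (gluing E p)"
    then obtain c a where ca: "{c, a} \<in> E" "v = map_prod \<sigma> id ` {(c, p c a), (a, p a c)}"
      unfolding relabel_def gluing_def by blast
    have "\<sigma> ` {c, a} \<in> image \<sigma> ` E" using ca(1) by (rule imageI)
    then show "v \<in> gluing (image \<sigma> ` E) ?q" unfolding ca(2) * gluing_def by auto
  next
    fix v assume "v \<in> gluing (image \<sigma> ` E) ?q"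
    then obtain c' a' where ca': "{c', a'} \<in> image \<sigma> ` E" "v = {(c', ?q c' a'), (a', ?q a' c')}"
      unfolding gluing_def by blast
    then obtain e where e: "e \<in> E" "\<sigma> ` e = {c', a'}" by auto
    then obtain c where c: "c' = \<sigma> c" by (metis imageE insertI1)
    have "a' \<in> nbrs (image \<sigma> ` E) (\<sigma> c)" using ca'(1) by (simp add: nbrs_def c)
    then obtain a where a: "a' = \<sigma> a" "{c, a} \<in> E" unfolding nbrs_image[OF assms] by (auto simp: nbrs_def)
    have "{(c, p c a), (a, p a c)} \<in> gluing E p" using a(2) unfolding gluing_def by blast
    then show "v \<in> relabel \<sigma> (gluing E p)"
      unfolding relabel_def ca'(2) c a(1) *[symmetric] by (rule imageI)
  qed
qed

lemma colored_trees_relabel: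
  assumes "\<sigma> \<in> relabs" "E \<in> trees"
  shows "image \<sigma> ` E \<in> trees"
proof -
  note s = relabelingsD[OF assms(1)]
  have "tree C (image \<sigma> ` E)" using tree_image[of C E \<sigma>] assms(2) s(3,6) by (simp add: colored_trees_def)
  moreover have "color u \<noteq> color v" if uv: "{u, v} \<in> image \<sigma> ` E" for u v
  proof -
    obtain u' where u': "u = \<sigma> u'" using s(2) by (metis bij_pointE)
    have "v \<in> nbrs (image \<sigma> ` E) (\<sigma> u')" using uv by (simp add: nbrs_def u')
    then obtain v' where "v = \<sigma> v'" "{u', v'} \<in> E" unfolding nbrs_image[OF s(3)] by (auto simp: nbrs_def)
    then show ?thesis using assms(2) s(4) by (simp add: u' colored_trees_def)
  qed
  ultimately show ?thesis by (simp add: colored_trees_def)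
qed

lemma positions_relabel:
  assumes "\<sigma> \<in> relabs" "positions E p"
  shows "positions (image \<sigma> ` E) (relabel_positions \<sigma> p)"
  unfolding positions_def
proof (rule allI)
  fix c'
  note s = relabelingsD[OF assms(1)]
  obtain c where c: "c' = \<sigma> c" using s(2) by (metis bij_pointE)
  have q: "relabel_positions \<sigma> p (\<sigma> c) (\<sigma> a) = p c a" for a
    using s(3) by (simp add: relabel_positions_def)
  have "inj_on (relabel_positions \<sigma> p (\<sigma> c)) (\<sigma> ` nbrs E c)"
    using assms(2) by (auto simp: inj_on_def q positions_def)
  then show "inj_on (relabel_positions \<sigma> p c') (nbrs (image \<sigma> ` E) c') \<and>
      (\<forall>a\<in>nbrs (image \<sigma> ` E) c'. 0 \<le> relabel_positions \<sigma> p c' a \<and> relabel_positions \<sigma> p c' a < len c')"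
    using assms(2) unfolding c nbrs_image[OF s(3)] by (auto simp: q s(5) positions_def)
qed

lemma gluing_arc_relabel:
  assumes "\<sigma> \<in> relabs"
  shows "gluing_arc (image \<sigma> ` E) (relabel_positions \<sigma> p) (\<sigma> c) (\<sigma> a) = gluing_arc E p c a"
proof -
  note s = relabelingsD[OF assms]
  have q: "relabel_positions \<sigma> p (\<sigma> c) (\<sigma> b) = p c b" for b
    using s(3) by (simp add: relabel_positions_def)
  show ?thesis
    unfolding gluing_arc_def arc_length_eq_Min circle_gluings_gluing nbrs_image[OF s(3)] image_image q
    by (simp add: arc_dist_def s(5))
qed

lemma generic_relabel:
  assumes "\<sigma> \<in> relabs" "V \<in> generic"
  shows "relabel \<sigma> V \<in> generic"
proof -
  obtain E p where E: "E \<in> trees" and p: "positions E p" and V: "V = gluing E p"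
    using generic_cactusE[OF assms(2)] .
  show ?thesis unfolding V relabel_gluing[OF relabelingsD(3)[OF assms(1)]]
    using colored_trees_relabel[OF assms(1) E] positions_relabel[OF assms(1) p] by (rule gluing_generic_cactus)
qed

lemma relabel_rotate:
  assumes "\<sigma> \<in> relabs"
  shows "relabel \<sigma> (rot t V) = rot (\<lambda>c. t (inv \<sigma> c)) (relabel \<sigma> V)"
  unfolding relabel_def rotate_circles_def image_image
  by (intro image_cong refl) (auto simp: relabelingsD(5)[OF assms] inv_f_f[OF relabelingsD(3)[OF assms]])

text \<open>\<open>rotation_rel\<close> relates only cacti to each other; since all rotations of a
  generic cactus are cacti, its class is a full orbit, on which relabelings can be computed.\<close>

lemma labelled_class_eq_range:
  assumes "X \<in> labelled" "V \<in> X" "V \<in> generic"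
  shows "X = range (\<lambda>t. rot t V)"
proof -
  obtain U where U: "X = rotation `` {U}"
    using assms(1) unfolding labelled_cacti_def by (rule quotientE)
  then have "(U, V) \<in> rotation" using assms(2) by simp
  then have "X = rotation `` {V}" unfolding U by (rule equiv_class_eq[OF equiv_rotation])
  moreover have "W \<in> rotation `` {V} \<longleftrightarrow> W \<in> range (\<lambda>t. rot t V)" for W
  proof
    assume "W \<in> rotation `` {V}"
    then obtain t where "W = rot t V" by (auto simp: rotation_rel_def)
    then show "W \<in> range (\<lambda>t. rot t V)" by simp
  next
    assume "W \<in> range (\<lambda>t. rot t V)"
    then obtain t where "W = rot t V" by (rule rangeE)
    then show "W \<in> rotation `` {V}" using generic_rotate(2)[OF assms(3), of t] by simp
  qed
  ultimately show ?thesis by (simp only: set_eq_iff simp_thms)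
qed

lemma labelled_class_range:
  assumes "V \<in> generic"
  shows "range (\<lambda>t. rot t V) \<in> labelled"
    "V \<in> range (\<lambda>t. rot t V)"
proof -
  have V: "V \<in> cacti C color len" by (rule generic_imp_cactus[OF assms])
  then obtain X where X: "X \<in> labelled" "V \<in> X" unfolding Union_labelled[symmetric] by (rule UnionE)
  show "range (\<lambda>t. rot t V) \<in> labelled"
    "V \<in> range (\<lambda>t. rot t V)" using X unfolding labelled_class_eq_range[OF X assms] by simp_all
qed

lemma relabel_class:
  assumes "\<sigma> \<in> relabs"
  shows "relabel \<sigma> ` range (\<lambda>t. rot t V) = range (\<lambda>t. rot t (relabel \<sigma> V))"
proof (intro equalityI subsetI)
  fix W assume "W \<in> relabel \<sigma> ` range (\<lambda>t. rot t V)"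
  then obtain t where "W = relabel \<sigma> (rot t V)" by blast
  then show "W \<in> range (\<lambda>t. rot t (relabel \<sigma> V))" unfolding relabel_rotate[OF assms] by blast
next
  fix W assume "W \<in> range (\<lambda>t. rot t (relabel \<sigma> V))"
  then obtain t where "W = rot t (relabel \<sigma> V)" by blast
  \<comment> \<open>A relabeling permutes the rotation angles together with the circles, so every
    \<open>t\<close> arises from some angles on the original circles, namely \<open>t\<close>
    composed with \<open>\<sigma>\<close>.\<close>
  also have "t = (\<lambda>c. (\<lambda>d. t (\<sigma> d)) (inv \<sigma> c))"
    using permutes_inverses(1)[OF relabelingsD(1)[OF assms]] by simp
  finally have "W = relabel \<sigma> (rot (\<lambda>d. t (\<sigma> d)) V)" unfolding relabel_rotate[OF assms] .
  then show "W \<in> relabel \<sigma> ` range (\<lambda>t. rot t V)" by blast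
qed

lemma relabel_orbit:
  assumes X: "X \<in> labelled" "V \<in> X" "V \<in> generic"
  shows "relabel_rel C color len `` {X} = (\<lambda>\<sigma>. relabel \<sigma> ` X) ` relabs"
proof -
  have "relabel \<sigma> ` X \<in> labelled" if "\<sigma> \<in> relabs" for \<sigma>
    unfolding labelled_class_eq_range[OF X] relabel_class[OF that]
    by (rule labelled_class_range(1)[OF generic_relabel[OF that X(3)]])
  then show ?thesis using X(1) unfolding relabel_rel_def by blast
qed

section \<open>Almost every cactus has trivial stabiliser\<close>

text \<open>Two circles of equal length with one gluing point each have equal arcs throughout the
  chart, so distinctness can be demanded almost everywhere only if one of the two arcs lies on a
  circle with at least two gluing points. The condition \<open>2 \<le> card (nbrs E c)\<close>
  expresses this; \<open>d\<close> may be a leaf.\<close>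

definition separated :: "'c set set \<Rightarrow> ('c \<times> 'c \<Rightarrow> real) set" where
  "separated E = {x \<in> chart_domain E. \<forall>c a d b. a \<in> nbrs E c \<longrightarrow> b \<in> nbrs E d \<longrightarrow> (c, a) \<noteq> (d, b) \<longrightarrow>
     2 \<le> card (nbrs E c) \<longrightarrow> arc_weight E x c a \<noteq> arc_weight E x d b}"

text \<open>Arc lengths are affine in the coordinates, with linear part \<open>f\<close> and
  constant part \<open>k\<close>. Equality of two of them is a proper hyperplane once the linear
  parts differ.\<close>

lemma null_sets_equal_arcs:
  assumes t: "tree C E" and ca: "a \<in> nbrs E c" and db: "b \<in> nbrs E d" and ne: "(c, a) \<noteq> (d, b)"
    and deg: "2 \<le> card (nbrs E c)"
  shows "{x \<in> space (Leb (coords E)). arc_weight E x c a = arc_weight E x d b}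
    \<in> null_sets (Leb (coords E))"
proof -
  define f :: "'c \<Rightarrow> 'c \<Rightarrow> 'c \<times> 'c \<Rightarrow> real"
    where "f c a q = (if a = base E c then if fst q = c then - 1 else 0 else if q = (c, a) then 1 else 0)" for c a q
  define k where "k c a = (if a = base E c then len c else 0)" for c a
  note fin = finite_coords[OF t]
  have C: "c \<in> C" "d \<in> C" using nbrs_in_C[OF t] ca db by blast+
  have affine: "arc_weight E x c a = k c a + (\<Sum>q\<in>coords E. f c a q * x q)"
    if "c \<in> C" "a \<in> nbrs E c" for c a and x :: "'c \<times> 'c \<Rightarrow> real"
  proof (cases "a = base E c")
    case True
    have "(\<Sum>q\<in>coords E. f c a q * x q) = (\<Sum>q\<in>Pair c ` (nbrs E c - {base E c}). - x q)"
      using that(1) fin by (intro sum.mono_neutral_cong_right) (auto simp: f_def True coords_def)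
    also have "\<dots> = - (\<Sum>b\<in>nbrs E c - {base E c}. x (c, b))"
      by (subst sum.reindex) (auto simp: inj_on_def sum_negf)
    finally show ?thesis by (simp add: arc_weight_def k_def True)
  next
    case False
    then have "(c, a) \<in> coords E" using that by (simp add: coords_def)
    moreover have "(\<Sum>q\<in>coords E. f c a q * x q) = (\<Sum>q\<in>{(c, a)}. x q)"
      using fin \<open>(c, a) \<in> coords E\<close> False by (intro sum.mono_neutral_cong_right) (auto simp: f_def)
    ultimately show ?thesis using False by (simp add: arc_weight_def k_def)
  qed
  \<comment> \<open>If \<open>(c, a)\<close> is a coordinate, it distinguishes the two linear parts.
    Otherwise the omitted arc of \<open>c\<close> has coefficient -1 at every coordinate of
    \<open>c\<close>: for \<open>d = c\<close> the coordinate \<open>(c, b)\<close> has coefficient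
    1 on the other side, and for \<open>d \<noteq> c\<close> any coordinate of \<open>c\<close>
    works, which exists by \<open>deg\<close>.\<close>
  obtain i where i: "i \<in> coords E" "f c a i - f d b i \<noteq> 0"
  proof (cases "a = base E c")
    case False
    show thesis
      by (rule that[of "(c, a)"]) (use False C ca ne in \<open>auto simp: coords_def f_def\<close>)
  next
    case True
    show thesis
    proof (cases "d = c")
      case True
      then have "b \<noteq> base E c" using ne \<open>a = base E c\<close> by simp
      then show thesis using that[of "(c, b)"] True \<open>a = base E c\<close> C db by (simp add: coords_def f_def)
    next
      case False
      have "\<not> nbrs E c \<subseteq> {base E c}" using deg card_mono[of "{base E c}" "nbrs E c"] by auto
      then obtain e where "e \<in> nbrs E c" "e \<noteq> base E c" by blast
      then show thesis using that[of "(c, e)"] False \<open>a = base E c\<close> C by (auto simp: coords_def f_def)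
    qed
  qed
  have "{x \<in> space (Leb (coords E)). arc_weight E x c a = arc_weight E x d b} =
     {x \<in> space (Leb (coords E)). (\<Sum>q\<in>coords E. (f c a q - f d b q) * x q) = k d b - k c a}"
    using affine[OF C(1) ca] affine[OF C(2) db]
    by (intro Collect_cong conj_cong refl) (auto simp: left_diff_distrib sum_subtractf)
  also have "\<dots> \<in> null_sets (Leb (coords E))"
    using fin i by (rule null_sets_hyperplane)
  finally show ?thesis .
qed

lemma null_sets_not_separated:
  assumes t: "tree C E"
  shows "chart_domain E - separated E \<in> null_sets (Leb (coords E))"
proof -
  let ?M = "Leb (coords E)"
  define P where "P = {((c, a), (d, b)) | c a d b. a \<in> nbrs E c \<and> b \<in> nbrs E d \<and> (c, a) \<noteq> (d, b) \<and> 2 \<le> card (nbrs E c)}"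
  define H where "H r = {x \<in> space ?M. arc_weight E x (fst (fst r)) (snd (fst r)) = arc_weight E x (fst (snd r)) (snd (snd r))}" for r
  have "P \<subseteq> (C \<times> C) \<times> (C \<times> C)" unfolding P_def using nbrs_in_C[OF t] by blast
  then have "finite P" by (rule finite_subset) (simp add: finite_C)
  moreover have "H r \<in> null_sets ?M" if "r \<in> P" for r
  proof -
    from that obtain c a d b where r: "r = ((c, a), (d, b))" "a \<in> nbrs E c" "b \<in> nbrs E d"
      "(c, a) \<noteq> (d, b)" "2 \<le> card (nbrs E c)" unfolding P_def by blast
    show ?thesis unfolding H_def r(1) fst_conv snd_conv by (rule null_sets_equal_arcs[OF t r(2-5)])
  qed
  ultimately have N: "(\<Union>r\<in>P. H r) \<in> null_sets ?M" by (intro null_sets_UN' countable_finite) auto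
  have sub: "chart_domain E \<subseteq> space ?M" by (auto simp: chart_domain_def space_PiM)
  have "chart_domain E - separated E = chart_domain E \<inter> (\<Union>r\<in>P. H r)"
  proof (intro equalityI subsetI)
    fix x assume x: "x \<in> chart_domain E - separated E"
    then obtain c a d b where "a \<in> nbrs E c" "b \<in> nbrs E d" "(c, a) \<noteq> (d, b)"
      "2 \<le> card (nbrs E c)" "arc_weight E x c a = arc_weight E x d b" unfolding separated_def by blast
    then have "((c, a), (d, b)) \<in> P" "x \<in> H ((c, a), (d, b))"
      using x sub unfolding P_def H_def by auto
    then show "x \<in> chart_domain E \<inter> (\<Union>r\<in>P. H r)" using x by blast
  next
    fix x assume x: "x \<in> chart_domain E \<inter> (\<Union>r\<in>P. H r)"
    then obtain r where r: "r \<in> P" "x \<in> H r" by blast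
    then obtain c a d b where "r = ((c, a), (d, b))" "a \<in> nbrs E c" "b \<in> nbrs E d"
      "(c, a) \<noteq> (d, b)" "2 \<le> card (nbrs E c)" unfolding P_def by blast
    moreover from this r have "arc_weight E x c a = arc_weight E x d b" by (simp add: H_def)
    ultimately show "x \<in> chart_domain E - separated E" using x unfolding separated_def by blast
  qed
  then show ?thesis using null_set_Int1[OF N sets_chart_domain[OF t]] by (simp add: Int_commute)
qed

lemma generic_rotate_chart:
  assumes "V \<in> generic"
  shows "arc_type len (rot t V) = arc_type len V"
    "arc_coords len (rot t V) = arc_coords len V"
proof -
  obtain E p where E: "E \<in> trees" and p: "positions E p" and V: "V = gluing E p"
    using generic_cactusE[OF assms] .
  then have tr: "tree C E" by (simp add: colored_trees_def)
  note q = positions_rotate[OF tr p, of t]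
  show type: "arc_type len (rot t V) = arc_type len V"
    unfolding V rotate_gluing by (rule arc_type_rotate[OF tr p])
  have ex: "(\<exists>b. (c, a, b) \<in> arc_type len V) \<longleftrightarrow> a \<in> nbrs E c" for c a
    unfolding V arc_type_gluing[OF tr p] using arc_end_in_gluing[OF tr p] by blast
  then have coords: "coord_arcs (arc_type len V) = coords E"
    using nbrs_in_C[OF tr] by (auto simp: coord_arcs_def coords_def omitted_arc_def base_def)
  show "arc_coords len (rot t V) = arc_coords len V"
    unfolding arc_coords_def type coords
  proof (rule restrict_ext)
    fix r assume "r \<in> coords E"
    then obtain c a where r: "r = (c, a)" "a \<in> nbrs E c" by (auto simp: coords_def)
    show "(case r of (c, c') \<Rightarrow> arc_length len (rot t V) (c, gluing_position (rot t V) c c')) =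
       (case r of (c, c') \<Rightarrow> arc_length len V (c, gluing_position V c c'))"
      using gluing_arc_rotate[OF p r(2), of t]
      unfolding r(1) V rotate_gluing prod.case gluing_position_gluing[OF tr p r(2)] gluing_position_gluing[OF tr q r(2)]
      by (simp add: gluing_arc_def)
  qed
qed

definition separated_classes :: "('c \<times> real) set set set set" where
  "separated_classes = {X \<in> labelled. \<exists>E L x. E \<in> trees \<and> L \<in> orders E \<and>
     x \<in> separated E \<and> normal E L x \<in> X}"

text \<open>Type and coordinates are invariant under rotation, so it does not matter which member of
  a class is charted.\<close>

lemma chart_image_separated:
  assumes E: "E \<in> trees" "L \<in> orders E"
  shows "chart (order_type L) separated_classes = separated E"
proof (intro equalityI subsetI)
  fix x assume "x \<in> chart (order_type L) separated_classes"
  then obtain V X where V: "V \<in> generic" "arc_type len V = order_type L" "x = arc_coords len V"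
    "X \<in> separated_classes" "V \<in> X" unfolding chart_image_def by blast
  then obtain E' L' x' where X: "X \<in> labelled" "E' \<in> trees" "L' \<in> orders E'"
    "x' \<in> separated E'" "normal E' L' x' \<in> X" unfolding separated_classes_def by blast
  have x': "x' \<in> chart_domain E'" using X(4) by (simp add: separated_def)
  obtain t where t: "normal E' L' x' = rot t V"
    using labelled_class_eq_range[OF X(1) V(5,1)] X(5) by blast
  have "arc_type len V = order_type L'" "arc_coords len V = x'"
    using generic_rotate_chart[OF V(1), of t] normal_type[OF X(2,3) x'] normal_coords[OF X(2,3) x'] by (simp_all add: t)
  moreover from this have "E = E'" using order_type_inject[of E E' L L'] E X V(2) by (simp add: colored_trees_def)
  ultimately show "x \<in> separated E" using V(3) X(4) by simp
next
  fix x assume x: "x \<in> separated E"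
  then have x': "x \<in> chart_domain E" by (simp add: separated_def)
  let ?V = "normal E L x"
  note g = normal_generic[OF E x']
  have "range (\<lambda>t. rot t ?V) \<in> separated_classes"
    unfolding separated_classes_def using labelled_class_range[OF g] E x by blast
  then have "?V \<in> \<Union>separated_classes" using labelled_class_range(2)[OF g] by blast
  then show "x \<in> chart (order_type L) separated_classes"
    unfolding chart_image_def
    by (intro image_eqI[of _ _ ?V]) (simp_all add: g normal_type[OF E x'] normal_coords[OF E x'])
qed

lemma AE_separated: "AE X in labelled_measure C color len. X \<in> separated_classes"
proof -
  let ?\<Omega> = "labelled"
  define N where "N = ?\<Omega> - separated_classes"
  have sub: "separated_classes \<subseteq> ?\<Omega>" by (auto simp: separated_classes_def)
  have null: "chart \<tau> N \<in> null_sets (Leb (coord_arcs \<tau>))" for \<tau>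
  proof (cases "\<tau> \<in> types")
    case True
    then obtain E L where E: "E \<in> trees" "L \<in> orders E" "\<tau> = order_type L" by (rule typesE)
    then have t: "tree C E" by (simp add: colored_trees_def)
    show ?thesis
      unfolding N_def chart_image_Diff[OF sub] E(3) chart_image_labelled[OF E(1,2)]
        chart_image_separated[OF E(1,2)] coord_arcs_order_type[OF t E(2)]
      by (rule null_sets_not_separated[OF t])
  next
    case False
    then show ?thesis by (simp add: chart_image_not_type)
  qed
  have N: "N \<in> labelled_sets" using null unfolding labelled_sets_def N_def by (auto simp: null_sets_def)
  have "emeasure (labelled_measure C color len) N = 0"
    unfolding emeasure_labelled_measure[OF N] labelled_volume_def using null by (simp add: null_sets_def)
  then show ?thesis
    using N by (intro AE_I[of _ _ N]) (auto simp: sets_labelled_measure space_labelled_measure N_def)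
qed

text \<open>
  A relabeling that maps a separated cactus to a rotation of itself preserves arc lengths, hence
  fixes every circle with at least two gluing points together with the circles glued to it.
\<close>

lemma separated_relabel_trivial:
  assumes E: "E \<in> trees" and L: "L \<in> orders E" and x: "x \<in> separated E"
    and r: "\<rho> \<in> relabs"
    and eq: "relabel \<rho> (normal E L x) = rot t (normal E L x)"
  shows "\<rho> = id"
proof -
  let ?p = "normal_positions E L x" and ?F = "image \<rho> ` E"
  let ?q = "relabel_positions \<rho> ?p" and ?p' = "rotate_positions t ?p"
  have tr: "tree C E" and col: "\<And>u v. {u, v} \<in> E \<Longrightarrow> color u \<noteq> color v" using E by (auto simp: colored_trees_def)
  have xd: "x \<in> chart_domain E" using x by (simp add: separated_def)
  note rD = relabelingsD[OF r]
  note p = positions_normal[OF tr L xd]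
  note p' = positions_rotate[OF tr p, of t]
  have F: "?F \<in> trees" by (rule colored_trees_relabel[OF r E])
  then have trF: "tree C ?F" by (simp add: colored_trees_def)
  have q: "positions ?F ?q" by (rule positions_relabel[OF r p])
  have g: "gluing ?F ?q = gluing E ?p'" using eq unfolding relabel_gluing[OF rD(3)] rotate_gluing .
  have nb: "nbrs D c = {a. \<exists>v\<in>gluing D s. fst ` v = {c, a}}" for D s c
  proof (intro equalityI subsetI)
    fix a assume "a \<in> nbrs D c"
    then have "{(c, s c a), (a, s a c)} \<in> gluing D s" by (rule gluing_vertex)
    then show "a \<in> {a. \<exists>v\<in>gluing D s. fst ` v = {c, a}}" by (intro CollectI bexI) auto
  next
    fix a assume "a \<in> {a. \<exists>v\<in>gluing D s. fst ` v = {c, a}}"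
    then obtain v where "v \<in> gluing D s" "fst ` v = {c, a}" by blast
    then show "a \<in> nbrs D c" using gluing_fst_edge[of v D s] by (simp add: nbrs_def)
  qed
  \<comment> \<open>Neighbourhoods can be read off the glued graph, and by \<open>g\<close> the
    graph is the same on both sides; thus \<open>\<rho>\<close> is an automorphism of the
    tree.\<close>
  have nbF: "nbrs ?F c = nbrs E c" for c using nb[of ?F c ?q] nb[of E c ?p'] unfolding g by simp
  have arcs: "arc_weight E x (\<rho> c) (\<rho> a) = arc_weight E x c a" and nbr: "\<rho> a \<in> nbrs E (\<rho> c)" if ca: "a \<in> nbrs E c" for c a
  proof -
    have "\<rho> a \<in> nbrs ?F (\<rho> c)" using ca unfolding nbrs_image[OF rD(3)] by simp
    then show n: "\<rho> a \<in> nbrs E (\<rho> c)" unfolding nbF .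
    have c: "c \<in> C" "\<rho> c \<in> C" using nbrs_in_C[OF tr] ca n by blast+
    have "?q (\<rho> c) (\<rho> a) = ?p' (\<rho> c) (\<rho> a)"
      using gluing_position_gluing[OF trF q \<open>\<rho> a \<in> nbrs ?F (\<rho> c)\<close>] gluing_position_gluing[OF tr p' n] unfolding g by simp
    then have "gluing_arc ?F ?q (\<rho> c) (\<rho> a) = gluing_arc E ?p' (\<rho> c) (\<rho> a)"
      unfolding gluing_arc_def g by simp
    then have "gluing_arc E ?p c a = gluing_arc E ?p (\<rho> c) (\<rho> a)"
      unfolding gluing_arc_relabel[OF r] gluing_arc_rotate[OF p n] .
    then show "arc_weight E x (\<rho> c) (\<rho> a) = arc_weight E x c a"
      unfolding gluing_arc_normal[OF tr L xd c(1) ca] gluing_arc_normal[OF tr L xd c(2) n] by simp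
  qed
  have fixed: "\<rho> c = c \<and> \<rho> a = a" if ca: "a \<in> nbrs E c" and deg: "2 \<le> card (nbrs E c)" for c a
  proof (rule ccontr)
    assume "\<not> (\<rho> c = c \<and> \<rho> a = a)"
    then have "(c, a) \<noteq> (\<rho> c, \<rho> a)" by auto
    then have "arc_weight E x c a \<noteq> arc_weight E x (\<rho> c) (\<rho> a)"
      using x ca nbr[OF ca] deg unfolding separated_def by blast
    then show False using arcs[OF ca] by simp
  qed
  have "\<rho> c = c" for c
  proof (cases "c \<in> C")
    case False
    then show ?thesis using permutes_not_in[OF rD(1)] by simp
  next
    case c: True
    obtain u where u: "u \<in> nbrs E c" using nbrs_nonempty[OF tr c] by blast
    have cu: "c \<in> nbrs E u" using u nbrs_sym[of c E u] by simp
    have uC: "u \<in> C" using nbrs_in_C[OF tr u] by simp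
    show ?thesis
    proof (cases "2 \<le> card (nbrs E c) \<or> 2 \<le> card (nbrs E u)")
      case True
      \<comment> \<open>A circle with a single gluing point is fixed as a neighbour of one with at
        least two.\<close>
      then show ?thesis using fixed[OF u] fixed[OF cu] by blast
    next
      case False
      \<comment> \<open>Both degrees are 1, so \<open>c\<close> and \<open>u\<close> are the only
        circles, each with a single arc. Their lengths may coincide; the swap is excluded by the
        colours instead.\<close>
      then have "card (nbrs E c) = 1" "card (nbrs E u) = 1"
        using tree_card_nbrs_pos[OF tr c card_C] tree_card_nbrs_pos[OF tr uC card_C] by linarith+
      then have nc: "nbrs E c = {u}" and nu: "nbrs E u = {c}" using u cu by (auto simp: card_1_singleton_iff)
      have tr': "tree (C - {c}) (E - {{u, c}})" by (rule tree_remove_leaf[OF tr nc])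
      have "nbrs (E - {{u, c}}) u = {}" using nu by (auto simp: nbrs_def)
      moreover have "u \<in> C - {c}" using uC nbrs_in_C[OF tr u] by simp
      ultimately have Cu: "C - {c} = {u}" using tree_nbrs_nonempty[OF tr', of u] by blast
      have "\<rho> c \<in> C" using rD(6) c by blast
      then have "\<rho> c = c \<or> \<rho> c \<in> C - {c}" by simp
      then have "\<rho> c = c \<or> \<rho> c = u" unfolding Cu by simp
      moreover have "color c \<noteq> color u" using u col by (simp add: nbrs_def)
      ultimately show ?thesis using rD(4)[of c] by metis
    qed
  qed
  then show ?thesis by auto
qed

text \<open>Two relabelings with the same image of \<open>X\<close> differ by one that maps
  \<open>V\<close> to a rotation of itself, hence by the identity; the orbit map is
  injective.\<close>

lemma card_orbit_separated:
  assumes "X \<in> separated_classes"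
  shows "card (relabel_rel C color len `` {X}) = card (relabs)"
proof -
  obtain E L x where E: "E \<in> trees" and L: "L \<in> orders E" and x: "x \<in> separated E"
    and X: "X \<in> labelled" "normal E L x \<in> X"
    using assms unfolding separated_classes_def by blast
  define V where "V = normal E L x"
  have V: "V \<in> X" "V \<in> generic"
    using X(2) normal_generic[OF E L] x by (auto simp: V_def separated_def)
  have "inj_on (\<lambda>\<sigma>. relabel \<sigma> ` X) (relabs)"
  proof (rule inj_onI)
    fix \<sigma> \<tau> assume s: "\<sigma> \<in> relabs" and t: "\<tau> \<in> relabs"
      and eq: "relabel \<sigma> ` X = relabel \<tau> ` X"
    have "relabel \<sigma> V \<in> relabel \<tau> ` X" using V(1) unfolding eq[symmetric] by (rule imageI)
    then obtain u where "relabel \<sigma> V = relabel \<tau> (rot u V)"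
      unfolding labelled_class_eq_range[OF X(1) V] by blast
    then have "relabel (inv \<tau> \<circ> \<sigma>) V = rot u V"
      by (simp add: relabel_comp relabel_inv[OF t])
    then have "inv \<tau> \<circ> \<sigma> = id"
      unfolding V_def using relabelings_group(2)[OF relabelings_group(3)[OF t] s]
      by (intro separated_relabel_trivial[OF E L x])
    then have "inv \<tau> (\<sigma> c) = c" for c by (metis comp_apply id_apply)
    then have "\<sigma> c = \<tau> c" for c using permutes_inverses(1)[OF relabelingsD(1)[OF t]] by metis
    then show "\<sigma> = \<tau>" by blast
  qed
  then show ?thesis unfolding relabel_orbit[OF X(1) V] by (rule card_image)
qed

theorem emeasure_cactus_space:
  "emeasure (cactus_measure C color len) (cactus_space C color len) =
    ennreal (tree_sum color C len / real (card (relabs)))"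
proof -
  let ?M = "labelled_measure C color len" and ?n = "card (relabs)"
  have "AE X in ?M. card (relabel_rel C color len `` {X}) = ?n"
    using AE_separated by (rule AE_mp) (simp add: card_orbit_separated)
  then have "emeasure (quotient_measure ?M (relabel_rel C color len)) (space ?M // relabel_rel C color len) =
     ennreal (1 / real ?n) * emeasure ?M (space ?M)"
    by (intro emeasure_quotient_measure) (simp add: space_labelled_measure equiv_relabel)
  then have "emeasure (cactus_measure C color len) (cactus_space C color len) =
     ennreal (1 / real ?n) * ennreal (tree_sum color C len)"
    by (simp add: cactus_measure_def cactus_space_def space_labelled_measure emeasure_labelled_cacti)
  also have "\<dots> = ennreal (1 / real ?n * tree_sum color C len)"
    by (rule ennreal_mult'[symmetric]) simp
  finally show ?thesis by simp
qed

end

section \<open>From one relabeling group to the colours, and the volume formula\<close>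

text \<open>A relabeling preserves every colour class, hence is the same as a family of
  permutations, one for each class, all extended by the identity. A colour in \<open>K\<close>
  without circles contributes a factor 1.\<close>

lemma card_relabelings:
  assumes fin: "finite C" "finite K" and K: "color ` C \<subseteq> K"
  shows "card (relabelings C color len) = (\<Prod>i\<in>K. card {\<sigma>. \<sigma> permutes {c \<in> C. color c = i} \<and>
     (\<forall>c\<in>C. color c = i \<longrightarrow> len (\<sigma> c) = len c)})"
proof -
  define P where "P i = {\<sigma>. \<sigma> permutes {c \<in> C. color c = i} \<and> (\<forall>c\<in>C. color c = i \<longrightarrow> len (\<sigma> c) = len c)}" for i
  define f where "f \<sigma> = (\<lambda>i\<in>K. \<lambda>c. if c \<in> C \<and> color c = i then \<sigma> c else c)" for \<sigma> :: "'a \<Rightarrow> 'a"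
  define g where "g h = (\<lambda>c. if c \<in> C then h (color c) c else c)" for h :: "nat \<Rightarrow> 'a \<Rightarrow> 'a"
  have "bij_betw f (relabelings C color len) (Pi\<^sub>E K P)"
  proof (rule bij_betwI[where g = g])
    show "f \<in> relabelings C color len \<rightarrow> Pi\<^sub>E K P"
    proof
      fix \<sigma> assume "\<sigma> \<in> relabelings C color len"
      then have s: "\<sigma> permutes C" "\<And>c. c \<in> C \<Longrightarrow> color (\<sigma> c) = color c \<and> len (\<sigma> c) = len c"
        by (auto simp: relabelings_def)
      have "f \<sigma> i \<in> P i" if "i \<in> K" for i
      proof -
        let ?S = "{c \<in> C. color c = i}"
        have fi: "f \<sigma> i c = (if c \<in> ?S then \<sigma> c else c)" for c using that by (simp add: f_def)
        have "inj_on (f \<sigma> i) ?S" using permutes_inj[OF s(1)] by (auto simp: inj_on_def fi dest: injD)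
        moreover have "f \<sigma> i ` ?S \<subseteq> ?S" using s(2) permutes_in_image[OF s(1)] by (auto simp: fi)
        ultimately have "bij_betw (f \<sigma> i) ?S ?S" using fin(1) by (simp add: bij_betw_def endo_inj_surj)
        then have "f \<sigma> i permutes ?S" by (rule bij_imp_permutes) (auto simp: fi)
        moreover have "\<forall>c\<in>C. color c = i \<longrightarrow> len (f \<sigma> i c) = len c" using s(2) by (simp add: fi)
        ultimately show ?thesis unfolding P_def by blast
      qed
      then show "f \<sigma> \<in> Pi\<^sub>E K P" by (intro PiE_I) (simp_all add: f_def)
    qed
    show "g \<in> Pi\<^sub>E K P \<rightarrow> relabelings C color len"
    proof
      fix h assume h: "h \<in> Pi\<^sub>E K P"
      have hP: "h i permutes {c \<in> C. color c = i}" "\<And>c. c \<in> C \<Longrightarrow> color c = i \<Longrightarrow> len (h i c) = len c" if "i \<in> K" for i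
        using PiE_mem[OF h that] unfolding P_def by auto
      have inC: "color c \<in> K" if "c \<in> C" for c using that K by blast
      have hc: "g h c \<in> C \<and> color (g h c) = color c \<and> len (g h c) = len c" if "c \<in> C" for c
        using permutes_in_image[OF hP(1)[OF inC[OF that]], of c] hP(2)[OF inC[OF that] that] that by (simp add: g_def)
      have "inj_on (g h) C"
      proof (rule inj_onI)
        fix c d assume cd: "c \<in> C" "d \<in> C" "g h c = g h d"
        then have "color c = color d" using hc by metis
        then have "h (color c) c = h (color c) d" using cd by (simp add: g_def)
        then show "c = d" using permutes_inj[OF hP(1)[OF inC[OF cd(1)]]] by (auto dest: injD)
      qed
      moreover have "g h ` C \<subseteq> C" using hc by blast
      ultimately have "bij_betw (g h) C C" using fin(1) by (simp add: bij_betw_def endo_inj_surj)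
      then have "g h permutes C" by (rule bij_imp_permutes) (simp add: g_def)
      then show "g h \<in> relabelings C color len" unfolding relabelings_def using hc by blast
    qed
    show "g (f \<sigma>) = \<sigma>" if "\<sigma> \<in> relabelings C color len" for \<sigma>
    proof
      fix c
      have "\<sigma> permutes C" using that by (simp add: relabelings_def)
      then show "g (f \<sigma>) c = \<sigma> c" using K permutes_not_in[of \<sigma> C c] by (auto simp: g_def f_def)
    qed
    show "f (g h) = h" if h: "h \<in> Pi\<^sub>E K P" for h
    proof (rule PiE_ext[of _ K "\<lambda>_. UNIV"])
      show "f (g h) \<in> K \<rightarrow>\<^sub>E UNIV" by (simp add: f_def)
      show "h \<in> K \<rightarrow>\<^sub>E UNIV" using h by (auto simp: PiE_iff)
      fix i assume i: "i \<in> K"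
      have "h i permutes {c \<in> C. color c = i}" using PiE_mem[OF h i] unfolding P_def by blast
      then have "h i c = c" if "\<not> (c \<in> C \<and> color c = i)" for c
        using permutes_not_in[of "h i" "{c \<in> C. color c = i}" c] that by simp
      then show "f (g h) i = h i" using i by (auto simp: f_def g_def fun_eq_iff)
    qed
  qed
  then have "card (relabelings C color len) = card (Pi\<^sub>E K P)" by (rule bij_betw_same_card)
  also have "\<dots> = (\<Prod>i\<in>K. card (P i))" by (rule card_PiE[OF fin(2)])
  finally show ?thesis by (simp add: P_def)
qed

theorem theorem3:
  fixes C :: "'c set" and color :: "'c \<Rightarrow> nat" and len :: "'c \<Rightarrow> real"
    and k :: nat and m :: "nat \<Rightarrow> nat" and li :: "nat \<Rightarrow> real" and l :: real
    and aut :: "nat \<Rightarrow> nat"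
  assumes "k \<ge> 2"
    and "finite C" and "color ` C \<subseteq> {1..k}" and "\<forall>c\<in>C. len c > 0"
    and "\<forall>i\<in>{1..k}. m i = card {c \<in> C. color c = i}" and "\<forall>i\<in>{1..k}. m i \<ge> 1"
    and "\<forall>i\<in>{1..k}. li i = (\<Sum>c | c \<in> C \<and> color c = i. len c)"
    and "l = (\<Sum>i=1..k. li i)"
    and "\<forall>i\<in>{1..k}. aut i =
           card {\<sigma>. \<sigma> permutes {c \<in> C. color c = i} \<and>
                    (\<forall>c\<in>C. color c = i \<longrightarrow> len (\<sigma> c) = len c)}"
  shows "emeasure (cactus_measure C color len) (cactus_space C color len) =
           ennreal (l ^ (k - 2) * (\<Prod>i=1..k. (l - li i) ^ (m i - 1) / real (aut i)))"
proof -
  \<comment> \<open>As \<open>m i \<ge> 1\<close>, every colour occurs. So the number of colours is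
    exactly \<open>k\<close>, as the exponent \<open>k - 2\<close> requires, and
    \<open>k \<ge> 2\<close> provides at least two circles.\<close>
  have K: "color ` C = {1..k}"
  proof (intro equalityI subsetI)
    fix i assume i: "i \<in> {1..k}"
    then have "card {c \<in> C. color c = i} \<noteq> 0" using assms(5,6) by force
    then have "{c \<in> C. color c = i} \<noteq> {}" by (metis card.empty)
    then show "i \<in> color ` C" by blast
  qed (use assms(3) in blast)
  have "card (color ` C) \<le> card C" using assms(2) by (rule card_image_le)
  then interpret circles C color len using assms(1,2,4) K by unfold_locales auto
  have l: "l = sum len C"
  proof -
    have "l = (\<Sum>i=1..k. \<Sum>c | c \<in> C \<and> color c = i. len c)" unfolding assms(8) using assms(7) by (intro sum.cong) auto
    also have "\<dots> = sum len C" unfolding K[symmetric] by (rule sum.image_gen[OF assms(2), symmetric])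
    finally show ?thesis .
  qed
  have "tree_sum color C len = class_product color C len"
    using assms(1,2) K by (intro tree_sum_eq_class_product) auto
  also have "\<dots> = l ^ (k - 2) * (\<Prod>i=1..k. (l - li i) ^ (m i - 1))"
    unfolding class_product_def K l using assms(5,7) by (auto intro!: prod.cong)
  finally have vol: "tree_sum color C len = l ^ (k - 2) * (\<Prod>i=1..k. (l - li i) ^ (m i - 1))" .
  have aut: "card (relabelings C color len) = (\<Prod>i=1..k. aut i)"
    using card_relabelings[OF assms(2) finite_atLeastAtMost assms(3), of len] assms(9) by simp
  show ?thesis
    unfolding emeasure_cactus_space vol aut by (simp add: prod_dividef)
qed

end
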